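(* Let $L\subseteq\{0,1\}^*\times\mathbb{N}$ be a parameterized language. The following are equivalent: (1) $L\in{\sf W[P]}\text{-}{\sf PFPT}$; (2) there is a $k$-restricted Turing machine $M$ such that $(x,k)\in L\iff \#\mathrm{acc}_M(x,k)-\#\mathrm{rej}_M(x,k)>0$; (3) there is a function $F\in{\sf Gap}\text{-}{\sf FPT}$ such that $(x,k)\in L\iff F(x,k)>0$; (4) there are a parameterized language $B\in{\sf FPT}$ (of triples $\langle x,y,k\rangle$) and a computable $f$ such that, with $P(n,k)=f(k)\log n$, $(x,k)\in L\iff |\{y\in\{0,1\}^{P(|x|,k)} : \langle x,y,k\rangle\in B\}|\ge 2^{P(|x|,k)-1}+1$.
   Context: Parameterized problems have inputs $(x,k)\in\{0,1\}^*\times\mathbb{N}$ with $n=|x|$ and parameter $k$. ${\sf FPT}$ is the class of parameterized languages decidable deterministically in time $h(k)\,|x|^c$ for some computable $h$ and constant $c$. A $k$-restricted Turing machine is a nondeterministic Turing machine which, for some computable functions $f,g$, runs in time $g(k)\,\mathrm{poly}(n)$ and makes at most $f(k)\log n$ nondeterministic (binary) moves on every computation path; a $k$-restricted probabilistic Turing machine is the same with the nondeterministic moves replaced by fair random coin flips. For a nondeterministic machine $M$, $\#\mathrm{acc}_M(x,k)$ and $\#\mathrm{rej}_M(x,k)$ denote the numbers of accepting and rejecting paths. ${\sf Gap}\text{-}{\sf FPT}$ is the class of functions $F:\{0,1\}^*\times\mathbb{N}\to\mathbb{Z}$ with $F(x,k)=\#\mathrm{acc}_M(x,k)-\#\mathrm{rej}_M(x,k)$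 for some $k$-restricted machine $M$. ${\sf W[P]}\text{-}{\sf PFPT}$ is the class of parameterized languages $L$ for which there is a $k$-restricted probabilistic Turing machine $M$ such that $(x,k)\in L\Rightarrow \Pr[M\text{ accepts }(x,k)]>1/2$ and $(x,k)\notin L\Rightarrow\Pr[M\text{ accepts }(x,k)]\le 1/2$.
   Formalization: Here log n is read as the logarithm to base 2 rounded up, and as 1 when n ≤ 1; with log 1 = 0, P(1,k) = 0 and the bound in (4) is 3/2, so (4) would exclude every x of length 1 and fail for the language of all pairs, while log 0 is undefined. *)

theory Defs
  imports Complex_Main
begin

text \<open>Single-tape Turing machines over a finite tape alphabet {0..<num_symbols}
  (0 = blank, 1 = bit False, 2 = bit True, 3 = separator) and a finite state set
  {0..<num_states} (0 = start, 1 = accept, 2 = reject).  In every non-halting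
  state the transition list for the scanned symbol has one entry (deterministic
  move) or two entries (binary nondeterministic move / fair coin flip).\<close>

datatype dir = Lft | Stay | Rgt

record tm =
  num_states :: nat
  num_symbols :: nat
  delta :: "nat \<Rightarrow> nat \<Rightarrow> (nat \<times> nat \<times> dir) list"

record config =
  st :: nat
  tape :: "int \<Rightarrow> nat"
  pos :: int

definition start_state :: nat where "start_state = 0"
definition acc_state :: nat where "acc_state = 1"
definition rej_state :: nat where "rej_state = 2"

definition halted :: "config \<Rightarrow> bool" where
  "halted c \<longleftrightarrow> st c = acc_state \<or> st c = rej_state"

definition wf_tm :: "tm \<Rightarrow> bool" where
  "wf_tm M \<longleftrightarrow> num_states M \<ge> 3 \<and> num_symbols M \<ge> 4 \<and>
     (\<forall>q < num_states M. \<forall>a < num_symbols M. q \<noteq> acc_state \<and> q \<noteq> rej_state \<longrightarrow>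
        (length (delta M q a) = 1 \<or> length (delta M q a) = 2) \<and>
        (\<forall>(q', b, d) \<in> set (delta M q a). q' < num_states M \<and> b < num_symbols M))"

definition deterministic :: "tm \<Rightarrow> bool" where
  "deterministic M \<longleftrightarrow> (\<forall>q a. length (delta M q a) \<le> 1)"

fun move :: "dir \<Rightarrow> int" where
  "move Lft = -1" | "move Stay = 0" | "move Rgt = 1"

definition apply_tr :: "nat \<times> nat \<times> dir \<Rightarrow> config \<Rightarrow> config" where
  "apply_tr tr c = (case tr of (q', b, d) \<Rightarrow>
     \<lparr>st = q', tape = (tape c)(pos c := b), pos = pos c + move d\<rparr>)"

text \<open>reach M c bs t c': starting in c, the machine runs t steps and reaches c',
  where bs lists the choices made at the nondeterministic (binary) steps, in order.
  Every computation path is thus identified with its list of choice bits.\<close>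

inductive reach :: "tm \<Rightarrow> config \<Rightarrow> bool list \<Rightarrow> nat \<Rightarrow> config \<Rightarrow> bool" for M where
  refl: "reach M c [] 0 c"
| det: "\<not> halted c \<Longrightarrow> delta M (st c) (tape c (pos c)) = [tr] \<Longrightarrow>
        reach M (apply_tr tr c) bs t c' \<Longrightarrow> reach M c bs (Suc t) c'"
| nondet: "\<not> halted c \<Longrightarrow> delta M (st c) (tape c (pos c)) = [tr0, tr1] \<Longrightarrow>
        reach M (apply_tr (if b then tr1 else tr0) c) bs t c' \<Longrightarrow> reach M c (b # bs) (Suc t) c'"

fun bsym :: "bool \<Rightarrow> nat" where
  "bsym False = 1" | "bsym True = 2"

fun bits :: "nat \<Rightarrow> bool list" where
  "bits k = (if k = 0 then [] else odd k # bits (k div 2))"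

definition input_syms :: "bool list list \<Rightarrow> nat \<Rightarrow> nat list" where
  "input_syms ws k = concat (map (\<lambda>w. map bsym w @ [3]) ws) @ map bsym (bits k)"

definition init :: "bool list list \<Rightarrow> nat \<Rightarrow> config" where
  "init ws k = \<lparr>st = start_state,
     tape = (\<lambda>i. if 0 \<le> i \<and> i < int (length (input_syms ws k))
                 then input_syms ws k ! nat i else 0),
     pos = 0\<rparr>"

text \<open>A total function f is computable iff its graph is decidable by a deterministic
  machine that halts on every input (k is given as parameter, m as the input string).\<close>
definition computable :: "(nat \<Rightarrow> nat) \<Rightarrow> bool" where
  "computable f \<longleftrightarrow> (\<exists>M. wf_tm M \<and> deterministic M \<and>
     (\<forall>k m. \<exists>bs t c. reach M (init [bits m] k) bs t c \<and> halted c \<and>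
         (st c = acc_state \<longleftrightarrow> f k = m)))"

definition fpt_via :: "('a \<Rightarrow> bool list list) \<Rightarrow> ('a \<times> nat) set \<Rightarrow> bool" where
  "fpt_via enc L \<longleftrightarrow> (\<exists>M h c. wf_tm M \<and> deterministic M \<and> computable h \<and>
     (\<forall>a k. \<exists>bs t cf. reach M (init (enc a) k) bs t cf \<and> halted cf \<and>
         t \<le> h k * (sum_list (map length (enc a)) + 1) ^ c \<and>
         (st cf = acc_state \<longleftrightarrow> (a, k) \<in> L)))"

abbreviation FPT :: "(bool list \<times> nat) set \<Rightarrow> bool" where
  "FPT L \<equiv> fpt_via (\<lambda>x. [x]) L"

abbreviation FPT3 :: "((bool list \<times> bool list) \<times> nat) set \<Rightarrow> bool" where
  "FPT3 B \<equiv> fpt_via (\<lambda>(x, y). [x, y]) B"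

text \<open>log n, rounded up, with the convention log n = 1 for n \<le> 1 (so that
  f(k) log n is a natural number).\<close>
definition clog :: "nat \<Rightarrow> nat" where
  "clog n = (if n \<le> 1 then 1 else nat \<lceil>log 2 (real n)\<rceil>)"

definition k_restricted :: "tm \<Rightarrow> bool" where
  "k_restricted M \<longleftrightarrow> wf_tm M \<and> (\<exists>f g c. computable f \<and> computable g \<and>
     (\<forall>x k bs t cf. reach M (init [x] k) bs t cf \<longrightarrow>
        t \<le> g k * (length x + 1) ^ c \<and> length bs \<le> f k * clog (length x)))"

definition acc_paths :: "tm \<Rightarrow> bool list \<Rightarrow> nat \<Rightarrow> bool list set" where
  "acc_paths M x k = {bs. \<exists>t cf. reach M (init [x] k) bs t cf \<and> st cf = acc_state}"

definition rej_paths :: "tm \<Rightarrow> bool list \<Rightarrow> nat \<Rightarrow> bool list set" where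
  "rej_paths M x k = {bs. \<exists>t cf. reach M (init [x] k) bs t cf \<and> st cf = rej_state}"

definition num_acc :: "tm \<Rightarrow> bool list \<Rightarrow> nat \<Rightarrow> nat" where
  "num_acc M x k = card (acc_paths M x k)"

definition num_rej :: "tm \<Rightarrow> bool list \<Rightarrow> nat \<Rightarrow> nat" where
  "num_rej M x k = card (rej_paths M x k)"

definition prob_acc :: "tm \<Rightarrow> bool list \<Rightarrow> nat \<Rightarrow> real" where
  "prob_acc M x k = (\<Sum>bs \<in> acc_paths M x k. (1/2) ^ length bs)"

definition GapFPT :: "(bool list \<Rightarrow> nat \<Rightarrow> int) \<Rightarrow> bool" where
  "GapFPT F \<longleftrightarrow> (\<exists>M. k_restricted M \<and>
     (\<forall>x k. F x k = int (num_acc M x k) - int (num_rej M x k)))"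

definition WP_PFPT :: "(bool list \<times> nat) set \<Rightarrow> bool" where
  "WP_PFPT L \<longleftrightarrow> (\<exists>M. k_restricted M \<and>
     (\<forall>x k. ((x, k) \<in> L \<longrightarrow> prob_acc M x k > 1/2) \<and>
            ((x, k) \<notin> L \<longrightarrow> prob_acc M x k \<le> 1/2)))"

end

theory Submission
  imports Defs
begin

text \<open>
  Programs over finitely many stacks, with pushing, coin flips and loops as primitives, are
  compiled to single-tape machines with quadratic slowdown, so machines can be built by programming.

  From a path-counting machine to a majority over strings: a machine run on choice bits \<open>y\<close> uses a prefix
  of \<open>y\<close>. Accepting according to that run alone yields \<open>2\<^sup>P\<close> times the acceptance
  probability; deciding half of the unused suffixes positively and a single exceptional suffix by the
  outcome of the run yields \<open>2\<^sup>P\<^sup>-\<^sup>1\<close> plus the gap. Neither needs \<open>P\<close> to be computed.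

  From a majority back to machines: a machine that flips exactly \<open>P = f k * clog n\<close> coins on every path
  and then decides membership in \<open>B\<close> has uniform paths, so its acceptance probability and its gap
  both express the majority. The value \<open>f k\<close> is found by running the decider for the graph of \<open>f\<close>
  on 0, 1, 2, and so on.

  The running time of that search has to be bounded by a computable function. A function of the form
  \<open>2\<^sup>T\<close>, with \<open>T\<close> a running time, has a decidable graph: the binary digits of a power
  of two are a string of zeros and a one, which serves as a clock.
\<close>

section \<open>Stack programs\<close>

text \<open>Computability is a property of the graph of a function, so a computable function is
  evaluated only by search, and deciders for a sum, a product or a running time do not come for
  free. Time and choice bounds only have to hold from above, so the proof works with functions that
  have some computable upper bound (\<open>bounded\<close>); one family of deciders, for powers of
  two with running times in the exponent, yields all the closure properties.

  A second obstacle is that \<open>k_restricted\<close> speaks of all runs, including unfinished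
  ones, while a program is verified along single terminating runs. Runs whose choice strings have a
  common extension are comparable, so a halting run for every string of a prescribed length
  determines all the others.

  A third is that a gap counts every path once, whereas a path with choices \<open>bs\<close> owns
  \<open>2 ^ (P - length bs)\<close> of the strings of length \<open>P\<close>. This weight has to
  cancel: a path accepts half of its strings, up to one string that carries the sign. By Kraft's
  equality the halves add up to a constant, whatever the shape of the computation tree.\<close>

text \<open>\<open>Loop j P f\<close> pops a symbol \<open>s\<close> from stack \<open>j\<close>, runs \<open>f s\<close>, and repeats if \<open>P s\<close>
  holds. Popping an empty stack gives 0, a symbol that is never pushed.\<close>

datatype com = Skip | Push nat nat | Flip nat | Seq com com (infixr ";;" 60)
  | Loop nat "nat \<Rightarrow> bool" "nat \<Rightarrow> com"

type_synonym store = "nat \<Rightarrow> nat list"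

definition hd0 :: "nat list \<Rightarrow> nat" where
  "hd0 xs = (case xs of [] \<Rightarrow> 0 | a # _ \<Rightarrow> a)"

lemma hd0_simps [simp]: "hd0 [] = 0" "hd0 (a # xs) = a"
  by (simp_all add: hd0_def)

text \<open>Only terminating runs have a derivation, so exhibiting a run settles termination as
  well. Costs ignore stack heights; the walk to the top of a stack is charged by
  \<open>tm_time\<close>.\<close>

inductive exec :: "com \<Rightarrow> store \<Rightarrow> bool list \<Rightarrow> nat \<Rightarrow> store \<Rightarrow> bool" where
  Skip: "exec Skip \<sigma> [] 1 \<sigma>"
| Push: "exec (Push j a) \<sigma> [] 1 (\<sigma>(j := a # \<sigma> j))"
| Flip: "exec (Flip j) \<sigma> [b] 2 (\<sigma>(j := bsym b # \<sigma> j))"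
| Seq: "exec c \<sigma> bs t \<sigma>' \<Longrightarrow> exec d \<sigma>' bs' t' \<sigma>'' \<Longrightarrow> exec (c ;; d) \<sigma> (bs @ bs') (t + t' + 1) \<sigma>''"
| Exit: "\<not> P (hd0 (\<sigma> j)) \<Longrightarrow> exec (f (hd0 (\<sigma> j))) (\<sigma>(j := tl (\<sigma> j))) bs t \<sigma>' \<Longrightarrow>
    exec (Loop j P f) \<sigma> bs (t + 1) \<sigma>'"
| Again: "P (hd0 (\<sigma> j)) \<Longrightarrow> exec (f (hd0 (\<sigma> j))) (\<sigma>(j := tl (\<sigma> j))) bs t \<sigma>' \<Longrightarrow>
    exec (Loop j P f) \<sigma>' bs' t' \<sigma>'' \<Longrightarrow> exec (Loop j P f) \<sigma> (bs @ bs') (t + t' + 1) \<sigma>''"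

text \<open>Loop bodies are functions of the popped symbol, and only their values at symbols below
  \<open>A\<close> are constrained; this is what keeps the compiled control finite.\<close>

primrec wfc :: "nat \<Rightarrow> nat \<Rightarrow> com \<Rightarrow> bool" where
  "wfc K A Skip \<longleftrightarrow> True"
| "wfc K A (Push j a) \<longleftrightarrow> j < K \<and> 0 < a \<and> a < A"
| "wfc K A (Flip j) \<longleftrightarrow> j < K"
| "wfc K A (c ;; d) \<longleftrightarrow> wfc K A c \<and> wfc K A d"
| "wfc K A (Loop j P f) \<longleftrightarrow> j < K \<and> (\<forall>s<A. wfc K A (f s))"

primrec flipfree :: "nat \<Rightarrow> com \<Rightarrow> bool" where
  "flipfree A Skip \<longleftrightarrow> True"
| "flipfree A (Push j a) \<longleftrightarrow> True"
| "flipfree A (Flip j) \<longleftrightarrow> False"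
| "flipfree A (c ;; d) \<longleftrightarrow> flipfree A c \<and> flipfree A d"
| "flipfree A (Loop j P f) \<longleftrightarrow> (\<forall>s<A. flipfree A (f s))"

section \<open>Machines over arbitrary finite sets of states and symbols\<close>

text \<open>There is no halting test: a state halts when it has no transitions. States and symbols
  may have any type, so that control can be a list of commands and a cell a family of
  tracks.\<close>

inductive areach :: "('q \<Rightarrow> 'a \<Rightarrow> ('q \<times> 'a \<times> dir) list) \<Rightarrow> 'q \<times> (int \<Rightarrow> 'a) \<times> int \<Rightarrow>
    bool list \<Rightarrow> nat \<Rightarrow> 'q \<times> (int \<Rightarrow> 'a) \<times> int \<Rightarrow> bool" for \<delta> where
  refl: "areach \<delta> C [] 0 C"
| det: "\<delta> q (T p) = [(q', a, d)] \<Longrightarrow> areach \<delta> (q', T(p := a), p + move d) bs t C \<Longrightarrow>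
    areach \<delta> (q, T, p) bs (Suc t) C"
| nondet: "\<delta> q (T p) = [tr0, tr1] \<Longrightarrow> (if b then tr1 else tr0) = (q', a, d) \<Longrightarrow>
    areach \<delta> (q', T(p := a), p + move d) bs t C \<Longrightarrow> areach \<delta> (q, T, p) (b # bs) (Suc t) C"

lemma areach_trans:
  "areach \<delta> C bs t C' \<Longrightarrow> areach \<delta> C' bs' t' C'' \<Longrightarrow> areach \<delta> C (bs @ bs') (t + t') C''"
proof (induction rule: areach.induct)
  case (det q T p q' a d bs t C)
  then show ?case using areach.det[of \<delta> q T p q' a d "bs @ bs'" "t + t'" C''] by simp
next
  case (nondet q T p tr0 tr1 b q' a d bs t C)
  then show ?case using areach.nondet[of \<delta> q T p tr0 tr1 b q' a d "bs @ bs'" "t + t'" C''] by simp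
qed simp

definition idx :: "'a list \<Rightarrow> 'a \<Rightarrow> nat" where
  "idx xs a = (THE i. i < length xs \<and> xs ! i = a)"

lemma idx_nth: "distinct xs \<Longrightarrow> i < length xs \<Longrightarrow> idx xs (xs ! i) = i"
  unfolding idx_def by (rule the_equality) (auto simp: nth_eq_iff_index_eq)

lemma idx_less: "distinct xs \<Longrightarrow> a \<in> set xs \<Longrightarrow> idx xs a < length xs"
  and nth_idx: "distinct xs \<Longrightarrow> a \<in> set xs \<Longrightarrow> xs ! idx xs a = a"
  by (metis idx_nth in_set_conv_nth)+

text \<open>The lists fix the numbering, so their first entries have to follow the conventions for
  \<open>tm\<close>: start, accepting and rejecting state; blank, False, True and separator.\<close>

definition encode :: "'q list \<Rightarrow> 'a list \<Rightarrow> ('q \<Rightarrow> 'a \<Rightarrow> ('q \<times> 'a \<times> dir) list) \<Rightarrow> tm" where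
  "encode qs ss \<delta> = \<lparr>num_states = length qs, num_symbols = length ss,
     delta = (\<lambda>q a. if q < length qs \<and> a < length ss
       then map (\<lambda>(q', b, d). (idx qs q', idx ss b, d)) (\<delta> (qs ! q) (ss ! a)) else [])\<rparr>"

locale finite_machine =
  fixes qs :: "'q list" and ss :: "'a list" and \<delta> :: "'q \<Rightarrow> 'a \<Rightarrow> ('q \<times> 'a \<times> dir) list"
  assumes dq: "distinct qs" and ds: "distinct ss" and lq: "length qs \<ge> 3" and ls: "length ss \<ge> 4"
    and len: "\<And>q a. q \<in> set qs \<Longrightarrow> a \<in> set ss \<Longrightarrow> q \<noteq> qs ! 1 \<Longrightarrow> q \<noteq> qs ! 2 \<Longrightarrow>
      length (\<delta> q a) = 1 \<or> length (\<delta> q a) = 2"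
    and closed: "\<And>q a q' b d. q \<in> set qs \<Longrightarrow> a \<in> set ss \<Longrightarrow> (q', b, d) \<in> set (\<delta> q a) \<Longrightarrow>
      q' \<in> set qs \<and> b \<in> set ss"
    and halt: "\<And>a. \<delta> (qs ! 1) a = []" "\<And>a. \<delta> (qs ! 2) a = []"
begin

lemma wf_encode: "wf_tm (encode qs ss \<delta>)"
  unfolding wf_tm_def
proof (intro conjI allI impI)
  fix q a assume q: "q < num_states (encode qs ss \<delta>)" and a: "a < num_symbols (encode qs ss \<delta>)"
    and n: "q \<noteq> acc_state \<and> q \<noteq> rej_state"
  have mem: "qs ! q \<in> set qs" "ss ! a \<in> set ss" using q a by (auto simp: encode_def)
  have ne: "qs ! q \<noteq> qs ! 1" "qs ! q \<noteq> qs ! 2"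
    using n q lq by (auto simp: encode_def acc_state_def rej_state_def nth_eq_iff_index_eq[OF dq])
  show "length (delta (encode qs ss \<delta>) q a) = 1 \<or> length (delta (encode qs ss \<delta>) q a) = 2"
    using len[OF mem ne] q a by (simp add: encode_def)
  show "\<forall>(q', b, d) \<in> set (delta (encode qs ss \<delta>) q a).
      q' < num_states (encode qs ss \<delta>) \<and> b < num_symbols (encode qs ss \<delta>)"
    using closed[OF mem] q a by (auto simp: encode_def intro!: idx_less dq ds)
qed (use lq ls in \<open>auto simp: encode_def\<close>)

lemma deterministic_encode:
  "(\<And>q a. q \<in> set qs \<Longrightarrow> a \<in> set ss \<Longrightarrow> length (\<delta> q a) \<le> 1) \<Longrightarrow> deterministic (encode qs ss \<delta>)"
  by (auto simp: deterministic_def encode_def)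

definition config_of :: "'q \<times> (int \<Rightarrow> 'a) \<times> int \<Rightarrow> config" where
  "config_of = (\<lambda>(q, T, p). \<lparr>st = idx qs q, tape = (\<lambda>i. idx ss (T i)), pos = p\<rparr>)"

lemma delta_encode:
  "q \<in> set qs \<Longrightarrow> a \<in> set ss \<Longrightarrow> delta (encode qs ss \<delta>) (idx qs q) (idx ss a) =
     map (\<lambda>(q', b, d). (idx qs q', idx ss b, d)) (\<delta> q a)"
  by (simp add: encode_def idx_less nth_idx dq ds)

lemma not_halted: "q \<in> set qs \<Longrightarrow> \<delta> q a \<noteq> [] \<Longrightarrow> \<not> halted (config_of (q, T, p))"
  using halt nth_idx[OF dq, of q]
  by (auto simp: halted_def config_of_def acc_state_def rej_state_def)

lemma apply_config_of:
  "apply_tr (idx qs q', idx ss a, d) (config_of (q, T, p)) = config_of (q', T(p := a), p + move d)"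
  by (auto simp: apply_tr_def config_of_def)

lemma areach_reach:
  "areach \<delta> C bs t C' \<Longrightarrow> fst C \<in> set qs \<Longrightarrow> (\<And>i. fst (snd C) i \<in> set ss) \<Longrightarrow>
     reach (encode qs ss \<delta>) (config_of C) bs t (config_of C')"
proof (induction rule: areach.induct)
  case (refl C)
  show ?case by (rule reach.refl)
next
  case (det q T p q' a d bs t C)
  have q: "q \<in> set qs" and T: "T i \<in> set ss" for i using det.prems by auto
  have c: "q' \<in> set qs" "a \<in> set ss" using closed[OF q T, of q' a d p] det.hyps(1) by auto
  show ?case
  proof (rule reach.det)
    show "\<not> halted (config_of (q, T, p))" using det.hyps(1) q not_halted[of q "T p"] by auto
    show "delta (encode qs ss \<delta>) (st (config_of (q, T, p)))
        (tape (config_of (q, T, p)) (pos (config_of (q, T, p)))) = [(idx qs q', idx ss a, d)]"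
      using det.hyps(1) q T by (simp add: config_of_def delta_encode)
    show "reach (encode qs ss \<delta>) (apply_tr (idx qs q', idx ss a, d) (config_of (q, T, p))) bs t
        (config_of C)"
      unfolding apply_config_of using det.IH c T by auto
  qed
next
  case (nondet q T p tr0 tr1 b q' a d bs t C)
  let ?e = "\<lambda>(q', b, d). (idx qs q', idx ss b, d)"
  have q: "q \<in> set qs" and T: "T i \<in> set ss" for i using nondet.prems by auto
  have c: "q' \<in> set qs" "a \<in> set ss" using closed[OF q T, of q' a d p] nondet.hyps(1,2)
    by (auto split: if_splits)
  show ?case
  proof (rule reach.nondet)
    show "\<not> halted (config_of (q, T, p))" using nondet.hyps(1) q not_halted[of q "T p"] by auto
    show "delta (encode qs ss \<delta>) (st (config_of (q, T, p)))
        (tape (config_of (q, T, p)) (pos (config_of (q, T, p)))) = [?e tr0, ?e tr1]"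
      using nondet.hyps(1) q T by (simp add: config_of_def delta_encode)
    have "(if b then ?e tr1 else ?e tr0) = (idx qs q', idx ss a, d)"
      using nondet.hyps(2) by (auto split: if_splits)
    then show "reach (encode qs ss \<delta>) (apply_tr (if b then ?e tr1 else ?e tr0) (config_of (q, T, p))) bs t
        (config_of C)"
      using nondet.IH c T by (simp add: apply_config_of)
  qed
qed

end

section \<open>Compiling stack programs to single-tape machines\<close>

text \<open>Stack \<open>j\<close> is track \<open>j\<close> of the tape, with its bottom at cell 0, which carries a mark. An untouched
  input cell is a cell with only track 0 in use, so initially stack 0 holds the reversed input. Control
  is the list of remaining commands; a program accepts if it ends with a nonempty stack 0.\<close>

datatype ctl = Run "com list" | Seek "com list" | Take "com list" | Back "com list" | Boot | Yes | No

type_synonym cell = "bool \<times> (nat \<Rightarrow> nat)"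

definition cont :: "nat \<Rightarrow> (nat \<Rightarrow> bool) \<Rightarrow> (nat \<Rightarrow> com) \<Rightarrow> com list \<Rightarrow> nat \<Rightarrow> com list" where
  "cont j P f \<kappa> s = f s # (if P s then Loop j P f # \<kappa> else \<kappa>)"

text \<open>Between commands the head rests on cell 0. The top of stack \<open>j\<close> is the last
  nonzero entry of track \<open>j\<close>, so \<open>Seek\<close> walks right to the first zero of
  the track and \<open>Back\<close> returns to the mark. A pop turns back one cell in
  \<open>Take\<close>; a zero on the marked cell itself means that the stack is empty. A flip
  becomes a push of 1 or 2, the only branching.\<close>

fun stp :: "com \<Rightarrow> ctl \<Rightarrow> cell \<Rightarrow> (ctl \<times> cell \<times> dir) list" where
  "stp c (Run []) x = [(if snd x 0 = 0 then No else Yes, x, Stay)]"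
| "stp c (Run (Skip # \<kappa>)) x = [(Run \<kappa>, x, Stay)]"
| "stp c (Run (Push j a # \<kappa>)) x = [(Seek (Push j a # \<kappa>), x, Stay)]"
| "stp c (Run (Flip j # \<kappa>)) x = [(Run (Push j 1 # \<kappa>), x, Stay), (Run (Push j 2 # \<kappa>), x, Stay)]"
| "stp c (Run ((c1 ;; c2) # \<kappa>)) x = [(Run (c1 # c2 # \<kappa>), x, Stay)]"
| "stp c (Run (Loop j P f # \<kappa>)) x = [(Seek (Loop j P f # \<kappa>), x, Stay)]"
| "stp c (Seek (Push j a # \<kappa>)) x = [if snd x j = 0
     then (Back \<kappa>, (fst x, (snd x)(j := a)), Stay) else (Seek (Push j a # \<kappa>), x, Rgt)]"
| "stp c (Seek (Loop j P f # \<kappa>)) x = [if snd x j = 0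
     then (if fst x then (Run (cont j P f \<kappa> 0), x, Stay) else (Take (Loop j P f # \<kappa>), x, Lft))
     else (Seek (Loop j P f # \<kappa>), x, Rgt)]"
| "stp c (Seek \<kappa>) x = [(No, x, Stay)]"
| "stp c (Take (Loop j P f # \<kappa>)) x = [(Back (cont j P f \<kappa> (snd x j)), (fst x, (snd x)(j := 0)), Stay)]"
| "stp c (Take \<kappa>) x = [(No, x, Stay)]"
| "stp c (Back \<kappa>) x = [if fst x then (Run \<kappa>, x, Stay) else (Back \<kappa>, x, Lft)]"
| "stp c Boot x = [(Run [c], (True, snd x), Stay)]"
| "stp c Yes x = []"
| "stp c No x = []"

section \<open>Stores as tapes, and the cost of a push and a pop\<close>

definition rep :: "store \<Rightarrow> int \<Rightarrow> cell" where
  "rep \<sigma> i = (i = 0, \<lambda>j. if 0 \<le> i \<and> nat i < length (\<sigma> j) then rev (\<sigma> j) ! nat i else 0)"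

lemma rep_push: "(rep \<sigma>)(int (length (\<sigma> j)) :=
    (fst (rep \<sigma> (int (length (\<sigma> j)))), (snd (rep \<sigma> (int (length (\<sigma> j)))))(j := a))) =
    rep (\<sigma>(j := a # \<sigma> j))"
  by (rule ext) (auto simp: rep_def fun_eq_iff nth_append)

lemma rep_pop: "\<sigma> j \<noteq> [] \<Longrightarrow> (rep \<sigma>)(int (length (\<sigma> j)) - 1 :=
    (fst (rep \<sigma> (int (length (\<sigma> j)) - 1)), (snd (rep \<sigma> (int (length (\<sigma> j)) - 1)))(j := 0))) =
    rep (\<sigma>(j := tl (\<sigma> j)))"
proof -
  assume "\<sigma> j \<noteq> []"
  then obtain a xs where e: "\<sigma> j = a # xs" by (cases "\<sigma> j") auto
  then show ?thesis
    by (intro ext) (auto simp: rep_def fun_eq_iff nth_append)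
qed

lemma rep_top: "\<sigma> j \<noteq> [] \<Longrightarrow> snd (rep \<sigma> (int (length (\<sigma> j)) - 1)) j = hd0 (\<sigma> j)"
  by (cases "\<sigma> j") (auto simp: rep_def nth_append)

lemma rep_end: "snd (rep \<sigma> (int (length (\<sigma> j)))) j = 0"
  by (simp add: rep_def)

definition good_store :: "nat \<Rightarrow> nat \<Rightarrow> store \<Rightarrow> bool" where
  "good_store K A \<sigma> \<longleftrightarrow> (\<forall>j. set (\<sigma> j) \<subseteq> {0<..<A} \<and> (K \<le> j \<longrightarrow> \<sigma> j = []))"

lemma areach_write:
  "\<delta> q (T p) = [(q', a, d)] \<Longrightarrow> T' = T(p := a) \<Longrightarrow> p' = p + move d \<Longrightarrow>
    areach \<delta> (q, T, p) [] 1 (q', T', p')"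
  using areach.det[of \<delta> q T p q' a d "[]" 0] areach.refl[of \<delta> "(q', T', p')"] by simp

lemma areach_keep:
  "\<delta> q (T p) = [(q', T p, d)] \<Longrightarrow> p' = p + move d \<Longrightarrow> areach \<delta> (q, T, p) [] 1 (q', T, p')"
  by (rule areach_write) auto

text \<open>Induction on the distance \<open>i\<close> to the first free cell. All stack symbols are
  positive, so the walk cannot stop early.\<close>

lemma seek:
  assumes "\<And>x. snd x j \<noteq> 0 \<Longrightarrow> stp c (Seek \<kappa>) x = [(Seek \<kappa>, x, Rgt)]"
    and "set (\<sigma> j) \<subseteq> {0<..<A}" "i \<le> length (\<sigma> j)"
  shows "areach (stp c) (Seek \<kappa>, rep \<sigma>, int (length (\<sigma> j) - i)) [] i (Seek \<kappa>, rep \<sigma>, int (length (\<sigma> j)))"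
  using assms(3)
proof (induction i)
  case 0
  then show ?case by (simp add: areach.refl)
next
  case (Suc i)
  let ?p = "length (\<sigma> j) - Suc i"
  have "rev (\<sigma> j) ! ?p \<in> set (\<sigma> j)" using Suc.prems
    by (metis diff_less nth_mem length_rev set_rev Suc_le_eq gr_implies_not0 neq0_conv zero_less_Suc)
  then have "rev (\<sigma> j) ! ?p > 0" "?p < length (\<sigma> j)" using assms(2) Suc.prems by auto
  then have "snd (rep \<sigma> (int ?p)) j \<noteq> 0" unfolding rep_def by (simp del: of_nat_diff)
  from assms(1)[OF this]
  have "areach (stp c) (Seek \<kappa>, rep \<sigma>, int ?p) [] 1 (Seek \<kappa>, rep \<sigma>, int (length (\<sigma> j) - i))"
    using Suc.prems by (intro areach_keep) auto
  from areach_trans[OF this Suc.IH] show ?case using Suc.prems by simp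
qed

lemma rewind: "areach (stp c) (Back \<kappa>, rep \<sigma>, int i) [] (Suc i) (Run \<kappa>, rep \<sigma>, 0)"
proof (induction i)
  case 0
  have "stp c (Back \<kappa>) (rep \<sigma> 0) = [(Run \<kappa>, rep \<sigma> 0, Stay)]" by (simp add: rep_def)
  then show ?case using areach_keep[of "stp c" "Back \<kappa>" "rep \<sigma>" 0 "Run \<kappa>" Stay] by simp
next
  case (Suc i)
  have "stp c (Back \<kappa>) (rep \<sigma> (int (Suc i))) = [(Back \<kappa>, rep \<sigma> (int (Suc i)), Lft)]" by (simp add: rep_def)
  then have "areach (stp c) (Back \<kappa>, rep \<sigma>, int (Suc i)) [] 1 (Back \<kappa>, rep \<sigma>, int i)"
    by (rule areach_keep) simp
  from areach_trans[OF this Suc.IH] show ?case by simp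
qed

lemma run_push:
  assumes "set (\<sigma> j) \<subseteq> {0<..<A}"
  shows "areach (stp c) (Run (Push j a # \<kappa>), rep \<sigma>, 0) [] (2 * length (\<sigma> j) + 3)
    (Run \<kappa>, rep (\<sigma>(j := a # \<sigma> j)), 0)"
proof -
  let ?n = "length (\<sigma> j)" let ?k = "Push j a # \<kappa>"
  have 1: "areach (stp c) (Run ?k, rep \<sigma>, 0) [] 1 (Seek ?k, rep \<sigma>, 0)"
    by (rule areach_keep[where d = Stay]) simp_all
  have 2: "areach (stp c) (Seek ?k, rep \<sigma>, 0) [] ?n (Seek ?k, rep \<sigma>, int ?n)"
    using seek[of j c ?k \<sigma> A ?n] assms by simp
  have 3: "areach (stp c) (Seek ?k, rep \<sigma>, int ?n) [] 1 (Back \<kappa>, rep (\<sigma>(j := a # \<sigma> j)), int ?n)"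
    by (rule areach_write[where a = "(fst (rep \<sigma> (int ?n)), (snd (rep \<sigma> (int ?n)))(j := a))" and d = Stay])
      (simp_all add: rep_end rep_push)
  have "1 + ?n + 1 + Suc ?n = 2 * ?n + 3" by simp
  then show ?thesis
    using areach_trans[OF areach_trans[OF areach_trans[OF 1 2] 3] rewind] by (metis append.simps(1))
qed

lemma run_pop:
  assumes "set (\<sigma> j) \<subseteq> {0<..<A}"
  shows "\<exists>T\<le>2 * length (\<sigma> j) + 3. areach (stp c) (Run (Loop j P f # \<kappa>), rep \<sigma>, 0) [] T
    (Run (cont j P f \<kappa> (hd0 (\<sigma> j))), rep (\<sigma>(j := tl (\<sigma> j))), 0)"
proof -
  let ?n = "length (\<sigma> j)" let ?k = "Loop j P f # \<kappa>"
  have 1: "areach (stp c) (Run ?k, rep \<sigma>, 0) [] 1 (Seek ?k, rep \<sigma>, 0)"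
    by (rule areach_keep[where d = Stay]) simp_all
  show ?thesis
  proof (cases "\<sigma> j = []")
    case True
    have "stp c (Seek ?k) (rep \<sigma> 0) = [(Run (cont j P f \<kappa> 0), rep \<sigma> 0, Stay)]"
      using True by (simp add: rep_def)
    then have "areach (stp c) (Seek ?k, rep \<sigma>, 0) [] 1 (Run (cont j P f \<kappa> 0), rep \<sigma>, 0)"
      by (rule areach_keep) simp
    moreover have "\<sigma>(j := []) = \<sigma>" using True by auto
    ultimately show ?thesis using areach_trans[OF 1, of "[]" 1] True by (intro exI[of _ 2]) (simp add: numeral_2_eq_2)
  next
    case False
    have 2: "areach (stp c) (Seek ?k, rep \<sigma>, 0) [] ?n (Seek ?k, rep \<sigma>, int ?n)"
      using seek[of j c ?k \<sigma> A ?n] assms by simp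
    have "fst (rep \<sigma> (int ?n)) = False" using False by (simp add: rep_def)
    then have 3: "areach (stp c) (Seek ?k, rep \<sigma>, int ?n) [] 1 (Take ?k, rep \<sigma>, int ?n - 1)"
      by (intro areach_keep[where d = Lft]) (simp_all add: rep_end)
    have 4: "areach (stp c) (Take ?k, rep \<sigma>, int ?n - 1) [] 1
        (Back (cont j P f \<kappa> (hd0 (\<sigma> j))), rep (\<sigma>(j := tl (\<sigma> j))), int ?n - 1)"
    proof (rule areach_write[where d = Stay])
      show "stp c (Take ?k) (rep \<sigma> (int ?n - 1)) = [(Back (cont j P f \<kappa> (hd0 (\<sigma> j))),
          (fst (rep \<sigma> (int ?n - 1)), (snd (rep \<sigma> (int ?n - 1)))(j := 0)), Stay)]"
        using False by (simp add: rep_top)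
    qed (use rep_pop[of \<sigma> j] False in simp_all)
    have 5: "int ?n - 1 = int (?n - 1)" using False by (cases "\<sigma> j") auto
    have "areach (stp c) (Run (Loop j P f # \<kappa>), rep \<sigma>, 0) [] (1 + ?n + 1 + 1 + Suc (?n - 1))
        (Run (cont j P f \<kappa> (hd0 (\<sigma> j))), rep (\<sigma>(j := tl (\<sigma> j))), 0)"
      using areach_trans[OF areach_trans[OF areach_trans[OF areach_trans[OF 1 2] 3[unfolded 5]] 4[unfolded 5]] rewind]
      by (simp add: 5)
    moreover have "1 + ?n + 1 + 1 + Suc (?n - 1) \<le> 2 * ?n + 3" using False by (cases "\<sigma> j") auto
    ultimately show ?thesis by blast
  qed
qed

text \<open>Within \<open>t\<close> units of time no stack outgrows \<open>N + t\<close>, and a unit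
  costs at most one round trip to the top of a stack plus a few steps.\<close>

definition tm_time :: "nat \<Rightarrow> nat \<Rightarrow> nat" where
  "tm_time N t = t * (2 * (N + t) + 4)"

text \<open>The extra unit in the time of a compound command pays for the glue:
  \<open>2 * N + 4\<close> covers the pop of a loop, at most \<open>2 * N + 3\<close> steps, or the
  single step that unfolds a sequence.\<close>

lemma tm_time_add:
  "tm_time N t + tm_time (N + t) t' + (2 * N + 4) \<le> tm_time N (t + t' + 1)"
  by (simp add: tm_time_def algebra_simps)

lemma good_pop: "good_store K A \<sigma> \<Longrightarrow> good_store K A (\<sigma>(j := tl (\<sigma> j)))"
proof -
  assume g: "good_store K A \<sigma>"
  have "set (tl (\<sigma> j)) \<subseteq> set (\<sigma> j)" by (cases "\<sigma> j") auto
  moreover have h: "set (\<sigma> i) \<subseteq> {0<..<A}" "K \<le> i \<Longrightarrow> \<sigma> i = []" for i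
    using g by (simp_all add: good_store_def)
  ultimately have "set (tl (\<sigma> j)) \<subseteq> {0<..<A}" by (meson order_trans)
  then show ?thesis using h by (simp add: good_store_def)
qed

lemma good_push: "good_store K A \<sigma> \<Longrightarrow> j < K \<Longrightarrow> 0 < a \<Longrightarrow> a < A \<Longrightarrow> good_store K A (\<sigma>(j := a # \<sigma> j))"
  by (auto simp: good_store_def)

lemma good_hd0: "good_store K A \<sigma> \<Longrightarrow> 0 < A \<Longrightarrow> hd0 (\<sigma> j) < A"
proof (cases "\<sigma> j")
  case (Cons a xs)
  assume "good_store K A \<sigma>"
  then have "set (\<sigma> j) \<subseteq> {0<..<A}" by (simp add: good_store_def)
  then show ?thesis using Cons by simp
qed simp

text \<open>Alphabet and height bounds are proved together with the simulation because the second
  half of a compound command starts from the store left by the first, with heights up to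
  \<open>N + t\<close>. The parameter \<open>c0\<close> affects \<open>stp\<close> only in the state
  \<open>Boot\<close>.\<close>

lemma exec_compiled:
  "exec c \<sigma> bs t \<sigma>' \<Longrightarrow> wfc K A c \<Longrightarrow> good_store K A \<sigma> \<Longrightarrow> 2 < A \<Longrightarrow> (\<And>j. length (\<sigma> j) \<le> N) \<Longrightarrow>
   good_store K A \<sigma>' \<and> (\<forall>j. length (\<sigma>' j) \<le> N + t) \<and>
   (\<forall>\<kappa>. \<exists>T\<le>tm_time N t. areach (stp c0) (Run (c # \<kappa>), rep \<sigma>, 0) bs T (Run \<kappa>, rep \<sigma>', 0))"
proof (induction arbitrary: N rule: exec.induct)
  case (Skip \<sigma>)
  have "areach (stp c0) (Run (Skip # \<kappa>), rep \<sigma>, 0) [] 1 (Run \<kappa>, rep \<sigma>, 0)" for \<kappa>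
    by (rule areach_keep[where d = Stay]) simp_all
  moreover have "1 \<le> tm_time N 1" by (simp add: tm_time_def)
  ultimately show ?case using Skip by (metis trans_le_add1)
next
  case (Push j a \<sigma>)
  have l: "length (\<sigma> i) \<le> N" for i using Push.prems by auto
  have "2 * length (\<sigma> j) + 3 \<le> tm_time N 1" using l[of j] by (simp add: tm_time_def)
  moreover have "areach (stp c0) (Run (Push j a # \<kappa>), rep \<sigma>, 0) [] (2 * length (\<sigma> j) + 3)
      (Run \<kappa>, rep (\<sigma>(j := a # \<sigma> j)), 0)" for \<kappa>
    using Push.prems by (intro run_push) (auto simp: good_store_def)
  moreover have "good_store K A (\<sigma>(j := a # \<sigma> j))" using Push.prems by (intro good_push) auto
  moreover have "length ((\<sigma>(j := a # \<sigma> j)) i) \<le> N + 1" for i using l[of i] by auto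
  ultimately show ?case by blast
next
  case (Flip j \<sigma> b)
  have l: "length (\<sigma> i) \<le> N" for i using Flip.prems by auto
  have 1: "areach (stp c0) (Run (Flip j # \<kappa>), rep \<sigma>, 0) [b] (Suc 0) (Run (Push j (bsym b) # \<kappa>), rep \<sigma>, 0)" for \<kappa>
    using areach.nondet[of "stp c0" "Run (Flip j # \<kappa>)" "rep \<sigma>" 0 _ _ b "Run (Push j (bsym b) # \<kappa>)" "rep \<sigma> 0" Stay "[]" 0]
      areach.refl by (cases b) fastforce+
  have 2: "areach (stp c0) (Run (Push j (bsym b) # \<kappa>), rep \<sigma>, 0) [] (2 * length (\<sigma> j) + 3)
      (Run \<kappa>, rep (\<sigma>(j := bsym b # \<sigma> j)), 0)" for \<kappa>
    using Flip.prems by (intro run_push) (auto simp: good_store_def)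
  have "Suc 0 + (2 * length (\<sigma> j) + 3) \<le> tm_time N 2" using l[of j] by (simp add: tm_time_def)
  moreover have "areach (stp c0) (Run (Flip j # \<kappa>), rep \<sigma>, 0) [b] (Suc 0 + (2 * length (\<sigma> j) + 3))
      (Run \<kappa>, rep (\<sigma>(j := bsym b # \<sigma> j)), 0)" for \<kappa>
    using areach_trans[OF 1 2] by simp
  moreover have "good_store K A (\<sigma>(j := bsym b # \<sigma> j))"
    using Flip.prems by (cases b) (auto intro!: good_push)
  moreover have "length ((\<sigma>(j := bsym b # \<sigma> j)) i) \<le> N + 2" for i using l[of i] by auto
  ultimately show ?case by blast
next
  case (Seq c \<sigma> bs t \<sigma>' d bs' t' \<sigma>'')
  have l: "length (\<sigma> i) \<le> N" for i using Seq.prems by auto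
  have 1: "good_store K A \<sigma>'" "\<And>j. length (\<sigma>' j) \<le> N + t"
    "\<And>\<kappa>. \<exists>T\<le>tm_time N t. areach (stp c0) (Run (c # \<kappa>), rep \<sigma>, 0) bs T (Run \<kappa>, rep \<sigma>', 0)"
    using Seq.IH(1)[of N] Seq.prems by auto
  have 2: "good_store K A \<sigma>''" "\<And>j. length (\<sigma>'' j) \<le> N + t + t'"
    "\<And>\<kappa>. \<exists>T\<le>tm_time (N + t) t'. areach (stp c0) (Run (d # \<kappa>), rep \<sigma>', 0) bs' T (Run \<kappa>, rep \<sigma>'', 0)"
    using Seq.IH(2)[of "N + t"] Seq.prems 1 by auto
  have "\<exists>T\<le>tm_time N (t + t' + 1). areach (stp c0) (Run ((c ;; d) # \<kappa>), rep \<sigma>, 0) (bs @ bs') T (Run \<kappa>, rep \<sigma>'', 0)" for \<kappa>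
  proof -
    obtain T1 where T1: "T1 \<le> tm_time N t" "areach (stp c0) (Run (c # d # \<kappa>), rep \<sigma>, 0) bs T1 (Run (d # \<kappa>), rep \<sigma>', 0)"
      using 1(3) by blast
    obtain T2 where T2: "T2 \<le> tm_time (N + t) t'" "areach (stp c0) (Run (d # \<kappa>), rep \<sigma>', 0) bs' T2 (Run \<kappa>, rep \<sigma>'', 0)"
      using 2(3) by blast
    have "areach (stp c0) (Run ((c ;; d) # \<kappa>), rep \<sigma>, 0) [] 1 (Run (c # d # \<kappa>), rep \<sigma>, 0)"
      by (rule areach_keep[where d = Stay]) simp_all
    from areach_trans[OF areach_trans[OF this T1(2)] T2(2)]
    have "areach (stp c0) (Run ((c ;; d) # \<kappa>), rep \<sigma>, 0) (bs @ bs') (1 + T1 + T2) (Run \<kappa>, rep \<sigma>'', 0)" by simp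
    moreover have "1 + T1 + T2 \<le> tm_time N (t + t' + 1)" using tm_time_add[of N t t'] T1(1) T2(1) by linarith
    ultimately show ?thesis by blast
  qed
  moreover have "length (\<sigma>'' j) \<le> N + (t + t' + 1)" for j using 2(2)[of j] by simp
  ultimately show ?case using 2(1) by blast
next
  case (Exit P \<sigma> j f bs t \<sigma>')
  have l: "length (\<sigma> i) \<le> N" for i using Exit.prems by auto
  have "good_store K A (\<sigma>(j := tl (\<sigma> j)))" using good_pop Exit.prems by blast
  moreover have "length ((\<sigma>(j := tl (\<sigma> j))) i) \<le> N" for i using l[of i] by auto
  moreover have "wfc K A (f (hd0 (\<sigma> j)))" using Exit.prems good_hd0[of K A \<sigma> j] by simp
  ultimately have 1: "good_store K A \<sigma>'" "\<And>j. length (\<sigma>' j) \<le> N + t"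
    "\<And>\<kappa>. \<exists>T\<le>tm_time N t. areach (stp c0) (Run (f (hd0 (\<sigma> j)) # \<kappa>), rep (\<sigma>(j := tl (\<sigma> j))), 0) bs T (Run \<kappa>, rep \<sigma>', 0)"
    using Exit.IH[of N] Exit.prems(3) by blast+
  have "\<exists>T\<le>tm_time N (t + 1). areach (stp c0) (Run (Loop j P f # \<kappa>), rep \<sigma>, 0) bs T (Run \<kappa>, rep \<sigma>', 0)" for \<kappa>
  proof -
    obtain T1 where T1: "T1 \<le> 2 * length (\<sigma> j) + 3" "areach (stp c0) (Run (Loop j P f # \<kappa>), rep \<sigma>, 0) [] T1
        (Run (f (hd0 (\<sigma> j)) # \<kappa>), rep (\<sigma>(j := tl (\<sigma> j))), 0)"
      using run_pop[of \<sigma> j A c0 P f \<kappa>] Exit.prems Exit.hyps(1) by (auto simp: good_store_def cont_def)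
    obtain T2 where T2: "T2 \<le> tm_time N t"
      "areach (stp c0) (Run (f (hd0 (\<sigma> j)) # \<kappa>), rep (\<sigma>(j := tl (\<sigma> j))), 0) bs T2 (Run \<kappa>, rep \<sigma>', 0)"
      using 1(3) by blast
    from areach_trans[OF T1(2) T2(2)]
    have "areach (stp c0) (Run (Loop j P f # \<kappa>), rep \<sigma>, 0) bs (T1 + T2) (Run \<kappa>, rep \<sigma>', 0)" by simp
    moreover have "T1 + T2 \<le> tm_time N (t + 1)" using tm_time_add[of N t 0] T1(1) T2(1) l[of j] by (simp add: tm_time_def)
    ultimately show ?thesis by blast
  qed
  moreover have "length (\<sigma>' j) \<le> N + (t + 1)" for j using 1(2)[of j] by simp
  ultimately show ?case using 1(1) by blast
next
  case (Again P \<sigma> j f bs t \<sigma>' bs' t' \<sigma>'')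
  have l: "length (\<sigma> i) \<le> N" for i using Again.prems by auto
  have "good_store K A (\<sigma>(j := tl (\<sigma> j)))" using good_pop Again.prems by blast
  moreover have "length ((\<sigma>(j := tl (\<sigma> j))) i) \<le> N" for i using l[of i] by auto
  moreover have "wfc K A (f (hd0 (\<sigma> j)))" using Again.prems good_hd0[of K A \<sigma> j] by simp
  ultimately have 1: "good_store K A \<sigma>'" "\<And>j. length (\<sigma>' j) \<le> N + t"
    "\<And>\<kappa>. \<exists>T\<le>tm_time N t. areach (stp c0) (Run (f (hd0 (\<sigma> j)) # \<kappa>), rep (\<sigma>(j := tl (\<sigma> j))), 0) bs T (Run \<kappa>, rep \<sigma>', 0)"
    using Again.IH(1)[of N] Again.prems(3) by blast+
  have 2: "good_store K A \<sigma>''" "\<And>j. length (\<sigma>'' j) \<le> N + t + t'"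
    "\<And>\<kappa>. \<exists>T\<le>tm_time (N + t) t'. areach (stp c0) (Run (Loop j P f # \<kappa>), rep \<sigma>', 0) bs' T (Run \<kappa>, rep \<sigma>'', 0)"
    using Again.IH(2)[of "N + t"] Again.prems 1 by blast+
  have "\<exists>T\<le>tm_time N (t + t' + 1). areach (stp c0) (Run (Loop j P f # \<kappa>), rep \<sigma>, 0) (bs @ bs') T (Run \<kappa>, rep \<sigma>'', 0)" for \<kappa>
  proof -
    obtain T1 where T1: "T1 \<le> 2 * length (\<sigma> j) + 3" "areach (stp c0) (Run (Loop j P f # \<kappa>), rep \<sigma>, 0) [] T1
        (Run (f (hd0 (\<sigma> j)) # Loop j P f # \<kappa>), rep (\<sigma>(j := tl (\<sigma> j))), 0)"
      using run_pop[of \<sigma> j A c0 P f \<kappa>] Again.prems Again.hyps(1) by (auto simp: good_store_def cont_def)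
    obtain T2 where T2: "T2 \<le> tm_time N t"
      "areach (stp c0) (Run (f (hd0 (\<sigma> j)) # Loop j P f # \<kappa>), rep (\<sigma>(j := tl (\<sigma> j))), 0) bs T2 (Run (Loop j P f # \<kappa>), rep \<sigma>', 0)"
      using 1(3) by blast
    obtain T3 where T3: "T3 \<le> tm_time (N + t) t'" "areach (stp c0) (Run (Loop j P f # \<kappa>), rep \<sigma>', 0) bs' T3 (Run \<kappa>, rep \<sigma>'', 0)"
      using 2(3) by blast
    from areach_trans[OF areach_trans[OF T1(2) T2(2)] T3(2)]
    have "areach (stp c0) (Run (Loop j P f # \<kappa>), rep \<sigma>, 0) (bs @ bs') (T1 + T2 + T3) (Run \<kappa>, rep \<sigma>'', 0)" by simp
    moreover have "T1 + T2 + T3 \<le> tm_time N (t + t' + 1)"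
      using tm_time_add[of N t t'] T1(1) T2(1) T3(1) l[of j] by linarith
    ultimately show ?thesis by blast
  qed
  moreover have "length (\<sigma>'' j) \<le> N + (t + t' + 1)" for j using 2(2)[of j] by simp
  ultimately show ?case using 2(1) by blast
qed

section \<open>Finiteness of the control and of the tape alphabet\<close>

primrec conts :: "nat \<Rightarrow> com \<Rightarrow> com list \<Rightarrow> com list set" where
  "conts A Skip \<kappa> = {Skip # \<kappa>}"
| "conts A (Push j a) \<kappa> = {Push j a # \<kappa>}"
| "conts A (Flip j) \<kappa> = {Flip j # \<kappa>, Push j 1 # \<kappa>, Push j 2 # \<kappa>}"
| "conts A (c ;; d) \<kappa> = insert ((c ;; d) # \<kappa>) (conts A c (d # \<kappa>) \<union> conts A d \<kappa>)"
| "conts A (Loop j P f) \<kappa> = insert (Loop j P f # \<kappa>)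
     (\<Union>s<A. conts A (f s) (if P s then Loop j P f # \<kappa> else \<kappa>))"

text \<open>Loops do not make the control grow: after its body a loop returns to the very same list
  of commands, so only the finitely many symbols below \<open>A\<close> cause branching.\<close>

lemma finite_conts: "finite (conts A c \<kappa>)"
  by (induction c arbitrary: \<kappa>) auto

lemma conts_self: "c # \<kappa> \<in> conts A c \<kappa>"
  by (cases c) auto

fun succs :: "nat \<Rightarrow> com list \<Rightarrow> com list set" where
  "succs A [] = {}"
| "succs A (Skip # \<kappa>) = {\<kappa>}"
| "succs A (Push j a # \<kappa>) = {\<kappa>}"
| "succs A (Flip j # \<kappa>) = {Push j 1 # \<kappa>, Push j 2 # \<kappa>}"
| "succs A ((c ;; d) # \<kappa>) = {c # d # \<kappa>}"
| "succs A (Loop j P f # \<kappa>) = cont j P f \<kappa> ` {..<A}"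

lemma conts_closed: "\<kappa>' \<in> conts A c \<kappa> \<Longrightarrow> succs A \<kappa>' \<subseteq> insert \<kappa> (conts A c \<kappa>)"
proof (induction c arbitrary: \<kappa> \<kappa>')
  case (Seq c d)
  then show ?case using conts_self[of c "d # \<kappa>" A] conts_self[of d \<kappa> A] by fastforce
next
  case (Loop j P f)
  have *: "cont j P f \<kappa> s \<in> conts A (Loop j P f) \<kappa>" if "s < A" for s
    using that conts_self[of "f s" "if P s then Loop j P f # \<kappa> else \<kappa>" A] by (auto simp: cont_def)
  show ?case
  proof (cases "\<kappa>' = Loop j P f # \<kappa>")
    case True
    then show ?thesis using * by auto
  next
    case False
    then obtain s where s: "s < A" "\<kappa>' \<in> conts A (f s) (if P s then Loop j P f # \<kappa> else \<kappa>)"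
      using Loop.prems by auto
    define \<kappa>\<^sub>0 where "\<kappa>\<^sub>0 = (if P s then Loop j P f # \<kappa> else \<kappa>)"
    have "succs A \<kappa>' \<subseteq> insert \<kappa>\<^sub>0 (conts A (f s) \<kappa>\<^sub>0)" using Loop.IH[OF _ s(2)] by (simp add: \<kappa>\<^sub>0_def)
    moreover have "conts A (f s) \<kappa>\<^sub>0 \<subseteq> conts A (Loop j P f) \<kappa>" using s(1) by (auto simp: \<kappa>\<^sub>0_def)
    moreover have "\<kappa>\<^sub>0 \<in> insert \<kappa> (conts A (Loop j P f) \<kappa>)" by (simp add: \<kappa>\<^sub>0_def)
    ultimately show ?thesis by blast
  qed
qed auto

definition comp_states :: "nat \<Rightarrow> com \<Rightarrow> ctl set" where
  "comp_states A c = {Boot, Yes, No} \<union>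
     (\<Union>\<kappa>\<in>insert [] (conts A c []). {Run \<kappa>, Seek \<kappa>, Take \<kappa>, Back \<kappa>})"

text \<open>Tracks from \<open>K\<close> on are forced to be 0; without this there would be
  infinitely many cells.\<close>

definition comp_cells :: "nat \<Rightarrow> nat \<Rightarrow> cell set" where
  "comp_cells K A = UNIV \<times> {f. \<forall>j. (j \<in> {..<K} \<longrightarrow> f j \<in> {..<A}) \<and> (j \<notin> {..<K} \<longrightarrow> f j = 0)}"

lemma wfc_conts:
  "\<kappa>' \<in> conts A c \<kappa> \<Longrightarrow> wfc K A c \<Longrightarrow> 2 < A \<Longrightarrow> \<forall>d\<in>set \<kappa>. wfc K A d \<Longrightarrow> \<forall>d\<in>set \<kappa>'. wfc K A d"
proof (induction c arbitrary: \<kappa> \<kappa>')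
  case (Seq c d)
  from Seq.prems(1) consider "\<kappa>' = (c ;; d) # \<kappa>" | "\<kappa>' \<in> conts A c (d # \<kappa>)" | "\<kappa>' \<in> conts A d \<kappa>" by auto
  then show ?case
  proof cases
    case 2
    show ?thesis by (rule Seq.IH(1)[OF 2]) (use Seq.prems in simp_all)
  next
    case 3
    show ?thesis by (rule Seq.IH(2)[OF 3]) (use Seq.prems in simp_all)
  qed (use Seq.prems in simp)
next
  case (Loop j P f)
  show ?case
  proof (cases "\<kappa>' = Loop j P f # \<kappa>")
    case False
    then obtain s where s: "s < A" "\<kappa>' \<in> conts A (f s) (if P s then Loop j P f # \<kappa> else \<kappa>)"
      using Loop.prems by auto
    have "\<forall>d\<in>set (if P s then Loop j P f # \<kappa> else \<kappa>). wfc K A d" using Loop.prems(2,4) by simp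
    then show ?thesis using Loop.IH[OF _ s(2)] s(1) Loop.prems(2,3) by simp
  qed (use Loop.prems in simp)
qed auto

lemma comp_closed:
  assumes "wfc K A c" "2 < A" "q \<in> comp_states A c" "x \<in> comp_cells K A" "(q', y, d) \<in> set (stp c q x)"
  shows "q' \<in> comp_states A c \<and> y \<in> comp_cells K A"
proof -
  obtain m g where x: "x = (m, g)" by (cases x)
  have g: "g j < A" "j \<ge> K \<Longrightarrow> g j = 0" for j
    using assms(2,4) by (cases "j < K"; fastforce simp: comp_cells_def x)+
  have cc: "(m', g) \<in> comp_cells K A" for m' using assms(4) by (simp add: comp_cells_def x)
  have cu: "j < K \<Longrightarrow> a < A \<Longrightarrow> (m', g(j := a)) \<in> comp_cells K A" for m' j a
    using assms(4) by (auto simp: comp_cells_def x)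
  have cz: "(m', g(j := 0)) \<in> comp_cells K A" for m' j
    using assms(2,4) by (auto simp: comp_cells_def x)
  define X where "X = insert [] (conts A c [])"
  have X: "\<kappa> \<in> X \<Longrightarrow> \<kappa>' \<in> succs A \<kappa> \<Longrightarrow> \<kappa>' \<in> X" for \<kappa> \<kappa>'
    using conts_closed[of \<kappa> A c "[]"] by (auto simp: X_def)
  have w: "\<kappa> \<in> X \<Longrightarrow> d \<in> set \<kappa> \<Longrightarrow> wfc K A d" for \<kappa> d
    using wfc_conts[of \<kappa> A c "[]" K] assms(1,2) by (auto simp: X_def)
  have S: "comp_states A c = {Boot, Yes, No} \<union> (\<Union>\<kappa>\<in>X. {Run \<kappa>, Seek \<kappa>, Take \<kappa>, Back \<kappa>})"
    by (simp add: comp_states_def X_def)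
  have c0: "[c] \<in> X" by (simp add: X_def conts_self)
  have p: "cont j P f \<kappa> (g i) \<in> succs A (Loop j P f # \<kappa>)"  "cont j P f \<kappa> 0 \<in> succs A (Loop j P f # \<kappa>)" for i j P f \<kappa>
    using g(1) assms(2) by auto
  from assms(3) consider "q = Boot" | "q = Yes \<or> q = No"
    | \<kappa> where "\<kappa> \<in> X" "q = Run \<kappa>" | \<kappa> where "\<kappa> \<in> X" "q = Seek \<kappa>"
    | \<kappa> where "\<kappa> \<in> X" "q = Take \<kappa>" | \<kappa> where "\<kappa> \<in> X" "q = Back \<kappa>"
    unfolding S by auto
  then show ?thesis
  proof cases
    case 1
    then show ?thesis using assms(5) c0 cc by (auto simp: S x)
  next
    case 2
    then show ?thesis using assms(5) by auto
  next
    case 3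
    show ?thesis
    proof (cases \<kappa>)
      case Nil
      then show ?thesis using 3 assms(4,5) by (auto simp: S)
    next
      case (Cons e \<kappa>')
      then show ?thesis using 3 assms(4,5) X[OF 3(1)] by (cases e) (auto simp: S)
    qed
  next
    case 4
    show ?thesis
    proof (cases \<kappa>)
      case Nil
      then show ?thesis using 4 assms(4,5) by (auto simp: S)
    next
      case (Cons e \<kappa>')
      have we: "wfc K A e" using w[OF 4(1)] Cons by simp
      show ?thesis using Cons 4 assms(5) X[OF 4(1)] we cc cu p
        by (cases e) (auto simp: S x split: if_splits)
    qed
  next
    case 5
    show ?thesis
    proof (cases \<kappa>)
      case Nil
      then show ?thesis using 5 assms(4,5) by (auto simp: S)
    next
      case (Cons e \<kappa>')
      show ?thesis using Cons 5 assms(5) X[OF 5(1)] cc cz p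
        by (cases e) (auto simp: S x split: if_splits)
    qed
  next
    case 6
    then show ?thesis using assms(5) cc by (auto simp: S x split: if_splits)
  qed
qed

lemma stp_length: "q \<noteq> Yes \<Longrightarrow> q \<noteq> No \<Longrightarrow> length (stp c q x) = 1 \<or> length (stp c q x) = 2"
  by (cases "(c, q, x)" rule: stp.cases) auto

lemma flipfree_conts:
  "\<kappa>' \<in> conts A c \<kappa> \<Longrightarrow> flipfree A c \<Longrightarrow> \<forall>d\<in>set \<kappa>. flipfree A d \<Longrightarrow> \<forall>d\<in>set \<kappa>'. flipfree A d"
proof (induction c arbitrary: \<kappa> \<kappa>')
  case (Seq c d)
  from Seq.prems(1) consider "\<kappa>' = (c ;; d) # \<kappa>" | "\<kappa>' \<in> conts A c (d # \<kappa>)" | "\<kappa>' \<in> conts A d \<kappa>" by auto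
  then show ?case
  proof cases
    case 2
    show ?thesis by (rule Seq.IH(1)[OF 2]) (use Seq.prems in simp_all)
  next
    case 3
    show ?thesis by (rule Seq.IH(2)[OF 3]) (use Seq.prems in simp_all)
  qed (use Seq.prems in simp)
next
  case (Loop j P f)
  show ?case
  proof (cases "\<kappa>' = Loop j P f # \<kappa>")
    case False
    then obtain s where s: "s < A" "\<kappa>' \<in> conts A (f s) (if P s then Loop j P f # \<kappa> else \<kappa>)"
      using Loop.prems by auto
    have "\<forall>d\<in>set (if P s then Loop j P f # \<kappa> else \<kappa>). flipfree A d" using Loop.prems(2,3) by simp
    then show ?thesis using Loop.IH[OF _ s(2)] s(1) Loop.prems(2) by simp
  qed (use Loop.prems in simp)
qed auto

lemma stp_deterministic:
  assumes "flipfree A c" "q \<in> comp_states A c"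
  shows "length (stp c q x) \<le> 1"
proof -
  have "\<forall>d\<in>set \<kappa>. flipfree A d" if "\<kappa> \<in> insert [] (conts A c [])" for \<kappa>
    using that flipfree_conts[of \<kappa> A c "[]"] assms(1) by auto
  then show ?thesis using assms(2) unfolding comp_states_def
    by (cases "(c, q, x)" rule: stp.cases) (auto, fastforce)
qed

text \<open>Lets the states and cells with a prescribed number be listed first, so that their
  positions agree with the conventions for machines.\<close>

lemma finite_ordering:
  assumes "finite S" "distinct xs" "set xs \<subseteq> S"
  obtains ys where "distinct (xs @ ys)" "set (xs @ ys) = S"
proof -
  obtain ys where "set ys = S - set xs" "distinct ys" using assms(1) finite_distinct_list[of "S - set xs"] by auto
  then show ?thesis using that[of ys] assms by auto
qed

text \<open>The bottom of a stack is at cell 0, so the last input symbol is on top. Programs meet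
  the parameter first, highest binary digit on top; moving it to another stack puts the lowest digit
  on top, as the counters expect.\<close>

definition start_store :: "bool list list \<Rightarrow> nat \<Rightarrow> store" where
  "start_store ws k = (\<lambda>_. [])(0 := rev (input_syms ws k))"

declare bits.simps [simp del]

lemma bsym_range: "bsym b \<in> {1, 2}" by (cases b) auto

lemma input_syms_range: "set (input_syms ws k) \<subseteq> {1, 2, 3}"
  using bsym_range by (auto simp: input_syms_def)

text \<open>Transfers single runs: nothing is claimed where the program has no run, and statements
  about all choice strings are recovered later by comparing runs. The 2 additional steps are
  \<open>Boot\<close> and the final look at the bottom of stack 0.\<close>

lemma compile:
  assumes "wfc K A c" "4 \<le> A" "0 < K"
  obtains M where "wf_tm M" "flipfree A c \<Longrightarrow> deterministic M"
    "\<And>ws k bs t \<sigma>. exec c (start_store ws k) bs t \<sigma> \<Longrightarrow>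
       \<exists>T cf. reach M (init ws k) bs T cf \<and> halted cf \<and> (st cf = acc_state \<longleftrightarrow> \<sigma> 0 \<noteq> []) \<and>
         T \<le> tm_time (length (input_syms ws k)) t + 2"
proof -
  define raw :: "nat \<Rightarrow> cell" where "raw s = (False, (\<lambda>_. 0)(0 := s))" for s
  have "finite (comp_states A c)" by (auto simp: comp_states_def finite_conts)
  moreover have "set [Boot, Yes, No] \<subseteq> comp_states A c" by (auto simp: comp_states_def)
  ultimately obtain qs' where qs': "distinct ([Boot, Yes, No] @ qs')" "set ([Boot, Yes, No] @ qs') = comp_states A c"
    using finite_ordering[of "comp_states A c" "[Boot, Yes, No]"] by auto
  have "finite (comp_cells K A)"
    unfolding comp_cells_def by (intro finite_SigmaI finite_set_of_finite_funs) auto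
  moreover have "distinct [raw 0, raw 1, raw 2, raw 3]"
    by (auto simp: raw_def fun_eq_iff)
  moreover have "set [raw 0, raw 1, raw 2, raw 3] \<subseteq> comp_cells K A"
    using assms(2,3) by (auto simp: raw_def comp_cells_def)
  ultimately obtain ss' where ss': "distinct ([raw 0, raw 1, raw 2, raw 3] @ ss')"
      "set ([raw 0, raw 1, raw 2, raw 3] @ ss') = comp_cells K A"
    using finite_ordering[of "comp_cells K A"] by metis
  define qs where "qs = [Boot, Yes, No] @ qs'"
  define ss where "ss = [raw 0, raw 1, raw 2, raw 3] @ ss'"
  have q12: "qs ! 0 = Boot" "qs ! 1 = Yes" "qs ! 2 = No" "length qs \<ge> 3" by (auto simp: qs_def)
  have sn: "ss ! s = raw s" if "s \<le> 3" for s
  proof -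
    have "s = 0 \<or> s = 1 \<or> s = 2 \<or> s = 3" using that by auto
    then show ?thesis by (auto simp: ss_def)
  qed
  have sq: "set qs = comp_states A c" and sss: "set ss = comp_cells K A"
    using qs' ss' by (auto simp: qs_def ss_def)
  interpret fm: finite_machine qs ss "stp c"
  proof
    show "distinct qs" "distinct ss" using qs' ss' by (simp_all only: qs_def ss_def)
    show "3 \<le> length qs" "4 \<le> length ss" by (auto simp: qs_def ss_def)
    show "length (stp c q a) = 1 \<or> length (stp c q a) = 2" if "q \<noteq> qs ! 1" "q \<noteq> qs ! 2" for q a
      using that stp_length unfolding q12 by blast
    show "q' \<in> set qs \<and> b \<in> set ss"
      if "q \<in> set qs" "a \<in> set ss" "(q', b, d) \<in> set (stp c q a)" for q a q' b d
      using comp_closed[OF assms(1) _ _ _ that(3)] that(1,2) assms(2) unfolding sq sss by auto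
  qed (simp_all add: q12[unfolded One_nat_def])
  have iq: "idx qs Boot = 0" "idx qs Yes = 1" "idx qs No = 2"
    using idx_nth[OF fm.dq, of 0] idx_nth[OF fm.dq, of 1] idx_nth[OF fm.dq, of 2] q12 fm.lq by (auto simp: qs_def)
  have ir: "idx ss (raw s) = s" if "s \<le> 3" for s
    using idx_nth[OF fm.ds, of s] sn[OF that] fm.ls that by auto
  define M where "M = encode qs ss (stp c)"
  have main: "\<exists>T cf. reach M (init ws k) bs T cf \<and> halted cf \<and> (st cf = acc_state \<longleftrightarrow> \<sigma> 0 \<noteq> []) \<and>
         T \<le> tm_time (length (input_syms ws k)) t + 2"
    if ex: "exec c (start_store ws k) bs t \<sigma>" for ws k bs t \<sigma>
  proof -
    let ?in = "input_syms ws k" and ?s = "start_store ws k"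
    define T0 :: "int \<Rightarrow> cell" where "T0 i = raw (if 0 \<le> i \<and> i < int (length ?in) then ?in ! nat i else 0)" for i
    have r: "0 < ?in ! i \<and> ?in ! i \<le> 3" if "i < length ?in" for i
      using nth_mem[OF that] input_syms_range[of ws k] by (auto)
    have lt3: "(if 0 \<le> i \<and> i < int (length ?in) then ?in ! nat i else 0) \<le> 3" for i :: int
      using r[of "nat i"] by auto
    have "fm.config_of (Boot, T0, 0) = init ws k"
      unfolding fm.config_of_def init_def T0_def by (simp add: iq ir[OF lt3] start_state_def)
    moreover have "areach (stp c) (Boot, T0, 0) [] 1 (Run [c], rep ?s, 0)"
    proof -
      have *: "T0(0 := (True, snd (T0 0))) = rep ?s"
        by (rule ext) (auto simp: T0_def rep_def raw_def start_store_def fun_eq_iff)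
      show ?thesis by (rule areach_write[where d = Stay, OF _ *[symmetric]]) simp_all
    qed
    moreover have good: "good_store K A ?s"
      using assms(2,3) input_syms_range[of ws k] by (fastforce simp: good_store_def start_store_def)
    moreover obtain T where "T \<le> tm_time (length ?in) t" "areach (stp c) (Run [c], rep ?s, 0) bs T (Run [], rep \<sigma>, 0)"
      and gs: "good_store K A \<sigma>"
    proof -
      have "length (?s j) \<le> length ?in" for j by (simp add: start_store_def)
      moreover have "2 < A" using assms(2) by simp
      ultimately show ?thesis using exec_compiled[OF ex assms(1) good, of "length ?in" c] that by blast
    qed
    moreover have "areach (stp c) (Run [], rep \<sigma>, 0) [] 1 (if \<sigma> 0 \<noteq> [] then Yes else No, rep \<sigma>, 0)"
    proof -
      \<comment> \<open>Cell 0 holds the bottom of stack 0, which is positive if it exists.\<close>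
      have "snd (rep \<sigma> 0) 0 = 0 \<longleftrightarrow> \<sigma> 0 = []"
      proof -
        have "last (\<sigma> 0) \<in> set (\<sigma> 0)" if "\<sigma> 0 \<noteq> []" using that by simp
        moreover have "set (\<sigma> 0) \<subseteq> {0<..<A}" using gs unfolding good_store_def by blast
        ultimately have "last (\<sigma> 0) > 0" if "\<sigma> 0 \<noteq> []" using that by (meson greaterThanLessThan_iff subsetD)
        then show ?thesis by (auto simp: rep_def hd_rev simp flip: hd_conv_nth)
      qed
      then show ?thesis by (intro areach_keep[where d = Stay]) simp_all
    qed
    ultimately have T: "areach (stp c) (Boot, T0, 0) bs (1 + T + 1) (if \<sigma> 0 \<noteq> [] then Yes else No, rep \<sigma>, 0)"
      and bd: "1 + T + 1 \<le> tm_time (length ?in) t + 2"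
      and i: "fm.config_of (Boot, T0, 0) = init ws k"
      using areach_trans[OF areach_trans] by fastforce+
    have "T0 i \<in> set ss" for i
    proof -
      define v where "v = (if 0 \<le> i \<and> i < int (length ?in) then ?in ! nat i else 0)"
      have "v \<le> 3" unfolding v_def by (rule lt3)
      then have "raw v \<in> set ss" using nth_mem[of v ss] sn[of v] fm.ls by simp
      then show ?thesis by (simp only: T0_def v_def)
    qed
    with fm.areach_reach[OF T] have "reach M (init ws k) bs (1 + T + 1) (fm.config_of (if \<sigma> 0 \<noteq> [] then Yes else No, rep \<sigma>, 0))"
      unfolding M_def i by (auto simp: qs_def)
    then show ?thesis using bd
      by (intro exI conjI) (auto simp: halted_def fm.config_of_def iq acc_state_def rej_state_def)
  qed
  have "deterministic M" if "flipfree A c"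
    unfolding M_def by (rule fm.deterministic_encode) (use stp_deterministic[OF that] sq in auto)
  then show thesis using that[of M] main fm.wf_encode unfolding M_def by blast
qed

section \<open>Computation paths\<close>

lemma reach_trans: "reach M c bs t c' \<Longrightarrow> reach M c' bs' t' c'' \<Longrightarrow> reach M c (bs @ bs') (t + t') c''"
  by (induction rule: reach.induct) (auto intro: reach.intros)

lemma reach_halted: "reach M c bs t c' \<Longrightarrow> halted c \<Longrightarrow> bs = [] \<and> t = 0 \<and> c' = c"
  by (cases rule: reach.cases) auto

text \<open>Once the choices are fixed a machine is deterministic. If two choice strings have a
  common extension, a run therefore is an initial part of any halting one. In particular the choice
  strings of halting paths form a prefix-free set.\<close>

lemma reach_prefix:
  "reach M c bs t c' \<Longrightarrow> reach M c bs2 t2 c2 \<Longrightarrow> halted c2 \<Longrightarrow> bs @ r = bs2 @ r2 \<Longrightarrow>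
   t \<le> t2 \<and> (\<exists>r. bs2 = bs @ r) \<and> (halted c' \<longrightarrow> bs = bs2 \<and> t = t2 \<and> c' = c2)"
proof (induction arbitrary: bs2 t2 r r2 rule: reach.induct)
  case (refl c)
  then show ?case using reach_halted by fastforce
next
  case (det c tr bs t c')
  from det.prems(1) show ?case
  proof (cases rule: reach.cases)
    case (det t')
    then show ?thesis using det.hyps(2) det.IH det.prems by auto
  qed (use det.hyps det.prems in auto)
next
  case (nondet c tr0 tr1 b bs t c')
  from nondet.prems(1) show ?case
  proof (cases rule: reach.cases)
    case (nondet tr0' tr1' b' bs' t')
    then show ?thesis using nondet.hyps(2) nondet.IH[of bs' t'] nondet.prems by auto
  qed (use nondet.hyps nondet.prems in auto)
qed

text \<open>\<open>wf_tm\<close> promises transitions only for states and symbols in range. Inside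
  this range a machine always has a move until it halts, so the invariant excludes getting
  stuck.\<close>

definition inb :: "tm \<Rightarrow> config \<Rightarrow> bool" where
  "inb M c \<longleftrightarrow> st c < num_states M \<and> (\<forall>i. tape c i < num_symbols M)"

lemma inb_apply:
  assumes "wf_tm M" "inb M c" "\<not> halted c" "tr \<in> set (delta M (st c) (tape c (pos c)))"
  shows "inb M (apply_tr tr c)"
  using assms unfolding wf_tm_def inb_def halted_def
  by (cases tr) (fastforce simp: apply_tr_def)

lemma inb_reach: "reach M c bs t c' \<Longrightarrow> wf_tm M \<Longrightarrow> inb M c \<Longrightarrow> inb M c'"
proof (induction rule: reach.induct)
  case (det c tr bs t c')
  then show ?case using inb_apply[of M c tr] by simp
next
  case (nondet c tr0 tr1 b bs t c')
  then show ?case using inb_apply[of M c "if b then tr1 else tr0"] by (auto split: if_splits)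
qed

lemma inb_init: "wf_tm M \<Longrightarrow> inb M (init ws k)"
proof -
  assume "wf_tm M"
  then have "0 < num_states M" "4 \<le> num_symbols M" by (auto simp: wf_tm_def)
  moreover have "input_syms ws k ! i < num_symbols M" if "i < length (input_syms ws k)" for i
    using nth_mem[OF that] input_syms_range[of ws k] calculation(2) by fastforce
  ultimately have "tape (init ws k) i < num_symbols M" "st (init ws k) < num_states M" for i
    by (auto simp: init_def start_state_def)
  then show ?thesis by (simp add: inb_def)
qed

text \<open>Past the end of \<open>y\<close>, choices are taken to be False.\<close>

definition fits :: "bool list \<Rightarrow> bool list \<Rightarrow> bool" where
  "fits y bs \<longleftrightarrow> (\<forall>i<length bs. bs ! i = (i < length y \<and> y ! i))"

lemma fits_Nil [simp]: "fits y []" by (simp add: fits_def)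

lemma fits_Cons: "fits y (b # bs) \<longleftrightarrow> b = (y \<noteq> [] \<and> hd y) \<and> fits (tl y) bs"
  by (cases y) (auto simp: fits_def nth_Cons less_Suc_eq_0_disj split: nat.splits)

lemma fits_snoc: "fits y bs \<Longrightarrow> fits y (bs @ [length bs < length y \<and> y ! length bs])"
  by (auto simp: fits_def nth_append less_Suc_eq)

lemma fits_take: "fits y bs \<Longrightarrow> length bs \<le> length y \<Longrightarrow> bs = take (length bs) y"
  by (auto simp: fits_def intro: nth_equalityI)

lemma fits_append: "fits (bs @ r) bs"
  by (auto simp: fits_def nth_append)

text \<open>A machine that has not halted can make one more step, with the choice dictated by
  \<open>y\<close>. Taking \<open>n\<close> above a time bound produces a halting run.\<close>

lemma fits_extend:
  assumes "wf_tm M" "inb M c0"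
  shows "\<exists>bs t c. reach M c0 bs t c \<and> fits y bs \<and> (halted c \<or> t = n)"
proof (induction n)
  case 0
  show ?case using reach.refl fits_Nil by blast
next
  case (Suc n)
  then obtain bs t c where r: "reach M c0 bs t c" "fits y bs" "halted c \<or> t = n" by blast
  show ?case
  proof (cases "halted c")
    case True
    then show ?thesis using r by blast
  next
    case False
    have "inb M c" using inb_reach[OF r(1) assms] .
    then have "length (delta M (st c) (tape c (pos c))) = 1 \<or> length (delta M (st c) (tape c (pos c))) = 2"
      using assms(1) False unfolding wf_tm_def inb_def halted_def by blast
    then consider tr where "delta M (st c) (tape c (pos c)) = [tr]"
      | tr0 tr1 where "delta M (st c) (tape c (pos c)) = [tr0, tr1]"
      by (auto simp: length_Suc_conv numeral_2_eq_2)
    then show ?thesis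
    proof cases
      case 1
      then have "reach M c [] 1 (apply_tr tr c)" using False reach.det[OF False 1 reach.refl] by simp
      from reach_trans[OF r(1) this] show ?thesis using r False by auto
    next
      case 2
      let ?b = "length bs < length y \<and> y ! length bs"
      have "reach M c [?b] 1 (apply_tr (if ?b then tr1 else tr0) c)"
        using reach.nondet[OF False 2 reach.refl, of ?b] by simp
      from reach_trans[OF r(1) this] show ?thesis using r False fits_snoc[OF r(2)] by auto
    qed
  qed
qed

lemma reach_deterministic: "reach M c bs t c' \<Longrightarrow> deterministic M \<Longrightarrow> bs = []"
proof (induction rule: reach.induct)
  case (nondet c tr0 tr1 b bs t c')
  then have "length (delta M (st c) (tape c (pos c))) \<le> 1" unfolding deterministic_def by blast
  then show ?case using nondet.hyps by simp
qed auto

section \<open>Running stack programs\<close>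

text \<open>An upper bound in place of the exact time allows costs to be rounded up whenever runs
  are composed.\<close>

definition runs :: "com \<Rightarrow> store \<Rightarrow> bool list \<Rightarrow> nat \<Rightarrow> store \<Rightarrow> bool" where
  "runs c \<sigma> bs T \<sigma>' \<longleftrightarrow> (\<exists>t\<le>T. exec c \<sigma> bs t \<sigma>')"

abbreviation Pop :: "nat \<Rightarrow> (nat \<Rightarrow> com) \<Rightarrow> com" where
  "Pop j f \<equiv> Loop j (\<lambda>_. False) f"

lemma runs_mono: "runs c \<sigma> bs T \<sigma>' \<Longrightarrow> T \<le> T' \<Longrightarrow> runs c \<sigma> bs T' \<sigma>'"
  unfolding runs_def by (meson order_trans)

lemma runs_Skip: "\<sigma>' = \<sigma> \<Longrightarrow> 1 \<le> T \<Longrightarrow> runs Skip \<sigma> [] T \<sigma>'"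
  unfolding runs_def using exec.Skip by blast

lemma runs_Push: "\<sigma>' = \<sigma>(j := a # \<sigma> j) \<Longrightarrow> 1 \<le> T \<Longrightarrow> runs (Push j a) \<sigma> [] T \<sigma>'"
  unfolding runs_def using exec.Push by blast

lemma runs_Flip: "\<sigma>' = \<sigma>(j := bsym b # \<sigma> j) \<Longrightarrow> 2 \<le> T \<Longrightarrow> runs (Flip j) \<sigma> [b] T \<sigma>'"
  unfolding runs_def using exec.Flip by blast

lemma runs_Seq: "runs c \<sigma> bs T \<sigma>' \<Longrightarrow> runs d \<sigma>' bs' T' \<sigma>'' \<Longrightarrow> runs (c ;; d) \<sigma> (bs @ bs') (T + T' + 1) \<sigma>''"
  unfolding runs_def
  by (meson exec.Seq add_le_mono le_refl)

lemma runs_Seq0: "runs c \<sigma> [] T \<sigma>' \<Longrightarrow> runs d \<sigma>' bs' T' \<sigma>'' \<Longrightarrow> T + T' + 1 \<le> T'' \<Longrightarrow> runs (c ;; d) \<sigma> bs' T'' \<sigma>''"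
  using runs_Seq[of c \<sigma> "[]" T \<sigma>' d bs' T' \<sigma>''] runs_mono by simp

lemma runs_Exit: "runs (f (hd0 (\<sigma> j))) (\<sigma>(j := tl (\<sigma> j))) bs T \<sigma>' \<Longrightarrow> \<not> P (hd0 (\<sigma> j)) \<Longrightarrow> T + 1 \<le> T' \<Longrightarrow>
    runs (Loop j P f) \<sigma> bs T' \<sigma>'"
  unfolding runs_def by (meson exec.Exit add_le_mono le_refl order_trans)

lemma runs_Again: "runs (f (hd0 (\<sigma> j))) (\<sigma>(j := tl (\<sigma> j))) bs T \<sigma>' \<Longrightarrow> P (hd0 (\<sigma> j)) \<Longrightarrow>
    runs (Loop j P f) \<sigma>' bs' T' \<sigma>'' \<Longrightarrow> runs (Loop j P f) \<sigma> (bs @ bs') (T + T' + 1) \<sigma>''"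
  unfolding runs_def by (meson exec.Again add_le_mono le_refl)

lemma runs_Again0:
  assumes "runs (f (hd0 (\<sigma> j))) (\<sigma>(j := tl (\<sigma> j))) [] T \<sigma>'" "P (hd0 (\<sigma> j))"
    "runs (Loop j P f) \<sigma>' bs' T' \<sigma>''" "T + T' + 1 \<le> T''"
  shows "runs (Loop j P f) \<sigma> bs' T'' \<sigma>''"
  using runs_mono[OF runs_Again[of f \<sigma> j "[]", OF assms(1,2,3)] assms(4)] by simp

definition each :: "nat \<Rightarrow> (nat \<Rightarrow> com) \<Rightarrow> com" where
  "each j g = Loop j (\<lambda>s. s \<noteq> 0) (\<lambda>s. if s = 0 then Skip else g s)"

lemma runs_each_Nil: "\<sigma> j = [] \<Longrightarrow> 2 \<le> T \<Longrightarrow> \<sigma>' = \<sigma> \<Longrightarrow> runs (each j g) \<sigma> [] T \<sigma>'"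
  unfolding each_def by (rule runs_Exit[where T = 1]) (auto intro!: runs_Skip)

lemma runs_each_Cons: "\<sigma> j = a # xs \<Longrightarrow> a \<noteq> 0 \<Longrightarrow> runs (g a) (\<sigma>(j := xs)) bs T \<sigma>' \<Longrightarrow>
    runs (each j g) \<sigma>' bs' T' \<sigma>'' \<Longrightarrow> runs (each j g) \<sigma> (bs @ bs') (T + T' + 1) \<sigma>''"
  unfolding each_def by (rule runs_Again) auto

lemma runs_each_Cons0:
  assumes "\<sigma> j = a # xs" "a \<noteq> 0" "runs (g a) (\<sigma>(j := xs)) [] T \<sigma>'"
    "runs (each j g) \<sigma>' bs' T' \<sigma>''" "T + T' + 1 \<le> T''"
  shows "runs (each j g) \<sigma> bs' T'' \<sigma>''"
  using runs_mono[OF runs_each_Cons[OF assms(1-4)] assms(5)] by simp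

lemma runs_each_push:
  "i \<noteq> j \<Longrightarrow> \<sigma> j = xs \<Longrightarrow> 0 \<notin> set xs \<Longrightarrow> 2 * length xs + 2 \<le> T \<Longrightarrow>
   \<sigma>' = \<sigma>(j := [], i := rev (map h xs) @ \<sigma> i) \<Longrightarrow> runs (each j (\<lambda>s. Push i (h s))) \<sigma> [] T \<sigma>'"
proof (induction xs arbitrary: \<sigma> \<sigma>' T)
  case Nil
  then show ?case by (intro runs_each_Nil) auto
next
  case (Cons a xs)
  show ?case
  proof (rule runs_each_Cons0[of _ _ a xs])
    show "runs (Push i (h a)) (\<sigma>(j := xs)) [] 1 (\<sigma>(j := xs, i := h a # \<sigma> i))"
      using Cons.prems by (intro runs_Push) auto
    show "runs (each j (\<lambda>s. Push i (h s))) (\<sigma>(j := xs, i := h a # \<sigma> i)) [] (2 * length xs + 2) \<sigma>'"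
      by (rule Cons.IH) (use Cons.prems in \<open>auto simp: fun_eq_iff\<close>)
  qed (use Cons.prems in auto)
qed

lemma runs_each_push2:
  "i \<noteq> j \<Longrightarrow> i' \<noteq> j \<Longrightarrow> i' \<noteq> i \<Longrightarrow> \<sigma> j = xs \<Longrightarrow> 0 \<notin> set xs \<Longrightarrow> 4 * length xs + 2 \<le> T \<Longrightarrow>
   \<sigma>' = \<sigma>(j := [], i := rev (map h xs) @ \<sigma> i, i' := rev (map h' xs) @ \<sigma> i') \<Longrightarrow>
   runs (each j (\<lambda>s. Push i (h s) ;; Push i' (h' s))) \<sigma> [] T \<sigma>'"
proof (induction xs arbitrary: \<sigma> \<sigma>' T)
  case Nil
  then show ?case by (intro runs_each_Nil) auto
next
  case (Cons a xs)
  show ?case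
  proof (rule runs_each_Cons0[of _ _ a xs])
    show "runs (Push i (h a) ;; Push i' (h' a)) (\<sigma>(j := xs)) [] 3 (\<sigma>(j := xs, i := h a # \<sigma> i, i' := h' a # \<sigma> i'))"
      using Cons.prems by (intro runs_Seq0[OF runs_Push runs_Push]) auto
    show "runs (each j (\<lambda>s. Push i (h s) ;; Push i' (h' s)))
        (\<sigma>(j := xs, i := h a # \<sigma> i, i' := h' a # \<sigma> i')) [] (4 * length xs + 2) \<sigma>'"
      by (rule Cons.IH) (use Cons.prems in \<open>auto simp: fun_eq_iff\<close>)
  qed (use Cons.prems in auto)
qed

lemma runs_clear:
  "\<sigma> j = xs \<Longrightarrow> 0 \<notin> set xs \<Longrightarrow> 2 * length xs + 2 \<le> T \<Longrightarrow> \<sigma>' = \<sigma>(j := []) \<Longrightarrow>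
   runs (each j (\<lambda>_. Skip)) \<sigma> [] T \<sigma>'"
proof (induction xs arbitrary: \<sigma> \<sigma>' T)
  case Nil
  then show ?case by (intro runs_each_Nil) auto
next
  case (Cons a xs)
  show ?case
    by (rule runs_each_Cons0[of _ _ a xs, OF _ _ runs_Skip[OF HOL.refl order.refl] Cons.IH]) (use Cons.prems in auto)
qed

definition until_sep :: "nat \<Rightarrow> nat \<Rightarrow> (nat \<Rightarrow> nat) \<Rightarrow> com" where
  "until_sep j i h = Loop j (\<lambda>s. s \<noteq> 0 \<and> s \<noteq> 3) (\<lambda>s. if s = 0 \<or> s = 3 then Skip else Push i (h s))"

lemma runs_until_sep:
  "i \<noteq> j \<Longrightarrow> \<sigma> j = xs @ 3 # ys \<Longrightarrow> 0 \<notin> set xs \<Longrightarrow> 3 \<notin> set xs \<Longrightarrow> 2 * length xs + 2 \<le> T \<Longrightarrow>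
   \<sigma>' = \<sigma>(j := ys, i := rev (map h xs) @ \<sigma> i) \<Longrightarrow> runs (until_sep j i h) \<sigma> [] T \<sigma>'"
proof (induction xs arbitrary: \<sigma> \<sigma>' T)
  case Nil
  then show ?case unfolding until_sep_def
    by (intro runs_Exit[where T = 1]) (auto intro!: runs_Skip)
next
  case (Cons a xs)
  show ?case unfolding until_sep_def
  proof (rule runs_Again0[where \<sigma>' = "\<sigma>(j := xs @ 3 # ys, i := h a # \<sigma> i)"])
    show "runs (if hd0 (\<sigma> j) = 0 \<or> hd0 (\<sigma> j) = 3 then Skip else Push i (h (hd0 (\<sigma> j)))) (\<sigma>(j := tl (\<sigma> j))) [] 1
        (\<sigma>(j := xs @ 3 # ys, i := h a # \<sigma> i))"
      using Cons.prems by (auto intro!: runs_Push)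
    show "runs (Loop j (\<lambda>s. s \<noteq> 0 \<and> s \<noteq> 3) (\<lambda>s. if s = 0 \<or> s = 3 then Skip else Push i (h s)))
        (\<sigma>(j := xs @ 3 # ys, i := h a # \<sigma> i)) [] (2 * length xs + 2) \<sigma>'"
      unfolding until_sep_def[symmetric] by (rule Cons.IH) (use Cons.prems in \<open>auto simp: fun_eq_iff\<close>)
  qed (use Cons.prems in auto)
qed

section \<open>Simulating a machine with prescribed choices\<close>

abbreviation (input) LT :: nat where "LT \<equiv> 2"
abbreviation (input) RT :: nat where "RT \<equiv> 3"
abbreviation (input) ST :: nat where "ST \<equiv> 4"
abbreviation (input) YS :: nat where "YS \<equiv> 5"
abbreviation (input) US :: nat where "US \<equiv> 6"
abbreviation (input) VD :: nat where "VD \<equiv> 7"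
abbreviation (input) TMP :: nat where "TMP \<equiv> 8"
abbreviation (input) KS :: nat where "KS \<equiv> 9"
abbreviation (input) MS :: nat where "MS \<equiv> 10"
abbreviation (input) JS :: nat where "JS \<equiv> 11"
abbreviation (input) ZS :: nat where "ZS \<equiv> 12"
abbreviation (input) FS :: nat where "FS \<equiv> 13"
abbreviation (input) CS :: nat where "CS \<equiv> 14"
abbreviation (input) XS :: nat where "XS \<equiv> 15"


text \<open>A tape is the pair of stacks \<open>LT\<close> and \<open>RT\<close>, with tape symbol \<open>a\<close> stored as \<open>a + 1\<close> so that
  an empty stack reads as blank. Choices are popped from \<open>YS\<close>, each leaves a mark on \<open>US\<close>, and the
  final state ends up on \<open>VD\<close>.\<close>

fun mv :: "dir \<Rightarrow> com" where
  "mv Stay = Skip"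
| "mv Rgt = Pop RT (\<lambda>s. Push LT (max 1 s))"
| "mv Lft = Pop LT (\<lambda>s. Push RT (max 1 s))"

text \<open>The scanned symbol is the top of \<open>RT\<close> and has already been popped, so
  writing is a push.\<close>

fun trc :: "nat \<times> nat \<times> dir \<Rightarrow> com" where
  "trc (q, b, d) = (Push RT (b + 1) ;; mv d ;; Push ST (q + 1))"

text \<open>An exhausted \<open>YS\<close> yields 0, which selects \<open>tr0\<close> just as False
  does; this is the convention behind \<open>fits\<close>.\<close>

definition sim_step :: "tm \<Rightarrow> nat \<Rightarrow> nat \<Rightarrow> com" where
  "sim_step M q a = (case delta M q a of
     [tr] \<Rightarrow> trc tr
   | [tr0, tr1] \<Rightarrow> Push US 1 ;; Pop YS (\<lambda>s. if s = 2 then trc tr1 else trc tr0)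
   | _ \<Rightarrow> Skip)"

text \<open>States are stored as \<open>q + 1\<close>, so 2 and 3 stand for acceptance and
  rejection. On runs from configurations in range the tests succeed; they serve to make the body a
  well-formed command for every symbol below the alphabet size.\<close>

definition sim :: "tm \<Rightarrow> com" where
  "sim M = Loop ST (\<lambda>s. s \<noteq> 2 \<and> s \<noteq> 3) (\<lambda>s. if s = 2 \<or> s = 3 then Push VD s else
     Pop RT (\<lambda>a. if s - 1 < num_states M \<and> a - 1 < num_symbols M \<and> s \<noteq> 0 then sim_step M (s - 1) (a - 1) else Skip))"

section \<open>Tapes as pairs of stacks\<close>

definition tget :: "nat list \<Rightarrow> nat \<Rightarrow> nat" where
  "tget l n = (if n < length l then l ! n - 1 else 0)"

lemma tget_simps [simp]: "tget (a # l) 0 = a - 1" "tget (a # l) (Suc n) = tget l n" "tget [] n = 0"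
  by (simp_all add: tget_def)

lemma tget_tl: "tget (tl l) n = tget l (Suc n)"
  by (cases l) auto

lemma tget_0: "tget l 0 = hd0 l - 1"
  by (cases l) auto

text \<open>A relation and not a function of the tape: stacks with and without trailing blanks
  represent the same half-tape.\<close>

definition tape_rel :: "config \<Rightarrow> nat list \<Rightarrow> nat list \<Rightarrow> bool" where
  "tape_rel c l r \<longleftrightarrow> (\<forall>n. tape c (pos c + int n) = tget r n) \<and> (\<forall>n. tape c (pos c - 1 - int n) = tget l n)"

lemma tape_rel_head: "tape_rel c l r \<Longrightarrow> tape c (pos c) = hd0 r - 1"
  unfolding tape_rel_def by (metis add.right_neutral of_nat_0 tget_0)

lemma tape_rel_write: "tape_rel c l r \<Longrightarrow> tape_rel (apply_tr (q, b, Stay) c) l ((b + 1) # tl r)"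
  unfolding tape_rel_def apply_tr_def
proof (intro conjI allI, goal_cases)
  case (1 n)
  then have "tape c (pos c + int n) = tget r n" by blast
  then show ?case by (cases n) (simp_all add: tget_tl)
qed auto

lemma apply_tr_move: "apply_tr (q, b, d) c = (apply_tr (q, b, Stay) c)\<lparr>pos := pos c + move d\<rparr>"
  by (simp add: apply_tr_def)

lemma tape_rel_right: "tape_rel c l r \<Longrightarrow> tape_rel (c\<lparr>pos := pos c + 1\<rparr>) (max 1 (hd0 r) # l) (tl r)"
proof -
  assume a: "tape_rel c l r"
  have 1: "tape c (pos c + 1 + int n) = tget (tl r) n" for n
    using a unfolding tape_rel_def tget_tl by (metis add.assoc add.commute of_nat_Suc)
  have 2: "tape c (pos c + 1 - 1 - int n) = tget (max 1 (hd0 r) # l) n" for n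
  proof (cases n)
    case 0
    then show ?thesis using tape_rel_head[OF a] by simp
  next
    case (Suc m)
    have "pos c + 1 - 1 - int n = pos c - 1 - int m" using Suc by simp
    then show ?thesis using a Suc unfolding tape_rel_def by (metis tget_simps(2))
  qed
  show ?thesis using 1 2 by (simp add: tape_rel_def)
qed

lemma tape_rel_left: "tape_rel c l r \<Longrightarrow> tape_rel (c\<lparr>pos := pos c - 1\<rparr>) (tl l) (max 1 (hd0 l) # r)"
proof -
  assume a: "tape_rel c l r"
  have 1: "tape c (pos c - 1 - 1 - int n) = tget (tl l) n" for n
  proof -
    have "pos c - 1 - 1 - int n = pos c - 1 - int (Suc n)" by simp
    then show ?thesis using a unfolding tape_rel_def tget_tl by metis
  qed
  have 2: "tape c (pos c - 1 + int n) = tget (max 1 (hd0 l) # r) n" for n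
  proof (cases n)
    case 0
    have "tape c (pos c - 1) = tget l 0" using a unfolding tape_rel_def by (metis diff_zero of_nat_0)
    then show ?thesis using 0 by (simp add: tget_0)
  next
    case (Suc m)
    then show ?thesis using a unfolding tape_rel_def by simp
  qed
  show ?thesis using 1 2 by (simp add: tape_rel_def)
qed

text \<open>The two stacks grow by at most 2 cells: one if the scanned cell lay beyond the end of
  \<open>RT\<close>, one more if a left move leaves the end of \<open>LT\<close>.\<close>

lemma runs_trc:
  assumes "tape_rel c l r"
  shows "\<exists>l' r'. tape_rel (apply_tr (q, b, d) c) l' r' \<and>
    (0 \<notin> set l \<longrightarrow> 0 \<notin> set r \<longrightarrow> 0 \<notin> set l' \<and> 0 \<notin> set r') \<and> length l' + length r' \<le> length l + length r + 2 \<and>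
    runs (trc (q, b, d)) (\<sigma>(LT := l, RT := tl r, ST := [])) [] 6 (\<sigma>(LT := l', RT := r', ST := [q + 1]))"
proof -
  note w = tape_rel_write[OF assms, of q b]
  have tl0: "0 \<notin> set xs \<Longrightarrow> 0 \<notin> set (tl xs)" for xs :: "nat list" by (cases xs) auto
  show ?thesis
  proof (cases d)
    case Stay
    have "runs (trc (q, b, Stay)) (\<sigma>(LT := l, RT := tl r, ST := [])) [] 6
        (\<sigma>(LT := l, RT := (b + 1) # tl r, ST := [q + 1]))"
      unfolding trc.simps mv.simps
      by (rule runs_Seq0, rule runs_Push[OF HOL.refl order.refl], rule runs_Seq0, rule runs_Skip[OF HOL.refl order.refl],
          rule runs_Push[OF _ order.refl]) (auto simp: fun_eq_iff)
    then show ?thesis using w tl0 Stay by (intro exI[of _ l] exI[of _ "(b + 1) # tl r"]) auto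
  next
    case Rgt
    have "runs (trc (q, b, Rgt)) (\<sigma>(LT := l, RT := tl r, ST := [])) [] 6
        (\<sigma>(LT := (b + 1) # l, RT := tl r, ST := [q + 1]))"
      unfolding trc.simps mv.simps
      by (rule runs_Seq0, rule runs_Push[OF HOL.refl order.refl], rule runs_Seq0, rule runs_Exit,
          rule runs_Push[OF HOL.refl order.refl], simp, rule order.refl, rule runs_Push[OF _ order.refl])
        (auto simp: fun_eq_iff)
    then show ?thesis using tape_rel_right[OF w] tl0 Rgt apply_tr_move[of q b Rgt c]
      by (intro exI[of _ "(b + 1) # l"] exI[of _ "tl r"]) (auto simp: apply_tr_def)
  next
    case Lft
    have "runs (trc (q, b, Lft)) (\<sigma>(LT := l, RT := tl r, ST := [])) [] 6
        (\<sigma>(LT := tl l, RT := max 1 (hd0 l) # (b + 1) # tl r, ST := [q + 1]))"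
      unfolding trc.simps mv.simps
      by (rule runs_Seq0, rule runs_Push[OF HOL.refl order.refl], rule runs_Seq0, rule runs_Exit,
          rule runs_Push[OF HOL.refl order.refl], simp, rule order.refl, rule runs_Push[OF _ order.refl])
        (auto simp: fun_eq_iff)
    then show ?thesis using tape_rel_left[OF w] tl0 Lft apply_tr_move[of q b Lft c]
      by (intro exI[of _ "tl l"] exI[of _ "max 1 (hd0 l) # (b + 1) # tl r"]) (auto simp: apply_tr_def)
  qed
qed

lemma runs_sim_step:
  assumes "\<not> halted c" "inb M c" "tape_rel c l r"
    "runs (sim_step M (st c) (tape c (pos c))) (\<sigma>(RT := tl r, ST := [])) [] T \<sigma>1" "runs (sim M) \<sigma>1 [] T' \<sigma>'"
    "\<sigma> ST = [st c + 1]" "\<sigma> RT = r" "T + T' + 2 \<le> T''"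
  shows "runs (sim M) \<sigma> [] T'' \<sigma>'"
  unfolding sim_def
proof (rule runs_Again0[where T = "T + 1" and T' = T' and \<sigma>' = \<sigma>1])
  have s: "st c + 1 \<noteq> 2" "st c + 1 \<noteq> 3" using assms(1) by (auto simp: halted_def acc_state_def rej_state_def)
  show "hd0 (\<sigma> ST) \<noteq> 2 \<and> hd0 (\<sigma> ST) \<noteq> 3" using s assms(6) by simp
  have "tape c (pos c) = hd0 r - 1" "tape c (pos c) < num_symbols M" "st c < num_states M"
    using tape_rel_head[OF assms(3)] assms(2) unfolding inb_def by blast+
  moreover have "(\<sigma>(ST := [], RT := tl r)) = \<sigma>(RT := tl r, ST := [])" by auto
  ultimately show "runs (if hd0 (\<sigma> ST) = 2 \<or> hd0 (\<sigma> ST) = 3 then Push VD (hd0 (\<sigma> ST))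
         else Pop RT (\<lambda>a. if hd0 (\<sigma> ST) - 1 < num_states M \<and> a - 1 < num_symbols M \<and> hd0 (\<sigma> ST) \<noteq> 0
           then sim_step M (hd0 (\<sigma> ST) - 1) (a - 1) else Skip))
     (\<sigma>(ST := tl (\<sigma> ST))) [] (T + 1) \<sigma>1"
    using s assms(4,6,7) by (auto intro!: runs_Exit[where T = T])
qed (use assms(5,8) in \<open>auto simp: sim_def\<close>)

text \<open>Induction on the run. The heights of the tape stacks are tracked because these stacks
  must be emptied afterwards. The factor 16 is generous: a binary move is charged 11 units, 9 for
  \<open>sim_step\<close> and 2 for the loop.\<close>

lemma runs_sim:
  "reach M c bs t c' \<Longrightarrow> halted c' \<Longrightarrow> wf_tm M \<Longrightarrow> inb M c \<Longrightarrow> tape_rel c l r \<Longrightarrow> fits y bs \<Longrightarrow>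
   0 \<notin> set l \<Longrightarrow> 0 \<notin> set r \<Longrightarrow>
   \<exists>l' r'. 0 \<notin> set l' \<and> 0 \<notin> set r' \<and> length l' + length r' \<le> length l + length r + 2 * t \<and>
     runs (sim M) (\<sigma>(LT := l, RT := r, ST := [st c + 1], YS := map bsym y, US := u)) [] (16 * t + 4)
      (\<sigma>(LT := l', RT := r', ST := [], YS := map bsym (drop (length bs) y), US := replicate (length bs) 1 @ u,
         VD := (st c' + 1) # \<sigma> VD))"
proof (induction arbitrary: l r y u rule: reach.induct)
  case (refl c)
  have "st c + 1 = 2 \<or> st c + 1 = 3" using refl.prems(1) by (auto simp: halted_def acc_state_def rej_state_def)
  then have "runs (sim M) (\<sigma>(LT := l, RT := r, ST := [st c + 1], YS := map bsym y, US := u)) [] (16 * 0 + 4)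
      (\<sigma>(LT := l, RT := r, ST := [], YS := map bsym (drop (length []) y), US := replicate (length []) 1 @ u,
         VD := (st c + 1) # \<sigma> VD))"
    unfolding sim_def by (intro runs_Exit[where T = 1]) (auto intro!: runs_Push)
  then show ?case using refl.prems by fastforce
next
  case (det c tr bs t c')
  obtain q b d where tr: "tr = (q, b, d)" by (cases tr)
  let ?c = "apply_tr tr c"
  have st: "st ?c = q" by (simp add: apply_tr_def tr)
  let ?\<sigma> = "\<sigma>(YS := map bsym y, US := u)"
  obtain l1 r1 where 1: "tape_rel ?c l1 r1" "0 \<notin> set l1" "0 \<notin> set r1" "length l1 + length r1 \<le> length l + length r + 2"
    "runs (trc tr) (?\<sigma>(LT := l, RT := tl r, ST := [])) [] 6 (?\<sigma>(LT := l1, RT := r1, ST := [q + 1]))"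
    using runs_trc[OF det.prems(4), of q b d ?\<sigma>] det.prems unfolding tr by blast
  have "inb M ?c" using inb_apply[OF det.prems(2,3) det.hyps(1)] det.hyps(2) by simp
  from det.IH[OF det.prems(1,2) this 1(1) det.prems(5) 1(2,3), of u]
  obtain l' r' where 2: "0 \<notin> set l'" "0 \<notin> set r'" "length l' + length r' \<le> length l1 + length r1 + 2 * t"
    "runs (sim M) (\<sigma>(LT := l1, RT := r1, ST := [q + 1], YS := map bsym y, US := u)) [] (16 * t + 4)
      (\<sigma>(LT := l', RT := r', ST := [], YS := map bsym (drop (length bs) y), US := replicate (length bs) 1 @ u,
         VD := (st c' + 1) # \<sigma> VD))" unfolding st by blast
  have "runs (sim M) (\<sigma>(LT := l, RT := r, ST := [st c + 1], YS := map bsym y, US := u)) [] (16 * Suc t + 4)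
      (\<sigma>(LT := l', RT := r', ST := [], YS := map bsym (drop (length bs) y), US := replicate (length bs) 1 @ u,
         VD := (st c' + 1) # \<sigma> VD))"
  proof (rule runs_sim_step[OF det.hyps(1) det.prems(3,4) _ 2(4)])
    have e: "(\<sigma>(LT := l, RT := r, ST := [st c + 1], YS := map bsym y, US := u, RT := tl r, ST := [])) =
        ?\<sigma>(LT := l, RT := tl r, ST := [])" by (auto simp: fun_eq_iff)
    have e': "(\<sigma>(LT := l1, RT := r1, ST := [q + 1], YS := map bsym y, US := u)) =
        ?\<sigma>(LT := l1, RT := r1, ST := [q + 1])" by (auto simp: fun_eq_iff)
    show "runs (sim_step M (st c) (tape c (pos c))) (\<sigma>(LT := l, RT := r, ST := [st c + 1], YS := map bsym y, US := u,
        RT := tl r, ST := [])) [] 6 (\<sigma>(LT := l1, RT := r1, ST := [q + 1], YS := map bsym y, US := u))"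
      unfolding e e' sim_step_def using det.hyps(2) 1(5) by simp
  qed auto
  moreover have "length l' + length r' \<le> length l + length r + 2 * Suc t" using 2(3) 1(4) by simp
  ultimately show ?case using 2(1,2) by blast
next
  case (nondet c tr0 tr1 b0 bs t c')
  define tr where "tr = (if b0 then tr1 else tr0)"
  obtain q b d where tr: "tr = (q, b, d)" by (cases tr)
  let ?c = "apply_tr tr c"
  have st: "st ?c = q" by (simp add: apply_tr_def tr)
  let ?\<sigma> = "\<sigma>(YS := map bsym (tl y), US := 1 # u)"
  obtain l1 r1 where 1: "tape_rel ?c l1 r1" "0 \<notin> set l1" "0 \<notin> set r1" "length l1 + length r1 \<le> length l + length r + 2"
    "runs (trc tr) (?\<sigma>(LT := l, RT := tl r, ST := [])) [] 6 (?\<sigma>(LT := l1, RT := r1, ST := [q + 1]))"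
    using runs_trc[OF nondet.prems(4), of q b d ?\<sigma>] nondet.prems unfolding tr by blast
  have "inb M ?c" using inb_apply[OF nondet.prems(2,3) nondet.hyps(1)] nondet.hyps(2) by (simp add: tr_def)
  moreover have fy: "fits (tl y) bs" and b0: "b0 = (y \<noteq> [] \<and> hd y)" using nondet.prems(5) by (auto simp: fits_Cons)
  ultimately obtain l' r' where 2: "0 \<notin> set l'" "0 \<notin> set r'" "length l' + length r' \<le> length l1 + length r1 + 2 * t"
    "runs (sim M) (\<sigma>(LT := l1, RT := r1, ST := [q + 1], YS := map bsym (tl y), US := 1 # u)) [] (16 * t + 4)
      (\<sigma>(LT := l', RT := r', ST := [], YS := map bsym (drop (length bs) (tl y)), US := replicate (length bs) 1 @ 1 # u,
         VD := (st c' + 1) # \<sigma> VD))"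
    using nondet.IH[of l1 r1 "tl y" "1 # u"] nondet.prems(1,2) 1(1,2,3) unfolding tr_def[symmetric] st by blast
  have r: "replicate (length bs) 1 @ 1 # u = replicate (length (b0 # bs)) 1 @ u"
    by (simp add: replicate_app_Cons_same)
  have dr: "drop (length bs) (tl y) = drop (length (b0 # bs)) y" by (simp add: drop_Suc)
  have "runs (sim M) (\<sigma>(LT := l, RT := r, ST := [st c + 1], YS := map bsym y, US := u)) [] (16 * Suc t + 4)
      (\<sigma>(LT := l', RT := r', ST := [], YS := map bsym (drop (length (b0 # bs)) y), US := replicate (length (b0 # bs)) 1 @ u,
         VD := (st c' + 1) # \<sigma> VD))"
  proof (rule runs_sim_step[OF nondet.hyps(1) nondet.prems(3,4) _ 2(4)[unfolded r dr]])
    let ?f = "\<lambda>s. if s = 2 then trc tr1 else trc tr0"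
    let ?s = "\<sigma>(LT := l, RT := r, ST := [st c + 1], YS := map bsym y, US := u, RT := tl r, ST := [])"
    have e: "?s(US := 1 # u, YS := map bsym (tl y)) = ?\<sigma>(LT := l, RT := tl r, ST := [])" by (auto simp: fun_eq_iff)
    have e': "(\<sigma>(LT := l1, RT := r1, ST := [q + 1], YS := map bsym (tl y), US := 1 # u)) =
        ?\<sigma>(LT := l1, RT := r1, ST := [q + 1])" by (auto simp: fun_eq_iff)
    have f: "?f (hd0 (map bsym y)) = trc tr" unfolding tr_def b0 by (cases y; cases "hd y") auto
    have "runs (Push US 1 ;; Pop YS ?f) ?s [] 9 (?\<sigma>(LT := l1, RT := r1, ST := [q + 1]))"
    proof (rule runs_Seq0[OF runs_Push])
      show "runs (Pop YS ?f) (?s(US := 1 # u)) [] 7 (?\<sigma>(LT := l1, RT := r1, ST := [q + 1]))"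
        by (rule runs_Exit[where T = 6]) (use f e 1(5) in \<open>auto simp: map_tl\<close>)
    qed auto
    then show "runs (sim_step M (st c) (tape c (pos c))) ?s [] 9 (\<sigma>(LT := l1, RT := r1, ST := [q + 1], YS := map bsym (tl y), US := 1 # u))"
      unfolding e' sim_step_def using nondet.hyps(2) by simp
  qed auto
  moreover have "length l' + length r' \<le> length l + length r + 2 * Suc t" using 2(3) 1(4) by simp
  ultimately show ?case using 2(1,2) by blast
qed

lemma wfc_trc: "b + 1 < A \<Longrightarrow> q + 1 < A \<Longrightarrow> 1 < A \<Longrightarrow> 8 \<le> K \<Longrightarrow> wfc K A (trc (q, b, d))"
  by (cases d) (auto simp: max_def)

lemma flipfree_trc: "flipfree A (trc tr)"
  by (cases tr; cases "snd (snd tr)") auto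

lemma sim_step_wf:
  assumes "wf_tm M" "num_states M < A" "num_symbols M < A" "8 \<le> K" "q < num_states M" "a < num_symbols M"
    "q \<noteq> acc_state" "q \<noteq> rej_state"
  shows "wfc K A (sim_step M q a) \<and> flipfree A (sim_step M q a)"
proof -
  have *: "wfc K A (trc tr)" if "tr \<in> set (delta M q a)" for tr
  proof -
    obtain q' b d where tr: "tr = (q', b, d)" by (cases tr)
    have "q' < num_states M" "b < num_symbols M" using assms that unfolding wf_tm_def tr by fast+
    then show ?thesis unfolding tr using assms by (intro wfc_trc) auto
  qed
  have "3 < A" using assms(1,3) by (simp add: wf_tm_def)
  then show ?thesis using * assms(4) unfolding sim_step_def
    by (auto split: list.splits simp: flipfree_trc simp del: trc.simps)
qed

lemma sim_wf:
  assumes "wf_tm M" "num_states M < A" "num_symbols M < A" "8 \<le> K"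
  shows "wfc K A (sim M)" "flipfree A (sim M)"
proof -
  have "s - 1 \<noteq> acc_state" "s - 1 \<noteq> rej_state" if "s \<noteq> 2" "s \<noteq> 3" "s \<noteq> 0" for s
    using that by (auto simp: acc_state_def rej_state_def)
  then show "wfc K A (sim M)" "flipfree A (sim M)"
    using sim_step_wf[OF assms] assms(4) unfolding sim_def by auto
qed


section \<open>Copying, filtering and truncating stacks\<close>

lemma bsym_simps [simp]: "bsym b \<noteq> 0" "bsym b \<noteq> 3" "bsym b = 2 \<longleftrightarrow> b" "bsym b < A \<longleftrightarrow> (if b then 2 < A else 1 < A)"
  by (cases b; simp)+

lemma zero_notin_bsym [simp]: "0 \<notin> set (map bsym y)" "0 \<notin> bsym ` S" "3 \<notin> bsym ` S"
  using bsym_simps(1,2) by (metis image_iff list.set_map)+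

lemma zero_notin_Suc [simp]: "0 \<notin> set (map Suc y)" "0 \<notin> Suc ` S"
  by auto

definition dup :: "nat \<Rightarrow> nat \<Rightarrow> (nat \<Rightarrow> nat) \<Rightarrow> com" where
  "dup i j h = (each i (\<lambda>s. Push TMP s) ;; each TMP (\<lambda>s. Push j (h s) ;; Push i s))"

lemma runs_dup:
  assumes "i \<noteq> j" "i \<noteq> TMP" "j \<noteq> TMP" "\<sigma> i = xs" "0 \<notin> set xs" "\<sigma> TMP = []" "6 * length xs + 5 \<le> T"
    "\<sigma>' = \<sigma>(j := map h xs @ \<sigma> j)"
  shows "runs (dup i j h) \<sigma> [] T \<sigma>'"
  unfolding dup_def
proof (rule runs_Seq0)
  show "runs (each i (\<lambda>s. Push TMP s)) \<sigma> [] (2 * length xs + 2) (\<sigma>(i := [], TMP := rev xs))"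
    using runs_each_push[of TMP i \<sigma> xs "2 * length xs + 2" _ "\<lambda>s. s"] assms by simp
  show "runs (each TMP (\<lambda>s. Push j (h s) ;; Push i s)) (\<sigma>(i := [], TMP := rev xs)) [] (4 * length xs + 2) \<sigma>'"
    by (rule runs_each_push2[where xs = "rev xs" and h' = "\<lambda>s. s"])
      (use assms in \<open>auto simp: fun_eq_iff rev_map\<close>)
qed (use assms in simp)

lemma runs_each_filter:
  "i \<noteq> j \<Longrightarrow> \<sigma> j = xs \<Longrightarrow> 0 \<notin> set xs \<Longrightarrow> 2 * length xs + 2 \<le> T \<Longrightarrow>
   \<sigma>' = \<sigma>(j := [], i := rev (filter Q xs) @ \<sigma> i) \<Longrightarrow>
   runs (each j (\<lambda>s. if Q s then Push i s else Skip)) \<sigma> [] T \<sigma>'"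
proof (induction xs arbitrary: \<sigma> \<sigma>' T)
  case Nil
  then show ?case by (intro runs_each_Nil) auto
next
  case (Cons a xs)
  let ?\<sigma> = "\<sigma>(j := xs, i := (if Q a then [a] else []) @ \<sigma> i)"
  show ?case
  proof (rule runs_each_Cons0[of _ _ a xs])
    show "runs (if Q a then Push i a else Skip) (\<sigma>(j := xs)) [] 1 ?\<sigma>"
      using Cons.prems by (auto intro!: runs_Push runs_Skip)
    show "runs (each j (\<lambda>s. if Q s then Push i s else Skip)) ?\<sigma> [] (2 * length xs + 2) \<sigma>'"
      by (rule Cons.IH) (use Cons.prems in \<open>auto simp: fun_eq_iff\<close>)
  qed (use Cons.prems in auto)
qed

lemma runs_each_drop:
  "i \<noteq> j \<Longrightarrow> \<sigma> j = xs \<Longrightarrow> 0 \<notin> set xs \<Longrightarrow> 3 * length xs + 2 \<le> T \<Longrightarrow>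
   \<sigma>' = \<sigma>(j := [], i := drop (length xs) (\<sigma> i)) \<Longrightarrow>
   runs (each j (\<lambda>_. Pop i (\<lambda>_. Skip))) \<sigma> [] T \<sigma>'"
proof (induction xs arbitrary: \<sigma> \<sigma>' T)
  case Nil
  then show ?case by (intro runs_each_Nil) auto
next
  case (Cons a xs)
  let ?\<sigma> = "\<sigma>(j := xs, i := tl (\<sigma> i))"
  show ?case
  proof (rule runs_each_Cons0[of _ _ a xs])
    show "runs (Pop i (\<lambda>_. Skip)) (\<sigma>(j := xs)) [] 2 ?\<sigma>"
      by (rule runs_Exit[where T = 1]) (use Cons.prems in \<open>auto intro!: runs_Skip\<close>)
    show "runs (each j (\<lambda>_. Pop i (\<lambda>_. Skip))) ?\<sigma> [] (3 * length xs + 2) \<sigma>'"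
      by (rule Cons.IH) (use Cons.prems in \<open>auto simp: fun_eq_iff drop_Suc\<close>)
  qed (use Cons.prems in auto)
qed

text \<open>The tape stacks are emptied at the end so that several simulations can follow one
  another in a program.\<close>

definition simulate :: "tm \<Rightarrow> com" where
  "simulate M = (Push ST 1 ;; sim M ;; each LT (\<lambda>_. Skip) ;; each RT (\<lambda>_. Skip))"

lemma tape_rel_init: "tape_rel (init ws k) [] (map Suc (input_syms ws k))"
  by (auto simp: tape_rel_def init_def tget_def)

lemma runs_simulate:
  assumes "wf_tm M" "reach M (init ws k) bs t c" "halted c" "fits y bs"
    "\<sigma> LT = []" "\<sigma> RT = map Suc (input_syms ws k)" "\<sigma> ST = []" "\<sigma> YS = map bsym y"
    "20 * t + 2 * length (input_syms ws k) + 20 \<le> T"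
    "\<sigma>' = \<sigma>(RT := [], YS := map bsym (drop (length bs) y), US := replicate (length bs) 1 @ \<sigma> US, VD := (st c + 1) # \<sigma> VD)"
  shows "runs (simulate M) \<sigma> [] T \<sigma>'"
proof -
  let ?r = "map Suc (input_syms ws k)"
  have s0: "st (init ws k) + 1 = 1" by (simp add: init_def start_state_def)
  obtain l' r' where l: "0 \<notin> set l'" "0 \<notin> set r'" "length l' + length r' \<le> length (input_syms ws k) + 2 * t"
    "runs (sim M) (\<sigma>(LT := [], RT := ?r, ST := [1], YS := map bsym y, US := \<sigma> US)) [] (16 * t + 4)
      (\<sigma>(LT := l', RT := r', ST := [], YS := map bsym (drop (length bs) y), US := replicate (length bs) 1 @ \<sigma> US,
         VD := (st c + 1) # \<sigma> VD))"
    using runs_sim[OF assms(2,3,1) inb_init[OF assms(1)] tape_rel_init assms(4), of \<sigma> "\<sigma> US"] s0 by auto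
  have e: "\<sigma>(ST := 1 # \<sigma> ST) = \<sigma>(LT := [], RT := ?r, ST := [1], YS := map bsym y, US := \<sigma> US)"
    using assms(5-8) by (auto simp: fun_eq_iff)
  let ?s = "\<sigma>(LT := l', RT := r', ST := [], YS := map bsym (drop (length bs) y), US := replicate (length bs) 1 @ \<sigma> US,
         VD := (st c + 1) # \<sigma> VD)"
  have c1: "runs (each LT (\<lambda>_. Skip)) ?s [] (2 * length l' + 2) (?s(LT := []))"
    by (rule runs_clear[of _ _ l']) (use l in auto)
  have c2: "runs (each RT (\<lambda>_. Skip)) (?s(LT := [])) [] (2 * length r' + 2) (?s(LT := [], RT := []))"
    by (rule runs_clear[of _ _ r']) (use l in auto)
  have c0: "runs (Push ST 1) \<sigma> [] 1 (\<sigma>(LT := [], RT := ?r, ST := [1], YS := map bsym y, US := \<sigma> US))"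
    unfolding e[symmetric] by (rule runs_Push) auto
  have "\<sigma>' = ?s(LT := [], RT := [])" using assms(5,7,10) by (auto simp: fun_eq_iff)
  then show ?thesis
    unfolding simulate_def using l(3) assms(9)
      runs_Seq0[OF c0 runs_Seq0[OF l(4) runs_Seq0[OF c1 c2 order.refl] order.refl], of T] by simp
qed

section \<open>Binary counters\<close>

lemma bits_0 [simp]: "bits 0 = []" by (simp add: bits.simps)

lemma bits_pos: "0 < k \<Longrightarrow> bits k = odd k # bits (k div 2)" by (simp add: bits.simps)

lemma bits_inj: "bits m = bits n \<Longrightarrow> m = n"
proof (induction m arbitrary: n rule: less_induct)
  case (less m)
  show ?case
  proof (cases "m = 0 \<or> n = 0")
    case True
    then show ?thesis using less.prems bits_pos[of m] bits_pos[of n] by (cases "m = 0"; cases "n = 0"; simp)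
  next
    case False
    then have "odd m = odd n" "m div 2 = n div 2"
      using less.prems bits_pos[of m] bits_pos[of n] less.IH[of "m div 2" "n div 2"] by auto
    then show ?thesis by (metis odd_two_times_div_two_succ even_two_times_div_two)
  qed
qed

lemma bits_power2: "bits (2 ^ n) = replicate n False @ [True]"
  by (induction n) (simp_all add: bits_pos)

lemma bits_Suc: "bits (Suc m) = (if m = 0 then [True] else if even m then True # bits (m div 2) else False # bits (Suc (m div 2)))"
  by (auto simp: bits_pos)

text \<open>The lowest digit is on top. Leading ones turn into zeros parked on \<open>TMP\<close>
  until a zero is met; it becomes a one and the parked zeros return. The end of the stack acts as a
  zero, which lengthens the number.\<close>

definition inc :: "nat \<Rightarrow> com" where
  "inc j = (Loop j (\<lambda>s. s = 2) (\<lambda>s. if s = 2 then Push TMP 1 else Push j 2) ;; each TMP (\<lambda>s. Push j s))"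

lemma runs_inc_loop:
  "j \<noteq> TMP \<Longrightarrow> \<sigma> j = map bsym (bits m) \<Longrightarrow>
   \<exists>r xs. replicate r 1 @ xs = map bsym (bits (Suc m)) \<and> r \<le> length (bits m) \<and>
     runs (Loop j (\<lambda>s. s = 2) (\<lambda>s. if s = 2 then Push TMP 1 else Push j 2)) \<sigma> [] (2 * length (bits m) + 2)
       (\<sigma>(j := xs, TMP := replicate r 1 @ \<sigma> TMP))"
proof (induction m arbitrary: \<sigma> rule: less_induct)
  case (less m)
  show ?case
  proof (cases "odd m")
    case False
    then have b: "map bsym (bits (Suc m)) = 2 # tl (\<sigma> j)" and h: "hd0 (\<sigma> j) \<noteq> 2"
      using less.prems bits_Suc[of m] bits_pos[of m] by (cases "m = 0"; simp)+
    have e: "\<sigma>(j := 2 # tl (\<sigma> j), TMP := replicate 0 1 @ \<sigma> TMP) = \<sigma>(j := 2 # tl (\<sigma> j))"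
      using less.prems(1) by (intro ext) auto
    have "runs (Loop j (\<lambda>s. s = 2) (\<lambda>s. if s = 2 then Push TMP 1 else Push j 2)) \<sigma> [] (2 * length (bits m) + 2)
        (\<sigma>(j := 2 # tl (\<sigma> j), TMP := replicate 0 1 @ \<sigma> TMP))"
      unfolding e by (rule runs_Exit[where T = 1]) (use h in \<open>auto intro!: runs_Push\<close>)
    moreover have "replicate 0 1 @ (2 # tl (\<sigma> j)) = map bsym (bits (Suc m))" using b by simp
    ultimately show ?thesis by blast
  next
    case True
    then have m: "0 < m" "bits m = True # bits (m div 2)" using bits_pos[of m] by (auto intro: Nat.gr0I)
    let ?\<sigma> = "\<sigma>(j := map bsym (bits (m div 2)), TMP := 1 # \<sigma> TMP)"
    obtain r xs where r: "replicate r 1 @ xs = map bsym (bits (Suc (m div 2)))" "r \<le> length (bits (m div 2))"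
     "runs (Loop j (\<lambda>s. s = 2) (\<lambda>s. if s = 2 then Push TMP 1 else Push j 2)) ?\<sigma> [] (2 * length (bits (m div 2)) + 2)
       (?\<sigma>(j := xs, TMP := replicate r 1 @ ?\<sigma> TMP))"
      using less.IH[of "m div 2" ?\<sigma>] m less.prems by fastforce
    have "runs (Loop j (\<lambda>s. s = 2) (\<lambda>s. if s = 2 then Push TMP 1 else Push j 2)) \<sigma> [] (2 * length (bits m) + 2)
        (?\<sigma>(j := xs, TMP := replicate r 1 @ ?\<sigma> TMP))"
      by (rule runs_Again0[OF _ _ r(3), where T = 1]) (use m less.prems in \<open>auto intro!: runs_Push simp: fun_eq_iff\<close>)
    moreover have "?\<sigma>(j := xs, TMP := replicate r 1 @ ?\<sigma> TMP) = \<sigma>(j := xs, TMP := replicate (Suc r) 1 @ \<sigma> TMP)"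
      using less.prems(1) by (auto simp: fun_eq_iff replicate_app_Cons_same)
    moreover have "replicate (Suc r) 1 @ xs = map bsym (bits (Suc m))" using r(1) True m(1) bits_Suc[of m] by simp
    ultimately show ?thesis using r(2) m(2) by (metis Suc_le_mono length_Cons)
  qed
qed

lemma runs_inc:
  assumes "j \<noteq> TMP" "\<sigma> j = map bsym (bits m)" "\<sigma> TMP = []" "4 * length (bits m) + 5 \<le> T"
    "\<sigma>' = \<sigma>(j := map bsym (bits (Suc m)))"
  shows "runs (inc j) \<sigma> [] T \<sigma>'"
proof -
  obtain r xs where r: "replicate r 1 @ xs = map bsym (bits (Suc m))" "r \<le> length (bits m)"
    "runs (Loop j (\<lambda>s. s = 2) (\<lambda>s. if s = 2 then Push TMP 1 else Push j 2)) \<sigma> [] (2 * length (bits m) + 2)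
       (\<sigma>(j := xs, TMP := replicate r 1 @ \<sigma> TMP))"
    using runs_inc_loop[of j \<sigma> m] assms by blast
  show ?thesis unfolding inc_def
    by (rule runs_Seq0[OF r(3) runs_each_push[of _ _ _ "replicate r 1" "2 * r + 2" _ "\<lambda>s. s"]])
      (use r assms in \<open>auto simp: fun_eq_iff\<close>)
qed

section \<open>A machine that makes exactly f k binary moves\<close>

text \<open>Successor on input symbols; the cut-off keeps the result below the alphabet size for every symbol.\<close>

definition shift :: "nat \<Rightarrow> nat" where
  "shift s = (if s \<le> 3 then s + 1 else 1)"

lemma shift_bsym [simp]: "shift (bsym b) = Suc (bsym b)" by (cases b) (auto simp: shift_def)

text \<open>The input of \<open>D\<close> is built on \<open>RT\<close> from right to left:
  parameter, separator (3, stored as 4), candidate value.\<close>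

definition probe :: "tm \<Rightarrow> com" where
  "probe D = (dup KS RT shift ;; Push RT 4 ;; dup MS RT shift ;; simulate D)"

text \<open>One coin is flipped per increment, so the flips count the value found; their results are
  only stored on \<open>JS\<close>. \<open>VD\<close> starts with 1, which no halting state leaves
  there, to mark the first round: it tests 0 without flip or increment.\<close>

definition search :: "tm \<Rightarrow> com" where
  "search D = (each 0 (\<lambda>s. Push KS s) ;; Push VD 1 ;;
     Loop VD (\<lambda>s. s \<noteq> 2) (\<lambda>s. if s = 2 then Skip else
       (if s = 1 then Skip else Flip JS ;; inc MS) ;; probe D))"

definition sstore :: "nat \<Rightarrow> nat \<Rightarrow> nat list \<Rightarrow> nat list \<Rightarrow> store" where
  "sstore k m v js = (\<lambda>_. [])(KS := map bsym (bits k), MS := map bsym (bits m), VD := v, JS := js)"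

lemma input_syms_1: "input_syms [y] k = map bsym y @ 3 # map bsym (bits k)"
  by (simp add: input_syms_def)

lemma input_syms_0: "input_syms [] k = map bsym (bits k)"
  by (simp add: input_syms_def)

lemma runs_probe:
  assumes "wf_tm D" "deterministic D" "reach D (init [bits m] k) bs t c" "halted c"
  shows "\<exists>T. runs (probe D) (sstore k m [] js) [] T (sstore k m [st c + 1] js)"
proof -
  have bs: "bs = []" using reach_deterministic assms by blast
  let ?s = "sstore k m [] js" and ?k = "map bsym (bits k)" and ?m = "map bsym (bits m)"
  have 1: "runs (dup KS RT shift) ?s [] (6 * length ?k + 5) (?s(RT := map Suc ?k))"
    by (rule runs_dup) (auto simp: sstore_def fun_eq_iff)
  have 2: "runs (Push RT 4) (?s(RT := map Suc ?k)) [] 1 (?s(RT := 4 # map Suc ?k))"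
    by (rule runs_Push) auto
  have 3: "runs (dup MS RT shift) (?s(RT := 4 # map Suc ?k)) [] (6 * length ?m + 5)
      (?s(RT := map Suc (input_syms [bits m] k)))"
    by (rule runs_dup) (auto simp: sstore_def fun_eq_iff input_syms_1)
  have 4: "runs (simulate D) (?s(RT := map Suc (input_syms [bits m] k))) []
      (20 * t + 2 * length (input_syms [bits m] k) + 20) (sstore k m [st c + 1] js)"
    by (rule runs_simulate[OF assms(1,3,4), where y = "[]"]) (auto simp: bs sstore_def fun_eq_iff)
  show ?thesis unfolding probe_def using runs_Seq[OF 1 runs_Seq[OF 2 runs_Seq[OF 3 4]]] by auto
qed

lemma runs_search:
  assumes "wf_tm D" "deterministic D"
    and D: "\<And>m. \<exists>bs t c. reach D (init [bits m] k) bs t c \<and> halted c \<and> (st c = acc_state \<longleftrightarrow> n = m)"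
  shows "\<exists>T \<sigma>. runs (search D) (start_store [] k) (replicate n False) T \<sigma>"
proof -
  define v :: "nat \<Rightarrow> nat" where "v m = (if n = m then 2 else 3)" for m
  have P: "\<exists>T. runs (probe D) (sstore k m [] js) [] T (sstore k m [v m] js)" for m js
  proof -
    obtain bs t c where r: "reach D (init [bits m] k) bs t c" "halted c" "st c = acc_state \<longleftrightarrow> n = m" using D by blast
    then have "st c + 1 = v m" by (auto simp: v_def halted_def acc_state_def rej_state_def)
    then show ?thesis using runs_probe[OF assms(1,2) r(1,2)] by metis
  qed
  let ?L = "Loop VD (\<lambda>s. s \<noteq> 2) (\<lambda>s. if s = 2 then Skip else (if s = 1 then Skip else Flip JS ;; inc MS) ;; probe D)"
  \<comment> \<open>Induction on the number \<open>d\<close> of increments still to come before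
    \<open>m\<close> reaches \<open>n\<close>.\<close>
  have L: "m + d = n \<Longrightarrow> \<exists>T \<sigma>. runs ?L (sstore k m [v m] js) (replicate d False) T \<sigma>" for m d js
  proof (induction d arbitrary: m js)
    case 0
    have "runs ?L (sstore k m [v m] js) [] 2 ((sstore k m [v m] js)(VD := []))"
      by (rule runs_Exit[where T = 1]) (use 0 in \<open>auto simp: sstore_def v_def intro!: runs_Skip\<close>)
    then show ?case by auto
  next
    case (Suc d)
    obtain T1 where 1: "runs (probe D) (sstore k (Suc m) [] (1 # js)) [] T1 (sstore k (Suc m) [v (Suc m)] (1 # js))"
      using P by blast
    obtain T2 \<sigma> where 2: "runs ?L (sstore k (Suc m) [v (Suc m)] (1 # js)) (replicate d False) T2 \<sigma>"
      using Suc.IH[of "Suc m" "1 # js"] Suc.prems by fastforce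
    have F: "runs (Flip JS) (sstore k m [] js) [False] 2 (sstore k m [] (1 # js))"
      by (rule runs_Flip) (auto simp: sstore_def fun_eq_iff)
    have I: "runs (inc MS) (sstore k m [] (1 # js)) [] (4 * length (bits m) + 5) (sstore k (Suc m) [] (1 # js))"
      by (rule runs_inc[where m = m]) (auto simp: sstore_def fun_eq_iff)
    have v: "sstore k m [v m] js VD = [3]" using Suc.prems by (auto simp: sstore_def v_def)
    have e: "(sstore k m [v m] js)(VD := tl [3]) = sstore k m [] js" by (auto simp: sstore_def fun_eq_iff)
    have "runs ?L (sstore k m [v m] js) ([False] @ replicate d False) (2 + (4 * length (bits m) + 5) + 1 + T1 + 1 + T2 + 1) \<sigma>"
      by (rule runs_Again[OF _ _ 2]) (use runs_Seq[OF runs_Seq[OF F I] 1] in \<open>simp_all add: v e[unfolded list.sel]\<close>)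
    then show ?case by auto
  qed
  obtain T1 where 1: "runs (probe D) (sstore k 0 [] []) [] T1 (sstore k 0 [v 0] [])" using P by blast
  obtain T2 \<sigma> where 2: "runs ?L (sstore k 0 [v 0] []) (replicate n False) T2 \<sigma>" using L[of 0 n "[]"] by fastforce
  have 3: "runs ?L (sstore k 0 [1] []) (replicate n False) (1 + T1 + 1 + T2 + 1) \<sigma>"
  proof (rule runs_Again0[OF _ _ 2, where T = "1 + T1 + 1"])
    have e: "sstore k 0 [1] [] VD = [1]" "(sstore k 0 [1] [])(VD := []) = sstore k 0 [] []"
      by (auto simp: sstore_def fun_eq_iff)
    show "runs (if hd0 (sstore k 0 [1] [] VD) = 2 then Skip else (if hd0 (sstore k 0 [1] [] VD) = 1 then Skip
        else Flip JS ;; inc MS) ;; probe D) ((sstore k 0 [1] [])(VD := tl (sstore k 0 [1] [] VD))) [] (1 + T1 + 1)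
        (sstore k 0 [v 0] [])"
      using runs_Seq0[OF runs_Skip[OF HOL.refl order.refl] 1 order.refl] by (simp only: e list.sel) simp
  qed (auto simp: sstore_def)
  have 4: "runs (each 0 (\<lambda>s. Push KS s)) (start_store [] k) [] (2 * length (bits k) + 2) (sstore k 0 [] [])"
    by (rule runs_each_push[where h = "\<lambda>s. s"])
      (auto simp: start_store_def sstore_def input_syms_0 fun_eq_iff rev_map)
  have 5: "runs (Push VD 1) (sstore k 0 [] []) [] 1 (sstore k 0 [1] [])"
    by (rule runs_Push) (auto simp: sstore_def fun_eq_iff)
  show ?thesis unfolding search_def using runs_Seq[OF 4 runs_Seq[OF 5 3]] by auto
qed

lemma wfc_each: "j < K \<Longrightarrow> (\<And>s. 0 < s \<Longrightarrow> s < A \<Longrightarrow> wfc K A (g s)) \<Longrightarrow> wfc K A (each j g)"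
  by (auto simp: each_def)

lemma flipfree_each: "(\<And>s. 0 < s \<Longrightarrow> s < A \<Longrightarrow> flipfree A (g s)) \<Longrightarrow> flipfree A (each j g)"
  by (auto simp: each_def)

lemma simulate_wf:
  assumes "wf_tm M" "num_states M < A" "num_symbols M < A" "8 \<le> K"
  shows "wfc K A (simulate M)" "flipfree A (simulate M)"
  using sim_wf[OF assms] assms by (auto simp: simulate_def wf_tm_def intro!: wfc_each flipfree_each)

lemma dup_wf:
  assumes "i < K" "j < K" "TMP < K" "\<And>s. 0 < s \<Longrightarrow> s < A \<Longrightarrow> 0 < h s \<and> h s < A"
  shows "wfc K A (dup i j h)" "flipfree A (dup i j h)"
  using assms by (auto simp: dup_def intro!: wfc_each flipfree_each)

lemma shift_less: "5 \<le> A \<Longrightarrow> 0 < shift s \<and> shift s < A" by (simp add: shift_def)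


lemma search_wf:
  assumes "wf_tm D" "num_states D < A" "num_symbols D < A" "14 \<le> K"
  shows "wfc K A (search D)"
proof -
  have "5 \<le> A" using assms(1,3) by (simp add: wf_tm_def)
  then show ?thesis using assms
    by (auto simp: search_def probe_def inc_def intro!: wfc_each dup_wf shift_less simulate_wf)
qed

text \<open>A single run is enough for later use, the one with all choices False: it makes
  \<open>f k\<close> choices, and \<open>T k\<close> is its exact length. No bound on
  \<open>T\<close> is available yet.\<close>

lemma ticker:
  assumes "computable f"
  obtains S T where "wf_tm S" "\<And>k. \<exists>c. reach S (init [] k) (replicate (f k) False) (T k) c \<and> halted c"
proof -
  obtain D where D: "wf_tm D" "deterministic D"
    "\<And>k m. \<exists>bs t c. reach D (init [bits m] k) bs t c \<and> halted c \<and> (st c = acc_state \<longleftrightarrow> f k = m)"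
    using assms unfolding computable_def by blast
  define A where "A = num_states D + num_symbols D + 4"
  have "wfc 14 A (search D)" by (rule search_wf) (use D in \<open>auto simp: A_def wf_tm_def\<close>)
  then obtain S where S: "wf_tm S"
    "\<And>ws k bs t \<sigma>. exec (search D) (start_store ws k) bs t \<sigma> \<Longrightarrow> \<exists>T cf. reach S (init ws k) bs T cf \<and> halted cf"
    using compile[of 14 A "search D"] by (auto simp: A_def) metis
  have "\<exists>T c. reach S (init [] k) (replicate (f k) False) T c \<and> halted c" for k
    using runs_search[OF D(1,2) D(3)[where k = k]] S(2) unfolding runs_def by blast
  then show thesis using that S(1) by metis
qed

section \<open>Clocks and computable upper bounds\<close>

text \<open>Making every step a choice turns the running time into the number of choice bits consumed.\<close>

definition clocked :: "tm \<Rightarrow> tm" where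
  "clocked S = S\<lparr>delta := \<lambda>q a. case delta S q a of [] \<Rightarrow> [] | tr # _ \<Rightarrow> [tr, tr]\<rparr>"

lemma wf_clocked:
  assumes "wf_tm S"
  shows "wf_tm (clocked S)"
  unfolding wf_tm_def
proof (intro conjI allI impI)
  fix q a assume q: "q < num_states (clocked S)" "a < num_symbols (clocked S)" "q \<noteq> acc_state \<and> q \<noteq> rej_state"
  then have S: "length (delta S q a) = 1 \<or> length (delta S q a) = 2"
    "\<forall>(q', b, d) \<in> set (delta S q a). q' < num_states S \<and> b < num_symbols S"
    using assms by (auto simp: wf_tm_def clocked_def)
  then obtain tr ds where d: "delta S q a = tr # ds" by (cases "delta S q a") auto
  then have e: "delta (clocked S) q a = [tr, tr]" by (simp add: clocked_def)
  show "length (delta (clocked S) q a) = 1 \<or> length (delta (clocked S) q a) = 2" unfolding e by simp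
  show "\<forall>(q', b, d) \<in> set (delta (clocked S) q a). q' < num_states (clocked S) \<and> b < num_symbols (clocked S)"
    using S(2) unfolding e d by (simp add: clocked_def)
qed (use assms in \<open>auto simp: wf_tm_def clocked_def\<close>)

text \<open>Both branches agree, so the machine follows the all-False run of \<open>S\<close>
  whatever the choices are, and consumes any string of length \<open>t\<close> exactly.\<close>

lemma reach_clocked:
  "reach S c bs t c' \<Longrightarrow> True \<notin> set bs \<Longrightarrow> length bs' = t \<Longrightarrow> reach (clocked S) c bs' t c'"
proof (induction arbitrary: bs' rule: reach.induct)
  case (refl c)
  then show ?case using reach.refl by auto
next
  case (det c tr bs t c')
  then obtain b r where "bs' = b # r" "length r = t" by (cases bs') auto
  moreover have "delta (clocked S) (st c) (tape c (pos c)) = [tr, tr]" using det.hyps by (simp add: clocked_def)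
  ultimately show ?case using reach.nondet[of c "clocked S" tr tr b r t c'] det by simp
next
  case (nondet c tr0 tr1 b0 bs t c')
  then obtain b r where "bs' = b # r" "length r = t" by (cases bs') auto
  moreover have "delta (clocked S) (st c) (tape c (pos c)) = [tr0, tr0]" using nondet.hyps by (simp add: clocked_def)
  ultimately show ?case using reach.nondet[of c "clocked S" tr0 tr0 b r t c'] nondet by auto
qed

lemma fits_exists: "\<exists>bs. length bs = t \<and> fits y bs"
  by (rule exI[of _ "map (\<lambda>i. i < length y \<and> y ! i) [0..<t]"]) (simp add: fits_def)

text \<open>The digits of \<open>m\<close> serve as choices. The two simulations and the loop over
  \<open>KS\<close> remove as many digits as the exponent demands; what remains on \<open>YS\<close>
  must be a single True, and \<open>FS\<close>, which collects the ones among all digits, must have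
  exactly one entry. Missing digits count as False, so the simulations end for small
  \<open>m\<close> too. The digits of \<open>k\<close> enter so that the power also dominates the
  length of the parameter on the tape.\<close>

definition clock :: "tm \<Rightarrow> tm \<Rightarrow> com" where
  "clock S1 S2 = (until_sep 0 KS (\<lambda>s. s) ;; each 0 (\<lambda>s. Push YS s ;; Push ZS s) ;;
     each ZS (\<lambda>s. if s = 2 then Push FS s else Skip) ;;
     dup KS RT shift ;; simulate (clocked S1) ;; dup KS RT shift ;; simulate (clocked S2) ;;
     each KS (\<lambda>_. Pop YS (\<lambda>_. Skip)) ;;
     Pop YS (\<lambda>a. Pop YS (\<lambda>b. Pop FS (\<lambda>c. Pop FS (\<lambda>d.
       if a = 2 \<and> b = 0 \<and> c \<noteq> 0 \<and> d = 0 then Push 0 1 else Skip)))))"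

lemma clock_accept:
  assumes "length (filter (\<lambda>b. b) y) = 1" "drop n y = [True]"
  shows "y = replicate n False @ [True]"
proof -
  have y: "y = take n y @ [True]" using assms(2) by (metis append_take_drop_id)
  have "filter (\<lambda>b. b) y = filter (\<lambda>b. b) (take n y) @ [True]"
    using arg_cong[OF y, of "filter (\<lambda>b. b)"] by (simp only: filter_append filter.simps if_True)
  then have "filter (\<lambda>b. b) (take n y) = []" using assms(1) by simp
  then have "\<forall>b\<in>set (take n y). b = False" by (auto simp: filter_empty_conv)
  moreover have "length (take n y) = n"
    using assms(2) by (cases "n \<le> length y") auto
  ultimately have "take n y = replicate n False" by (intro replicate_eqI) auto
  then show ?thesis using y by (simp only:)
qed

lemma filter_map_bsym: "filter (\<lambda>s. s = 2) (map bsym y) = replicate (length (filter (\<lambda>b. b) y)) 2"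
  by (induction y) auto

lemma runs_if_push:
  "1 \<le> T \<Longrightarrow> \<sigma>' = \<sigma>(0 := (if Q then [1] else []) @ \<sigma> 0) \<Longrightarrow> runs (if Q then Push 0 1 else Skip) \<sigma> [] T \<sigma>'"
  by (auto intro!: runs_Push runs_Skip)

lemma runs_clock_test:
  assumes "\<sigma> YS = ys" "\<sigma> FS = fs" "\<sigma> 0 = []"
  shows "\<exists>\<sigma>'. runs (Pop YS (\<lambda>a. Pop YS (\<lambda>b. Pop FS (\<lambda>c. Pop FS (\<lambda>d.
       if Q a b c d then Push 0 1 else Skip))))) \<sigma> [] 5 \<sigma>' \<and>
       \<sigma>' 0 = (if Q (hd0 ys) (hd0 (tl ys)) (hd0 fs) (hd0 (tl fs)) then [1] else [])"
proof -
  have e: "(\<sigma>(YS := tl ys)) YS = tl ys" "(\<sigma>(YS := tl ys, YS := tl (tl ys))) FS = fs"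
    "(\<sigma>(YS := tl ys, YS := tl (tl ys), FS := tl fs)) FS = tl fs" using assms by auto
  show ?thesis
    by (rule exI, rule conjI, rule runs_Exit[where T = 4], unfold assms, rule runs_Exit[where T = 3], unfold e,
        rule runs_Exit[where T = 2], unfold e, rule runs_Exit[where T = 1], unfold e,
        rule runs_if_push[OF order.refl HOL.refl]) (simp_all add: assms)
qed

lemma runs_clock:
  assumes S1: "wf_tm S1" "reach S1 (init [] k) (replicate n1 False) t1 c1" "halted c1"
    and S2: "wf_tm S2" "reach S2 (init [] k) (replicate n2 False) t2 c2" "halted c2"
  shows "\<exists>T \<sigma>. runs (clock S1 S2) (start_store [bits m] k) [] T \<sigma> \<and>
    (\<sigma> 0 \<noteq> [] \<longleftrightarrow> 2 ^ (t1 + t2 + length (bits k)) = m)"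
proof -
  define y where "y = bits m"
  let ?k = "map bsym (bits k)" and ?y = "map bsym y"
  let ?f = "replicate (length (filter (\<lambda>b. b) y)) 2 :: nat list"
  \<comment> \<open>The choices dictated by the digits of \<open>m\<close>, padded with False. Any
    strings of the right lengths are accepted by the clocked machines.\<close>
  obtain b1 b2 where b: "length b1 = t1" "fits y b1" "length b2 = t2" "fits (drop t1 y) b2"
    using fits_exists by blast
  define s0 :: store where "s0 = (\<lambda>_. [])"
  let ?s = "s0(KS := ?k, YS := ?y, FS := ?f)"
  have 1: "runs (until_sep 0 KS (\<lambda>s. s)) (start_store [bits m] k) [] (2 * length ?k + 2) (s0(KS := ?k, 0 := rev ?y))"
    by (rule runs_until_sep[where xs = "rev ?k"]) (auto simp: start_store_def input_syms_1 s0_def y_def fun_eq_iff rev_map)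
  have 2: "runs (each 0 (\<lambda>s. Push YS s ;; Push ZS s)) (s0(KS := ?k, 0 := rev ?y)) [] (4 * length ?y + 2)
      (s0(KS := ?k, YS := ?y, ZS := ?y))"
    by (rule runs_each_push2[where h = "\<lambda>s. s" and h' = "\<lambda>s. s"]) (auto simp: s0_def fun_eq_iff rev_map)
  have 3: "runs (each ZS (\<lambda>s. if s = 2 then Push FS s else Skip)) (s0(KS := ?k, YS := ?y, ZS := ?y)) [] (2 * length ?y + 2) ?s"
    by (rule runs_each_filter) (auto simp: s0_def fun_eq_iff filter_map_bsym simp del: filter_map)
  have 4: "runs (dup KS RT shift) ?s [] (6 * length ?k + 5) (?s(RT := map Suc (input_syms [] k)))"
    by (rule runs_dup) (auto simp: s0_def fun_eq_iff input_syms_0)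
  let ?v1 = "[st c1 + 1]" and ?v2 = "[st c2 + 1, st c1 + 1]"
  let ?s1 = "?s(YS := map bsym (drop t1 y), US := replicate t1 1, VD := ?v1)"
  let ?s2 = "?s(YS := map bsym (drop t2 (drop t1 y)), US := replicate t2 1 @ replicate t1 1, VD := ?v2)"
  have 5: "runs (simulate (clocked S1)) (?s(RT := map Suc (input_syms [] k))) [] (20 * t1 + 2 * length (input_syms [] k) + 20) ?s1"
    by (rule runs_simulate[OF wf_clocked[OF S1(1)] reach_clocked[OF S1(2) _ b(1)] S1(3) b(2)])
      (auto simp: s0_def fun_eq_iff b)
  have 6: "runs (dup KS RT shift) ?s1 [] (6 * length ?k + 5) (?s1(RT := map Suc (input_syms [] k)))"
    by (rule runs_dup) (auto simp: s0_def fun_eq_iff input_syms_0)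
  have 7: "runs (simulate (clocked S2)) (?s1(RT := map Suc (input_syms [] k))) [] (20 * t2 + 2 * length (input_syms [] k) + 20) ?s2"
    by (rule runs_simulate[OF wf_clocked[OF S2(1)] reach_clocked[OF S2(2) _ b(3)] S2(3) b(4)])
      (auto simp: s0_def fun_eq_iff b)
  define z where "z = drop (t1 + t2 + length (bits k)) y"
  have 8: "runs (each KS (\<lambda>_. Pop YS (\<lambda>_. Skip))) ?s2 [] (3 * length ?k + 2) (?s2(KS := [], YS := map bsym z))"
    by (rule runs_each_drop) (auto simp: s0_def fun_eq_iff drop_map z_def add.assoc add.commute add.left_commute)
  define acc where "acc = (hd0 (map bsym z) = 2 \<and> hd0 (tl (map bsym z)) = 0 \<and> hd0 ?f \<noteq> 0 \<and> hd0 (tl ?f) = 0)"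
  have 9: "\<exists>\<sigma>. runs (Pop YS (\<lambda>a. Pop YS (\<lambda>b. Pop FS (\<lambda>c. Pop FS (\<lambda>d.
       if a = 2 \<and> b = 0 \<and> c \<noteq> 0 \<and> d = 0 then Push 0 1 else Skip))))) (?s2(KS := [], YS := map bsym z)) [] 5 \<sigma> \<and>
       \<sigma> 0 = (if acc then [1] else [])"
    unfolding acc_def by (rule runs_clock_test) (auto simp: s0_def)
  have "acc \<longleftrightarrow> z = [True] \<and> length (filter (\<lambda>b. b) y) = 1"
  proof -
    have "hd0 (map bsym z) = 2 \<and> hd0 (tl (map bsym z)) = 0 \<longleftrightarrow> z = [True]"
      by (cases z; cases "tl z") auto
    moreover have "hd0 ?f \<noteq> 0 \<and> hd0 (tl ?f) = 0 \<longleftrightarrow> length (filter (\<lambda>b. b) y) = 1"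
      by (cases "length (filter (\<lambda>b. b) y)"; cases "length (filter (\<lambda>b. b) y) - 1") auto
    ultimately show ?thesis unfolding acc_def by argo
  qed
  also have "\<dots> \<longleftrightarrow> y = replicate (t1 + t2 + length (bits k)) False @ [True]"
    using clock_accept[of y] unfolding z_def by auto
  also have "\<dots> \<longleftrightarrow> 2 ^ (t1 + t2 + length (bits k)) = m"
    unfolding y_def using bits_power2 bits_inj by metis
  finally have acc: "acc \<longleftrightarrow> 2 ^ (t1 + t2 + length (bits k)) = m" .
  obtain \<sigma> where \<sigma>: "runs (Pop YS (\<lambda>a. Pop YS (\<lambda>b. Pop FS (\<lambda>c. Pop FS (\<lambda>d.
       if a = 2 \<and> b = 0 \<and> c \<noteq> 0 \<and> d = 0 then Push 0 1 else Skip))))) (?s2(KS := [], YS := map bsym z)) [] 5 \<sigma>"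
    "\<sigma> 0 = (if acc then [1] else [])"
    using 9 by blast
  have "\<exists>T. runs (clock S1 S2) (start_store [bits m] k) [] T \<sigma>"
    unfolding clock_def
    using runs_Seq[OF 1 runs_Seq[OF 2 runs_Seq[OF 3 runs_Seq[OF 4 runs_Seq[OF 5 runs_Seq[OF 6 runs_Seq[OF 7
      runs_Seq[OF 8 \<sigma>(1)]]]]]]]] unfolding append_Nil by blast
  moreover have "\<sigma> 0 \<noteq> [] \<longleftrightarrow> acc" using \<sigma>(2) by simp
  ultimately show ?thesis using acc by blast
qed

lemma clock_wf:
  assumes "wf_tm S1" "wf_tm S2" "num_states S1 < A" "num_symbols S1 < A" "num_states S2 < A" "num_symbols S2 < A" "14 \<le> K"
  shows "wfc K A (clock S1 S2)" "flipfree A (clock S1 S2)"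
proof -
  have A: "5 \<le> A" using assms(1,4) by (simp add: wf_tm_def)
  have n: "num_states (clocked S) = num_states S" "num_symbols (clocked S) = num_symbols S" for S
    by (simp_all add: clocked_def)
  show "wfc K A (clock S1 S2)" "flipfree A (clock S1 S2)" using assms A
    by (auto simp: clock_def until_sep_def n intro!: wfc_each flipfree_each dup_wf shift_less simulate_wf wf_clocked)
qed

text \<open>Two machines share one clock so that sums, and products through the exponent, are
  bounded by a single decider. No bound on \<open>T1\<close> or \<open>T2\<close> is presupposed: a
  decider of a graph only has to halt.\<close>

lemma computable_clock:
  assumes S1: "wf_tm S1" "\<And>k. \<exists>c. reach S1 (init [] k) (replicate (f1 k) False) (T1 k) c \<and> halted c"
    and S2: "wf_tm S2" "\<And>k. \<exists>c. reach S2 (init [] k) (replicate (f2 k) False) (T2 k) c \<and> halted c"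
  shows "computable (\<lambda>k. 2 ^ (T1 k + T2 k + length (bits k)))"
proof -
  define A where "A = num_states S1 + num_symbols S1 + num_states S2 + num_symbols S2 + 4"
  have w: "wfc 14 A (clock S1 S2)" and ff: "flipfree A (clock S1 S2)"
    by (rule clock_wf; use S1 S2 in \<open>auto simp: A_def wf_tm_def\<close>)+
  obtain M where M: "wf_tm M" "flipfree A (clock S1 S2) \<Longrightarrow> deterministic M"
    "\<And>ws k bs t \<sigma>. exec (clock S1 S2) (start_store ws k) bs t \<sigma> \<Longrightarrow>
       \<exists>T cf. reach M (init ws k) bs T cf \<and> halted cf \<and> (st cf = acc_state \<longleftrightarrow> \<sigma> 0 \<noteq> []) \<and>
         T \<le> tm_time (length (input_syms ws k)) t + 2"
    by (rule compile[OF w]) (auto simp: A_def)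
  have "\<exists>bs t c. reach M (init [bits m] k) bs t c \<and> halted c \<and>
      (st c = acc_state \<longleftrightarrow> 2 ^ (T1 k + T2 k + length (bits k)) = m)" for k m
  proof -
    obtain c1 c2 where "reach S1 (init [] k) (replicate (f1 k) False) (T1 k) c1" "halted c1"
      "reach S2 (init [] k) (replicate (f2 k) False) (T2 k) c2" "halted c2" using S1(2) S2(2) by blast
    then show ?thesis using runs_clock[OF S1(1) _ _ S2(1)] M(3) unfolding runs_def by metis
  qed
  then show ?thesis unfolding computable_def using M(1) M(2)[OF ff] by blast
qed

section \<open>Closure properties of functions with computable upper bounds\<close>

definition bounded :: "(nat \<Rightarrow> nat) \<Rightarrow> bool" where
  "bounded \<tau> \<longleftrightarrow> (\<exists>h. computable h \<and> (\<forall>k. \<tau> k \<le> h k))"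

lemma bounded_mono: "bounded \<tau> \<Longrightarrow> (\<And>k. \<tau>' k \<le> \<tau> k) \<Longrightarrow> bounded \<tau>'"
  unfolding bounded_def by (meson order_trans)

lemma bounded_computable: "computable h \<Longrightarrow> bounded h"
  unfolding bounded_def by blast

lemma reach_length: "reach M c bs t c' \<Longrightarrow> length bs \<le> t"
  by (induction rule: reach.induct) auto

text \<open>The ticker of \<open>h\<close> makes \<open>h k\<close> choices and hence takes at least
  \<open>h k\<close> steps, so the clock built on its running time lies above the power in
  question.\<close>

lemma bounded_exp:
  assumes "bounded \<tau>" "bounded \<tau>'"
  shows "bounded (\<lambda>k. 2 ^ (\<tau> k + \<tau>' k + length (bits k)))"
proof -
  obtain h h' where h: "computable h" "\<And>k. \<tau> k \<le> h k" "computable h'" "\<And>k. \<tau>' k \<le> h' k"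
    using assms unfolding bounded_def by blast
  obtain S T where S: "wf_tm S" "\<And>k. \<exists>c. reach S (init [] k) (replicate (h k) False) (T k) c \<and> halted c"
    using ticker[OF h(1)] by blast
  obtain S' T' where S': "wf_tm S'" "\<And>k. \<exists>c. reach S' (init [] k) (replicate (h' k) False) (T' k) c \<and> halted c"
    using ticker[OF h(3)] by blast
  have "\<tau> k \<le> T k" "\<tau>' k \<le> T' k" for k
    using S(2) S'(2) h(2,4) reach_length by (metis length_replicate order_trans)+
  then have "(2::nat) ^ (\<tau> k + \<tau>' k + length (bits k)) \<le> 2 ^ (T k + T' k + length (bits k))" for k
    by (intro power_increasing add_mono) auto
  then show ?thesis using computable_clock[OF S S'] unfolding bounded_def by blast
qed

lemma bounded_add: "bounded \<tau> \<Longrightarrow> bounded \<tau>' \<Longrightarrow> bounded (\<lambda>k. \<tau> k + \<tau>' k)"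
  by (rule bounded_mono[OF bounded_exp[of \<tau> \<tau>']]) (auto intro: order_trans[OF _ less_imp_le[OF less_exp]])

lemma bounded_mult:
  assumes "bounded \<tau>" "bounded \<tau>'"
  shows "bounded (\<lambda>k. \<tau> k * \<tau>' k)"
proof (rule bounded_mono[OF bounded_exp[OF assms]])
  fix k
  have "\<tau> k * \<tau>' k \<le> 2 ^ \<tau> k * 2 ^ \<tau>' k" by (intro mult_mono less_imp_le[OF less_exp]) auto
  also have "\<dots> = 2 ^ (\<tau> k + \<tau>' k)" by (simp add: power_add)
  also have "\<dots> \<le> 2 ^ (\<tau> k + \<tau>' k + length (bits k))" by (intro power_increasing) auto
  finally show "\<tau> k * \<tau>' k \<le> 2 ^ (\<tau> k + \<tau>' k + length (bits k))" .
qed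

lemma bounded_length_bits: "bounded \<tau> \<Longrightarrow> bounded (\<lambda>k. length (bits k))"
  by (rule bounded_mono[OF bounded_exp[of \<tau> \<tau>]]) (auto intro: order_trans[OF _ less_imp_le[OF less_exp]])

text \<open>No decider for a constant is built: 1 lies below every power of two, and larger
  constants are sums.\<close>

lemma bounded_const: "bounded \<tau> \<Longrightarrow> bounded (\<lambda>_. n)"
proof (induction n)
  case 0
  then show ?case by (rule bounded_mono) auto
next
  case (Suc n)
  have 1: "bounded (\<lambda>_. 1)" by (rule bounded_mono[OF bounded_exp[OF Suc.prems Suc.prems]]) auto
  then show ?case using bounded_add[OF Suc.IH[OF Suc.prems] 1] by simp
qed

text \<open>The search is clocked by itself: its running time \<open>T\<close> lies below a power of
  two whose graph is decided by running the search again, on the digits of the candidate.\<close>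

lemma bounded_ticker:
  assumes "computable f"
  obtains S T where "wf_tm S" "\<And>k. \<exists>c. reach S (init [] k) (replicate (f k) False) (T k) c \<and> halted c" "bounded T"
proof -
  obtain S T where S: "wf_tm S" "\<And>k. \<exists>c. reach S (init [] k) (replicate (f k) False) (T k) c \<and> halted c"
    using ticker[OF assms] by blast
  have "bounded (\<lambda>k. 2 ^ (T k + T k + length (bits k)))"
    by (rule bounded_computable[OF computable_clock[OF S S]])
  then have "bounded T" by (rule bounded_mono) (auto intro: order_trans[OF _ less_imp_le[OF less_exp]])
  then show thesis using that S by blast
qed

lemma bounded_poly: "bounded \<tau> \<Longrightarrow> bounded (\<lambda>k. a * (\<tau> k + b) ^ d)"
proof (induction d)
  case 0
  then show ?case using bounded_const by simp
next
  case (Suc d)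
  then show ?case using bounded_mult[OF bounded_add[OF Suc.prems bounded_const[OF Suc.prems, of b]] Suc.IH[OF Suc.prems]]
    by (simp add: mult.left_commute)
qed

section \<open>Deciding the outcome of a machine on given choice bits\<close>

definition decider :: "tm \<Rightarrow> (bool \<Rightarrow> nat \<Rightarrow> bool \<Rightarrow> bool) \<Rightarrow> com" where
  "decider M \<phi> = (until_sep 0 RT shift ;; until_sep 0 YS (\<lambda>s. s) ;; Push RT 4 ;; each 0 (\<lambda>s. Push RT (shift s)) ;;
     simulate M ;; Pop YS (\<lambda>a. each YS (\<lambda>s. if s = 2 then Push FS s else Skip) ;;
       Pop VD (\<lambda>v. Pop FS (\<lambda>c. if \<phi> (v = 2) a (c \<noteq> 0) then Push 0 1 else Skip))))"

lemma input_syms_2: "input_syms [x, y] k = map bsym x @ 3 # map bsym y @ 3 # map bsym (bits k)"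
  by (simp add: input_syms_def)

lemma runs_decider:
  assumes "wf_tm M" "reach M (init [x] k) bs t c" "halted c" "fits y bs"
  shows "\<exists>\<sigma>. runs (decider M \<phi>) (start_store [x, y] k) [] (20 * t + 4 * (length x + length y + length (bits k)) + 50) \<sigma> \<and>
    (\<sigma> 0 \<noteq> [] \<longleftrightarrow> \<phi> (st c = acc_state) (hd0 (map bsym (drop (length bs) y))) (True \<in> set (tl (drop (length bs) y))))"
proof -
  let ?k = "map bsym (bits k)" and ?y = "map bsym y" and ?x = "map bsym x"
  define s0 :: store where "s0 = (\<lambda>_. [])"
  define r where "r = drop (length bs) y"
  have 1: "runs (until_sep 0 RT shift) (start_store [x, y] k) [] (2 * length ?k + 2)
      (s0(0 := rev ?y @ 3 # rev ?x, RT := map Suc ?k))"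
    by (rule runs_until_sep[where xs = "rev ?k"])
      (auto simp: start_store_def input_syms_2 s0_def fun_eq_iff rev_map)
  have 2: "runs (until_sep 0 YS (\<lambda>s. s)) (s0(0 := rev ?y @ 3 # rev ?x, RT := map Suc ?k)) [] (2 * length ?y + 2)
      (s0(0 := rev ?x, RT := map Suc ?k, YS := ?y))"
    by (rule runs_until_sep[where xs = "rev ?y"]) (auto simp: s0_def fun_eq_iff rev_map)
  have 3: "runs (Push RT 4) (s0(0 := rev ?x, RT := map Suc ?k, YS := ?y)) [] 1
      (s0(0 := rev ?x, RT := 4 # map Suc ?k, YS := ?y))"
    by (rule runs_Push) (auto simp: fun_eq_iff)
  have 4: "runs (each 0 (\<lambda>s. Push RT (shift s))) (s0(0 := rev ?x, RT := 4 # map Suc ?k, YS := ?y)) [] (2 * length ?x + 2)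
      (s0(RT := map Suc (input_syms [x] k), YS := ?y))"
    by (rule runs_each_push) (auto simp: s0_def fun_eq_iff rev_map input_syms_1)
  let ?u = "replicate (length bs) 1"
  have 5: "runs (simulate M) (s0(RT := map Suc (input_syms [x] k), YS := ?y)) [] (20 * t + 2 * length (input_syms [x] k) + 20)
      (s0(YS := map bsym r, US := ?u, VD := [st c + 1]))"
    by (rule runs_simulate[OF assms]) (auto simp: s0_def fun_eq_iff r_def)
  let ?f = "replicate (length (filter (\<lambda>b. b) (tl r))) 2 :: nat list"
  let ?s = "s0(YS := map bsym (tl r), US := ?u, VD := [st c + 1])"
  let ?s' = "s0(US := ?u, VD := [st c + 1], FS := ?f)"
  have 6: "runs (each YS (\<lambda>s. if s = 2 then Push FS s else Skip)) ?s [] (2 * length y + 2) ?s'"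
    by (rule runs_each_filter) (auto simp: s0_def fun_eq_iff filter_map_bsym r_def simp del: filter_map)
  define acc where "acc = \<phi> (st c + 1 = 2) (hd0 (map bsym r)) (hd0 ?f \<noteq> 0)"
  define \<sigma> where "\<sigma> = ?s'(VD := [], FS := tl ?f, 0 := (if acc then [1] else []))"
  have 7: "runs (Pop VD (\<lambda>v. Pop FS (\<lambda>c. if \<phi> (v = 2) (hd0 (map bsym r)) (c \<noteq> 0) then Push 0 1 else Skip))) ?s' [] 3 \<sigma>"
  proof (rule runs_Exit[where T = 2], rule runs_Exit[where T = 1])
    have e: "?s' VD = [st c + 1]" "(?s'(VD := [])) FS = ?f" by auto
    show "runs (if \<phi> (hd0 (?s' VD) = 2) (hd0 (map bsym r)) (hd0 ((?s'(VD := tl (?s' VD))) FS) \<noteq> 0) then Push 0 1 else Skip)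
      (?s'(VD := tl (?s' VD), FS := tl ((?s'(VD := tl (?s' VD))) FS))) [] 1 \<sigma>"
      unfolding e list.sel hd0_simps acc_def[symmetric]
      by (rule runs_if_push) (auto simp: \<sigma>_def s0_def fun_eq_iff)
  qed auto
  have 8: "runs (Pop YS (\<lambda>a. each YS (\<lambda>s. if s = 2 then Push FS s else Skip) ;;
       Pop VD (\<lambda>v. Pop FS (\<lambda>c. if \<phi> (v = 2) a (c \<noteq> 0) then Push 0 1 else Skip))))
       (s0(YS := map bsym r, US := ?u, VD := [st c + 1])) [] (2 * length y + 7) \<sigma>"
  proof (rule runs_Exit)
    let ?z = "s0(YS := map bsym r, US := ?u, VD := [st c + 1])"
    have e: "?z YS = map bsym r" "?z(YS := tl (map bsym r)) = ?s" by (auto simp: fun_eq_iff map_tl)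
    show "runs (each YS (\<lambda>s. if s = 2 then Push FS s else Skip) ;;
       Pop VD (\<lambda>v. Pop FS (\<lambda>c. if \<phi> (v = 2) (hd0 (?z YS)) (c \<noteq> 0) then Push 0 1 else Skip)))
       (?z(YS := tl (?z YS))) [] (2 * length y + 2 + 3 + 1) \<sigma>"
      unfolding e by (rule runs_Seq0[OF 6 7 order.refl])
  qed auto
  have "hd0 (replicate (length (filter (\<lambda>b. b) z)) 2) \<noteq> 0 \<longleftrightarrow> True \<in> set z" for z
    by (induction z) auto
  then have "acc \<longleftrightarrow> \<phi> (st c = acc_state) (hd0 (map bsym r)) (True \<in> set (tl r))"
    by (simp add: acc_def acc_state_def)
  moreover have "\<sigma> 0 \<noteq> [] \<longleftrightarrow> acc" by (simp add: \<sigma>_def)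
  moreover have "runs (decider M \<phi>) (start_store [x, y] k) [] (20 * t + 4 * (length x + length y + length (bits k)) + 50) \<sigma>"
    unfolding decider_def
    by (rule runs_Seq0[OF 1 runs_Seq0[OF 2 runs_Seq0[OF 3 runs_Seq0[OF 4 runs_Seq0[OF 5 8 order.refl] order.refl]
      order.refl] order.refl]]) (simp add: input_syms_1)
  ultimately show ?thesis unfolding r_def by blast
qed

lemma decider_wf:
  assumes "wf_tm M" "num_states M < A" "num_symbols M < A" "14 \<le> K"
  shows "wfc K A (decider M \<phi>)" "flipfree A (decider M \<phi>)"
proof -
  have A: "5 \<le> A" using assms(1,3) by (simp add: wf_tm_def)
  then show "wfc K A (decider M \<phi>)" "flipfree A (decider M \<phi>)" using assms shift_less[OF A]
    by (auto simp: decider_def until_sep_def intro!: wfc_each flipfree_each simulate_wf)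
qed

lemma tm_time_le:
  assumes "N \<le> a * W" "t \<le> a * W" "1 \<le> W"
  shows "tm_time N t + 2 \<le> (4 * a * a + 4 * a + 2) * W\<^sup>2"
proof -
  have W: "1 \<le> W\<^sup>2" "W \<le> W\<^sup>2" using assms(3) by (simp_all add: power2_eq_square)
  have "tm_time N t \<le> (a * W) * (2 * (a * W + a * W) + 4)" unfolding tm_time_def
    using assms by (intro mult_mono add_mono) auto
  also have "\<dots> = 4 * a * a * W\<^sup>2 + 4 * a * W" by (simp add: algebra_simps power2_eq_square)
  also have "\<dots> \<le> 4 * a * a * W\<^sup>2 + 4 * a * W\<^sup>2" using W by simp
  finally show ?thesis using W by (simp add: algebra_simps)
qed

lemma fits_compatible:
  assumes "fits y bs" "fits y bs'"
  shows "\<exists>r r'. bs @ r = bs' @ r'"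
proof -
  have *: "\<exists>r. bs @ r = bs'" if "fits y bs" "fits y bs'" "length bs \<le> length bs'" for bs bs'
  proof -
    have "bs = take (length bs) bs'" using that by (auto simp: fits_def intro: nth_equalityI)
    then show ?thesis by (metis append_take_drop_id)
  qed
  show ?thesis using *[OF assms] *[OF assms(2,1)] by (metis append_Nil2 nat_le_linear)
qed

text \<open>The halting run that fits \<open>y\<close> is unique, so the existential quantifier
  speaks of one run. Strings too short for a path are covered by the default False, so membership is
  meaningful for every \<open>y\<close>.\<close>

definition outcome :: "tm \<Rightarrow> (bool \<Rightarrow> nat \<Rightarrow> bool \<Rightarrow> bool) \<Rightarrow> ((bool list \<times> bool list) \<times> nat) set" where
  "outcome M \<phi> = {((x, y), k). \<exists>bs t c. reach M (init [x] k) bs t c \<and> halted c \<and> fits y bs \<and>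
     \<phi> (st c = acc_state) (hd0 (map bsym (drop (length bs) y))) (True \<in> set (tl (drop (length bs) y)))}"

text \<open>A run cannot reach one step beyond the time bound, so extending it that far must meet a
  halting configuration.\<close>

lemma k_restricted_path:
  assumes "k_restricted M"
  shows "\<exists>bs t c. reach M (init [x] k) bs t c \<and> halted c \<and> fits y bs"
proof -
  obtain f g d where M: "wf_tm M" "\<And>bs t c. reach M (init [x] k) bs t c \<Longrightarrow> t \<le> g k * (length x + 1) ^ d"
    using assms unfolding k_restricted_def by blast
  obtain bs t c where r: "reach M (init [x] k) bs t c" "fits y bs" "halted c \<or> t = g k * (length x + 1) ^ d + 1"
    using fits_extend[OF M(1) inb_init[OF M(1)], of "[x]" k y] by blast
  then show ?thesis using M(2)[OF r(1)] by auto
qed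

lemma outcome_iff:
  assumes "reach M (init [x] k) bs t c" "halted c" "fits y bs"
  shows "((x, y), k) \<in> outcome M \<phi> \<longleftrightarrow>
    \<phi> (st c = acc_state) (hd0 (map bsym (drop (length bs) y))) (True \<in> set (tl (drop (length bs) y)))"
proof -
  have "bs' = bs \<and> c' = c" if "reach M (init [x] k) bs' t' c'" "halted c'" "fits y bs'" for bs' t' c'
    using fits_compatible[OF that(3) assms(3)] reach_prefix[OF that(1) assms(1,2)] that(2) by blast
  then show ?thesis unfolding outcome_def using assms by blast
qed

lemma FPT3_outcome:
  assumes M: "k_restricted M"
  shows "FPT3 (outcome M \<phi>)"
proof -
  obtain f g d where wf: "wf_tm M" and g: "computable g"
    and b: "\<And>x k bs t c. reach M (init [x] k) bs t c \<Longrightarrow> t \<le> g k * (length x + 1) ^ d"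
    using assms unfolding k_restricted_def by blast
  define A where "A = num_states M + num_symbols M + 4"
  have w: "wfc 14 A (decider M \<phi>)" and ff: "flipfree A (decider M \<phi>)"
    by (rule decider_wf; use wf in \<open>auto simp: A_def wf_tm_def\<close>)+
  obtain N where N: "wf_tm N" "flipfree A (decider M \<phi>) \<Longrightarrow> deterministic N"
    "\<And>ws k bs t \<sigma>. exec (decider M \<phi>) (start_store ws k) bs t \<sigma> \<Longrightarrow>
       \<exists>T cf. reach N (init ws k) bs T cf \<and> halted cf \<and> (st cf = acc_state \<longleftrightarrow> \<sigma> 0 \<noteq> []) \<and>
         T \<le> tm_time (length (input_syms ws k)) t + 2"
    by (rule compile[OF w]) (auto simp: A_def)
  define s where "s k = g k + length (bits k) + 1" for k
  \<comment> \<open>The factor is that of \<open>tm_time_le\<close> for \<open>a = 100\<close>; the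
    exponent 2 is the quadratic slowdown of the compiler.\<close>
  have "bounded (\<lambda>k. (4 * 100 * 100 + 4 * 100 + 2) * (g k + length (bits k) + 1) ^ 2)"
    using bounded_poly[OF bounded_add[OF bounded_computable[OF g] bounded_length_bits[OF bounded_computable[OF g]]], of "4 * 100 * 100 + 4 * 100 + 2" 1 2] by simp
  then obtain h where h: "computable h" "\<And>k. (4 * 100 * 100 + 4 * 100 + 2) * s k ^ 2 \<le> h k"
    unfolding bounded_def s_def by blast
  have "\<exists>bs T cf. reach N (init [x, y] k) bs T cf \<and> halted cf \<and>
      T \<le> h k * (length x + length y + 1) ^ (2 * (d + 1)) \<and>
      (st cf = acc_state \<longleftrightarrow> ((x, y), k) \<in> outcome M \<phi>)" for x y k
  proof -
    obtain bs t c where r: "reach M (init [x] k) bs t c" "halted c" "fits y bs"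
      using k_restricted_path[OF M] by blast
    obtain \<sigma> t' where \<sigma>: "t' \<le> 20 * t + 4 * (length x + length y + length (bits k)) + 50"
      "exec (decider M \<phi>) (start_store [x, y] k) [] t' \<sigma>" "\<sigma> 0 \<noteq> [] \<longleftrightarrow> ((x, y), k) \<in> outcome M \<phi>"
      using runs_decider[OF wf r, of \<phi>] outcome_iff[OF r, of \<phi>] unfolding runs_def by blast
    obtain T cf where T: "reach N (init [x, y] k) [] T cf" "halted cf" "st cf = acc_state \<longleftrightarrow> \<sigma> 0 \<noteq> []"
       "T \<le> tm_time (length (input_syms [x, y] k)) t' + 2"
      using N(3)[OF \<sigma>(2)] by blast
    define n where "n = length x + length y + 1"
    \<comment> \<open>A function of \<open>k\<close> times a power of \<open>n\<close>, so its
      square again has the form demanded by \<open>fpt_via\<close>. The exponent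
      \<open>d + 1\<close> instead of \<open>d\<close> puts \<open>n\<close> itself below the power
      even for \<open>d = 0\<close>.\<close>
    define W where "W = s k * n ^ (d + 1)"
    have n0: "1 \<le> n" by (simp add: n_def)
    have n1: "1 \<le> n ^ (d + 1)" "n \<le> n ^ (d + 1)" "1 \<le> n"
      using n0 one_le_power[OF n0] self_le_power[OF n0] by auto
    have "t \<le> g k * n ^ (d + 1)"
    proof -
      have "t \<le> g k * (length x + 1) ^ d" using b[OF r(1)] .
      also have "\<dots> \<le> g k * n ^ d" by (intro mult_left_mono power_mono) (auto simp: n_def)
      also have "\<dots> \<le> g k * n ^ (d + 1)" using n0 by (intro mult_left_mono power_increasing) auto
      finally show ?thesis .
    qed
    then have W: "t + length (bits k) + n \<le> 2 * W" "1 \<le> W"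
    proof -
      assume t: "t \<le> g k * n ^ (d + 1)"
      have "length (bits k) \<le> length (bits k) * n ^ (d + 1)" using n1(1) by simp
      moreover have "W = g k * n ^ (d + 1) + length (bits k) * n ^ (d + 1) + n ^ (d + 1)"
        unfolding W_def s_def by (simp only: distrib_right mult_1)
      ultimately show "t + length (bits k) + n \<le> 2 * W" using t n1(2) by linarith
      have "1 * 1 \<le> s k * n ^ (d + 1)" using n1(1) by (intro mult_le_mono) (auto simp: s_def)
      then show "1 \<le> W" by (simp add: W_def)
    qed
    have "t' \<le> 20 * (t + length (bits k) + n) + 50" using \<sigma>(1) by (simp add: n_def)
    also have "\<dots> \<le> 20 * (2 * W) + 50 * W" using W by (intro add_mono mult_left_mono) simp_all
    finally have "t' \<le> 100 * W" by simp
    moreover have "length (input_syms [x, y] k) \<le> 100 * W" using W unfolding n_def by (simp add: input_syms_2)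
    ultimately have "T \<le> (4 * 100 * 100 + 4 * 100 + 2) * W\<^sup>2" using tm_time_le[of _ 100 W t'] W(2) T(4) by (meson order_trans)
    also have "W\<^sup>2 = s k ^ 2 * n ^ (2 * (d + 1))" by (simp only: W_def power_mult_distrib power_mult[symmetric] mult.commute[of 2])
    also have "(4 * 100 * 100 + 4 * 100 + 2) * (s k ^ 2 * n ^ (2 * (d + 1))) \<le> h k * n ^ (2 * (d + 1))"
      using h(2)[of k] by (metis mult.assoc mult_le_mono1)
    finally show ?thesis using T(1,2,3) \<sigma>(3) unfolding n_def by blast
  qed
  then show ?thesis unfolding fpt_via_def using N(1) N(2)[OF ff] h(1)
    by (intro exI[of _ N] exI[of _ h] exI[of _ "2 * (d + 1)"]) (auto simp: case_prod_beta)
qed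

section \<open>Counting choice strings\<close>

lemma card_bool_lists: "card {y :: bool list. length y = n} = 2 ^ n"
  using card_lists_length_eq[of "UNIV :: bool set" n] by simp

lemma finite_bool_lists: "finite {y :: bool list. length y = n}"
  using finite_lists_length_eq[of "UNIV :: bool set" n] by simp

lemma acc_rej_disjoint: "acc_paths M x k \<inter> rej_paths M x k = {}"
proof -
  have False if "reach M (init [x] k) bs t c" "st c = acc_state" "reach M (init [x] k) bs t' c'" "st c' = rej_state" for bs t c t' c'
    using reach_prefix[OF that(1,3), of "[]" "[]"] that(2,4) by (auto simp: halted_def acc_state_def rej_state_def)
  then show ?thesis by (auto simp: acc_paths_def rej_paths_def)
qed

text \<open>Every string of length \<open>P\<close> extends the choices of exactly one halting path,
  so the strings split into disjoint blocks \<open>bs @ r\<close>. Within a block the verdict is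
  constant and only \<open>r\<close> varies.\<close>

lemma card_outcome:
  assumes M: "k_restricted M" and P: "\<And>bs. bs \<in> acc_paths M x k \<union> rej_paths M x k \<Longrightarrow> length bs \<le> P"
  shows "card {y. length y = P \<and> ((x, y), k) \<in> outcome M \<phi>} =
    (\<Sum>bs\<in>acc_paths M x k \<union> rej_paths M x k. card {r. length r = P - length bs \<and>
      \<phi> (bs \<in> acc_paths M x k) (hd0 (map bsym r)) (True \<in> set (tl r))})"
proof -
  let ?H = "acc_paths M x k \<union> rej_paths M x k"
  define R where "R bs = {r. length r = P - length bs \<and>
      \<phi> (bs \<in> acc_paths M x k) (hd0 (map bsym r)) (True \<in> set (tl r))}" for bs
  have H: "\<exists>t c. reach M (init [x] k) bs t c \<and> halted c" if "bs \<in> ?H" for bs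
    using that by (auto simp: acc_paths_def rej_paths_def halted_def)
  have Hacc: "st c = acc_state \<longleftrightarrow> bs \<in> acc_paths M x k" if "reach M (init [x] k) bs t c" "halted c" for bs t c
    using that acc_rej_disjoint[of M x k] by (auto simp: acc_paths_def rej_paths_def halted_def)
  have "{y. length y = P \<and> ((x, y), k) \<in> outcome M \<phi>} = (\<Union>bs\<in>?H. (\<lambda>r. bs @ r) ` R bs)"
  proof (intro equalityI subsetI)
    fix y assume y: "y \<in> {y. length y = P \<and> ((x, y), k) \<in> outcome M \<phi>}"
    obtain bs t c where r: "reach M (init [x] k) bs t c" "halted c" "fits y bs"
      using k_restricted_path[OF M] by blast
    have bs: "bs \<in> ?H" using r by (auto simp: acc_paths_def rej_paths_def halted_def)
    then have "bs = take (length bs) y" using fits_take[OF r(3)] P[OF bs] y by simp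
    then have "y = bs @ drop (length bs) y" by (metis append_take_drop_id)
    moreover have "drop (length bs) y \<in> R bs"
      using y outcome_iff[OF r, of \<phi>] Hacc[OF r(1,2)] by (simp add: R_def)
    ultimately show "y \<in> (\<Union>bs\<in>?H. (\<lambda>r. bs @ r) ` R bs)" using bs by blast
  next
    fix y assume "y \<in> (\<Union>bs\<in>?H. (\<lambda>r. bs @ r) ` R bs)"
    then obtain bs r where bs: "bs \<in> ?H" "y = bs @ r" "r \<in> R bs" by blast
    obtain t c where c: "reach M (init [x] k) bs t c" "halted c" using H[OF bs(1)] by blast
    show "y \<in> {y. length y = P \<and> ((x, y), k) \<in> outcome M \<phi>}"
      using outcome_iff[OF c, of y \<phi>] bs(2,3) P[OF bs(1)] Hacc[OF c] fits_append by (simp add: R_def)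
  qed
  moreover have "finite ?H"
    by (rule finite_subset[of _ "\<Union>n\<in>{..P}. {y. length y = n}"]) (use P finite_bool_lists in auto)
  moreover have "finite (R bs)" for bs
    by (rule finite_subset[OF _ finite_bool_lists[of "P - length bs"]]) (auto simp: R_def)
  \<comment> \<open>A string in both blocks would extend two halting paths, which makes them
    equal.\<close>
  moreover have "(\<lambda>r. bs @ r) ` R bs \<inter> (\<lambda>r. bs' @ r) ` R bs' = {}" if h: "bs \<in> ?H" "bs' \<in> ?H" "bs \<noteq> bs'" for bs bs'
  proof -
    obtain t c where "reach M (init [x] k) bs t c" "halted c" using H[OF h(1)] by blast
    moreover obtain t' c' where "reach M (init [x] k) bs' t' c'" "halted c'" using H[OF h(2)] by blast
    ultimately have "bs @ r \<noteq> bs' @ r'" for r r' using reach_prefix h(3) by blast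
    then show ?thesis by blast
  qed
  ultimately have "card {y. length y = P \<and> ((x, y), k) \<in> outcome M \<phi>} = (\<Sum>bs\<in>?H. card ((\<lambda>r. bs @ r) ` R bs))"
    by (simp only:) (rule card_UN_disjoint, auto)
  also have "\<dots> = (\<Sum>bs\<in>?H. card (R bs))" by (intro sum.cong card_image HOL.refl) (auto simp: inj_on_def)
  finally show ?thesis unfolding R_def .
qed

lemma finite_paths:
  assumes "k_restricted M"
  shows "finite (acc_paths M x k)" "finite (rej_paths M x k)"
proof -
  obtain f where "\<And>x k bs t cf. reach M (init [x] k) bs t cf \<Longrightarrow> length bs \<le> f k * clog (length x)"
    using assms unfolding k_restricted_def by blast
  then have "acc_paths M x k \<union> rej_paths M x k \<subseteq> (\<Union>n\<in>{..f k * clog (length x)}. {y. length y = n})"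
    by (auto simp: acc_paths_def rej_paths_def)
  then have "finite (acc_paths M x k \<union> rej_paths M x k)" using finite_bool_lists finite_subset by blast
  then show "finite (acc_paths M x k)" "finite (rej_paths M x k)" by auto
qed

text \<open>Kraft's equality for the tree of choices, obtained by counting with the rule that
  accepts everything.\<close>

lemma kraft:
  assumes M: "k_restricted M" and P: "\<And>bs. bs \<in> acc_paths M x k \<union> rej_paths M x k \<Longrightarrow> length bs \<le> P"
  shows "(\<Sum>bs\<in>acc_paths M x k \<union> rej_paths M x k. 2 ^ (P - length bs)) = (2::nat) ^ P"
proof -
  have "((x, y), k) \<in> outcome M (\<lambda>_ _ _. True)" for y
    using k_restricted_path[OF M, of x k y] outcome_iff by blast
  then show ?thesis using card_outcome[where M = M and x = x and k = k and P = P and \<phi> = "\<lambda>_ _ _. True", OF M P] by (simp add: card_bool_lists)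
qed

text \<open>The block of a path has \<open>2 ^ (P - length bs)\<close> strings, which is
  \<open>2 ^ P\<close> times the probability of that path.\<close>

lemma card_accepting:
  assumes M: "k_restricted M" and P: "\<And>bs. bs \<in> acc_paths M x k \<union> rej_paths M x k \<Longrightarrow> length bs \<le> P"
  shows "real (card {y. length y = P \<and> ((x, y), k) \<in> outcome M (\<lambda>a _ _. a)}) = 2 ^ P * prob_acc M x k"
proof -
  let ?a = "acc_paths M x k" and ?r = "rej_paths M x k"
  have c: "card {r :: bool list. length r = P - length bs \<and> bs \<in> ?a} = (if bs \<in> ?a then 2 ^ (P - length bs) else 0)" for bs
    by (simp add: card_bool_lists)
  have "card {y. length y = P \<and> ((x, y), k) \<in> outcome M (\<lambda>a _ _. a)} =
      (\<Sum>bs\<in>?a \<union> ?r. if bs \<in> ?a then 2 ^ (P - length bs) else 0)"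
    using card_outcome[where M = M and x = x and k = k and P = P and \<phi> = "\<lambda>a _ _. a", OF M P] unfolding c by simp
  also have "\<dots> = (\<Sum>bs\<in>?a. 2 ^ (P - length bs))"
    by (rule sum.mono_neutral_cong_right) (use finite_paths[OF M] in auto)
  finally have "real (card {y. length y = P \<and> ((x, y), k) \<in> outcome M (\<lambda>a _ _. a)}) = (\<Sum>bs\<in>?a. 2 ^ (P - length bs))" by simp
  also have "\<dots> = (\<Sum>bs\<in>?a. 2 ^ P * (1 / 2) ^ length bs)"
    by (rule sum.cong) (use P in \<open>auto simp: power_diff power_divide\<close>)
  finally show ?thesis unfolding prob_acc_def by (simp add: sum_distrib_left)
qed

text \<open>Half of the \<open>2 ^ Suc n\<close> strings begin with True. The first set adds one
  string beginning with False, the second omits one beginning with True.\<close>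

lemma card_heads:
  "card {r. length r = Suc n \<and> (hd0 (map bsym r) = 2 \<or> True \<notin> set (tl r))} = 2 ^ n + 1"
  "card {r. length r = Suc n \<and> (hd0 (map bsym r) = 2 \<and> True \<in> set (tl r))} = 2 ^ n - 1"
proof -
  have *: "True \<notin> set t \<longleftrightarrow> t = replicate n False" if "length t = n" for t :: "bool list"
    using that by (metis (full_types) in_set_replicate replicate_eqI)
  have 1: "{r. length r = Suc n \<and> (hd0 (map bsym r) = 2 \<or> True \<notin> set (tl r))} =
      insert (False # replicate n False) (Cons True ` {t. length t = n})"
    using * by (auto simp: length_Suc_conv image_iff)
  show "card {r. length r = Suc n \<and> (hd0 (map bsym r) = 2 \<or> True \<notin> set (tl r))} = 2 ^ n + 1"
    unfolding 1 by (subst card_insert_disjoint) (auto simp: finite_bool_lists card_image card_bool_lists)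
  have 2: "{r. length r = Suc n \<and> (hd0 (map bsym r) = 2 \<and> True \<in> set (tl r))} =
      Cons True ` {t. length t = n \<and> True \<in> set t}"
    by (auto simp: length_Suc_conv image_iff)
  have 3: "{t. length t = n \<and> True \<in> set t} = {t. length t = n} - {replicate n False}"
  proof (rule set_eqI)
    fix t show "t \<in> {t. length t = n \<and> True \<in> set t} \<longleftrightarrow> t \<in> {t. length t = n} - {replicate n False}"
      using *[of t] by auto
  qed
  show "card {r. length r = Suc n \<and> (hd0 (map bsym r) = 2 \<and> True \<in> set (tl r))} = 2 ^ n - 1"
    unfolding 2 3 by (simp add: card_image card_Diff_singleton card_bool_lists)
qed

text \<open>Unused bits starting with True are accepted, those starting with False rejected, with one exception:
  \<open>False\<dots>False\<close> is accepted on accepting paths, and \<open>True False\<dots>False\<close> is rejected on rejecting ones.\<close>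

definition gap_rule :: "bool \<Rightarrow> nat \<Rightarrow> bool \<Rightarrow> bool" where
  "gap_rule a s l \<longleftrightarrow> (if a then s = 2 \<or> \<not> l else s = 2 \<and> l)"

text \<open>A path contributes \<open>2 ^ (P - length bs)\<close> plus or minus 1. The powers add up
  to \<open>2 ^ P\<close> by \<open>kraft\<close>, the signs to the gap. Strings have length
  \<open>Suc P\<close>, so that every path leaves at least one bit to the rule.\<close>

lemma card_gap:
  assumes M: "k_restricted M" and P: "\<And>bs. bs \<in> acc_paths M x k \<union> rej_paths M x k \<Longrightarrow> length bs \<le> P"
  shows "int (card {y. length y = Suc P \<and> ((x, y), k) \<in> outcome M gap_rule}) =
    2 ^ P + int (num_acc M x k) - int (num_rej M x k)"
proof -
  let ?a = "acc_paths M x k" and ?r = "rej_paths M x k"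
  have "int (card {r. length r = Suc P - length bs \<and> gap_rule (bs \<in> ?a) (hd0 (map bsym r)) (True \<in> set (tl r))}) =
      2 ^ (P - length bs) + (if bs \<in> ?a then 1 else - 1)" if "bs \<in> ?a \<union> ?r" for bs
    using P[OF that] card_heads[of "P - length bs"] by (simp add: gap_rule_def Suc_diff_le of_nat_diff)
  then have "int (card {y. length y = Suc P \<and> ((x, y), k) \<in> outcome M gap_rule}) =
      (\<Sum>bs\<in>?a \<union> ?r. 2 ^ (P - length bs) + (if bs \<in> ?a then 1 else - 1))"
    using card_outcome[OF M, of x k "Suc P" gap_rule] P by (simp add: le_SucI)
  also have "\<dots> = int (\<Sum>bs\<in>?a \<union> ?r. 2 ^ (P - length bs)) + (\<Sum>bs\<in>?a \<union> ?r. if bs \<in> ?a then 1 else - 1)"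
    by (simp add: sum.distrib)
  also have "(\<Sum>bs\<in>?a \<union> ?r. if bs \<in> ?a then 1 else - 1 :: int) =
      (\<Sum>bs\<in>?a. if bs \<in> ?a then 1 else - 1) + (\<Sum>bs\<in>?r. if bs \<in> ?a then 1 else - 1)"
    using finite_paths[OF M] acc_rej_disjoint by (intro sum.union_disjoint) auto
  also have "(\<Sum>bs\<in>?r. if bs \<in> ?a then 1 else - 1 :: int) = (\<Sum>bs\<in>?r. - 1)"
    using acc_rej_disjoint[of M x k] by (intro sum.cong) auto
  also have "int (\<Sum>bs\<in>?a \<union> ?r. 2 ^ (P - length bs)) = 2 ^ P"
  proof -
    have "(\<Sum>bs\<in>?a \<union> ?r. 2 ^ (P - length bs)) = (2::nat) ^ P" by (rule kraft[OF M P])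
    then show ?thesis by simp
  qed
  finally show ?thesis by (simp add: num_acc_def num_rej_def)
qed

section \<open>Guessing a string of prescribed length\<close>


lemma length_bits_le: "length (bits m) \<le> m"
proof (induction m rule: less_induct)
  case (less m)
  show ?case
  proof (cases "m = 0")
    case False
    then have "length (bits (m div 2)) \<le> m div 2" by (intro less.IH) simp
    then show ?thesis using False by (simp add: bits_pos)
  qed simp
qed

lemma bits_bounds: "0 < m \<Longrightarrow> 2 ^ (length (bits m) - 1) \<le> m \<and> m < 2 ^ length (bits m) \<and> 1 \<le> length (bits m)"
proof (induction m rule: less_induct)
  case (less m)
  show ?case
  proof (cases "m div 2 = 0")
    case True
    then have "m = 1" using less.prems by simp
    then show ?thesis by (simp add: bits_pos)
  next
    case False
    then have "2 ^ (length (bits (m div 2)) - 1) \<le> m div 2 \<and> m div 2 < 2 ^ length (bits (m div 2)) \<and> 1 \<le> length (bits (m div 2))"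
      using less.IH[of "m div 2"] less.prems by simp
    moreover obtain l where "length (bits (m div 2)) = Suc l" using calculation by (cases "length (bits (m div 2))") auto
    ultimately show ?thesis using less.prems by (simp add: bits_pos) linarith
  qed
qed

text \<open>For \<open>n \<ge> 2\<close>, rounding the logarithm of \<open>n\<close> up gives the
  number of digits of \<open>n - 1\<close>. Hence a binary counter run over all but one symbol of
  \<open>x\<close> has the required length, up to the convention for
  \<open>n \<le> 1\<close>.\<close>

lemma clog_bits: "clog n = max 1 (length (bits (n - 1)))"
proof (cases "n \<le> 1")
  case False
  define c where "c = length (bits (n - 1))"
  have c: "2 ^ (c - 1) \<le> n - 1" "n - 1 < 2 ^ c" "1 \<le> c" using bits_bounds[of "n - 1"] False by (auto simp: c_def)
  have 1: "2 ^ (c - 1) < real n"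
  proof -
    have "2 ^ (c - 1) < n" using c(1) False by simp
    then show ?thesis by (metis of_nat_less_iff of_nat_numeral of_nat_power)
  qed
  have 2: "real n \<le> 2 ^ c"
  proof -
    have "n \<le> 2 ^ c" using c(2) by simp
    then show ?thesis by (metis of_nat_le_iff of_nat_numeral of_nat_power)
  qed
  have n: "0 < real n" using False by simp
  have "\<lceil>log 2 (real n)\<rceil> = int c"
  proof (rule ceiling_unique)
    have "log 2 (2 ^ (c - 1)) < log 2 (real n)" using 1 n by (subst log_less_cancel_iff) auto
    then show "of_int (int c) - 1 < log 2 (real n)" using c(3) by (simp add: log_nat_power of_nat_diff)
    have "log 2 (real n) \<le> log 2 (2 ^ c)" using 2 n by (subst log_le_cancel_iff) auto
    then show "log 2 (real n) \<le> of_int (int c)" by (simp add: log_nat_power)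
  qed
  then have "clog n = c" using False by (simp add: clog_def)
  then show ?thesis using c(3) unfolding c_def by simp
qed (simp add: clog_def)

lemma clog_pos: "1 \<le> clog n" by (simp add: clog_bits)

lemma clog_le: "clog n \<le> n + 1"
  using length_bits_le[of "n - 1"] by (simp add: clog_bits)

section \<open>Flipping exactly \<open>f k * clog n\<close> coins\<close>

lemma runs_each_inc:
  "\<sigma> ZS = xs \<Longrightarrow> 0 \<notin> set xs \<Longrightarrow> \<sigma> CS = map bsym (bits m) \<Longrightarrow> \<sigma> TMP = [] \<Longrightarrow> m + length xs \<le> n \<Longrightarrow>
   length xs * (4 * n + 6) + 2 \<le> T \<Longrightarrow> \<sigma>' = \<sigma>(ZS := [], CS := map bsym (bits (m + length xs))) \<Longrightarrow>
   runs (each ZS (\<lambda>_. inc CS)) \<sigma> [] T \<sigma>'"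
proof (induction xs arbitrary: \<sigma> \<sigma>' T m)
  case Nil
  then show ?case by (intro runs_each_Nil) (auto simp: fun_eq_iff)
next
  case (Cons a xs)
  let ?\<sigma> = "\<sigma>(ZS := xs, CS := map bsym (bits (Suc m)))"
  show ?case
  proof (rule runs_each_Cons0[of _ _ a xs])
    show "runs (inc CS) (\<sigma>(ZS := xs)) [] (4 * n + 5) ?\<sigma>"
      by (rule runs_inc[where m = m]) (use Cons.prems length_bits_le[of m] in auto)
    show "runs (each ZS (\<lambda>_. inc CS)) ?\<sigma> [] (length xs * (4 * n + 6) + 2) \<sigma>'"
      by (rule Cons.IH[where m = "Suc m"]) (use Cons.prems in \<open>auto simp: fun_eq_iff\<close>)
  qed (use Cons.prems in auto)
qed

text \<open>One flip per entry of \<open>CS\<close>. The stack passes through \<open>TMP\<close> and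
  is restored, so the block can be repeated.\<close>

definition flips :: com where
  "flips = (each CS (\<lambda>s. Push TMP s) ;; each TMP (\<lambda>s. Push CS s ;; Flip YS))"

lemma runs_each_flip:
  "\<sigma> TMP = xs \<Longrightarrow> 0 \<notin> set xs \<Longrightarrow> length y = length xs \<Longrightarrow>
   \<sigma>' = \<sigma>(TMP := [], CS := rev xs @ \<sigma> CS, YS := rev (map bsym y) @ \<sigma> YS) \<Longrightarrow>
   runs (each TMP (\<lambda>s. Push CS s ;; Flip YS)) \<sigma> y (5 * length xs + 2) \<sigma>'"
proof (induction xs arbitrary: \<sigma> \<sigma>' y)
  case Nil
  then show ?case by (auto intro!: runs_each_Nil simp: fun_eq_iff)
next
  case (Cons a xs)
  obtain b z where y: "y = b # z" "length z = length xs" using Cons.prems(3) by (cases y) auto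
  let ?\<sigma> = "\<sigma>(TMP := xs, CS := a # \<sigma> CS, YS := bsym b # \<sigma> YS)"
  have 1: "runs (Push CS a ;; Flip YS) (\<sigma>(TMP := xs)) [b] 4 ?\<sigma>"
    by (rule runs_Seq0[OF runs_Push[OF HOL.refl order.refl] runs_Flip[OF _ order.refl]]) (auto simp: fun_eq_iff)
  have 2: "runs (each TMP (\<lambda>s. Push CS s ;; Flip YS)) ?\<sigma> z (5 * length xs + 2) \<sigma>'"
    by (rule Cons.IH) (use Cons.prems y in \<open>auto simp: fun_eq_iff\<close>)
  have "runs (each TMP (\<lambda>s. Push CS s ;; Flip YS)) \<sigma> ([b] @ z) (4 + (5 * length xs + 2) + 1) \<sigma>'"
    by (rule runs_each_Cons[OF Cons.prems(1) _ 1 2]) (use Cons.prems in auto)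
  then show ?case using y by simp
qed

lemma runs_flips:
  assumes "\<sigma> CS = cs" "0 \<notin> set cs" "length y = length cs" "\<sigma> TMP = []" "\<sigma>' = \<sigma>(YS := rev (map bsym y) @ \<sigma> YS)"
  shows "runs flips \<sigma> y (7 * length cs + 5) \<sigma>'"
  unfolding flips_def
proof (rule runs_Seq0)
  show "runs (each CS (\<lambda>s. Push TMP s)) \<sigma> [] (2 * length cs + 2) (\<sigma>(CS := [], TMP := rev cs))"
    by (rule runs_each_push[where h = "\<lambda>s. s"]) (use assms in auto)
  show "runs (each TMP (\<lambda>s. Push CS s ;; Flip YS)) (\<sigma>(CS := [], TMP := rev cs)) y (5 * length (rev cs) + 2) \<sigma>'"
    by (rule runs_each_flip) (use assms in \<open>auto simp: fun_eq_iff\<close>)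
qed simp

text \<open>Each mark on \<open>US\<close> pays for one block of flips and is kept on
  \<open>FS\<close>, where an empty stack later reveals that there were no blocks.\<close>

lemma runs_all_flips:
  "\<sigma> US = replicate m 1 \<Longrightarrow> \<sigma> CS = cs \<Longrightarrow> 0 \<notin> set cs \<Longrightarrow> length y = m * length cs \<Longrightarrow> \<sigma> TMP = [] \<Longrightarrow>
   \<sigma>' = \<sigma>(US := [], FS := replicate m 1 @ \<sigma> FS, YS := rev (map bsym y) @ \<sigma> YS) \<Longrightarrow>
   runs (each US (\<lambda>_. Push FS 1 ;; flips)) \<sigma> y (m * (7 * length cs + 8) + 2) \<sigma>'"
proof (induction m arbitrary: \<sigma> \<sigma>' y)
  case 0
  then show ?case by (auto intro!: runs_each_Nil simp: fun_eq_iff)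
next
  case (Suc m)
  let ?c = "length cs"
  let ?\<sigma> = "\<sigma>(US := replicate m 1, FS := 1 # \<sigma> FS, YS := rev (map bsym (take ?c y)) @ \<sigma> YS)"
  have 1: "runs (Push FS 1 ;; flips) (\<sigma>(US := replicate m 1)) (take ?c y) (7 * ?c + 7) ?\<sigma>"
    by (rule runs_Seq0[OF runs_Push[OF HOL.refl order.refl] runs_flips[where cs = cs]])
      (use Suc.prems in \<open>auto simp: fun_eq_iff\<close>)
  have e: "rev (map bsym y) = rev (map bsym (drop ?c y)) @ rev (map bsym (take ?c y))"
    by (metis append_take_drop_id map_append rev_append)
  have 2: "runs (each US (\<lambda>_. Push FS 1 ;; flips)) ?\<sigma> (drop ?c y) (m * (7 * ?c + 8) + 2) \<sigma>'"
  proof (rule Suc.IH)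
    show "\<sigma>' = ?\<sigma>(US := [], FS := replicate m 1 @ ?\<sigma> FS, YS := rev (map bsym (drop ?c y)) @ ?\<sigma> YS)"
      unfolding Suc.prems(6) e by (auto simp: fun_eq_iff replicate_app_Cons_same)
  qed (use Suc.prems in auto)
  have "runs (each US (\<lambda>_. Push FS 1 ;; flips)) \<sigma> (take ?c y @ drop ?c y) (7 * ?c + 7 + (m * (7 * ?c + 8) + 2) + 1) \<sigma>'"
    by (rule runs_each_Cons[where a = 1, OF _ _ 1 2]) (use Suc.prems in auto)
  then show ?case by (simp add: algebra_simps)
qed

text \<open>\<open>CS\<close> represents \<open>clog n\<close> by its height: it counts
  \<open>x\<close> without one symbol, and re-pushing \<open>max 1 s\<close> gives the empty counter
  one entry. The simulated ticker leaves \<open>f k\<close> marks on \<open>US\<close>. The test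
  \<open>c \<noteq> 0\<close> rejects everything if \<open>f k = 0\<close>: there is then a single
  string \<open>y\<close>, and the threshold \<open>2 powr (- 1) + 1\<close> is out of
  reach.\<close>

definition guess :: "tm \<Rightarrow> tm \<Rightarrow> com" where
  "guess S N = (until_sep 0 KS (\<lambda>s. s) ;; each 0 (\<lambda>s. Push XS s ;; Push ZS s) ;; Pop ZS (\<lambda>_. Skip) ;;
     each ZS (\<lambda>_. inc CS) ;; Pop CS (\<lambda>s. Push CS (max 1 s)) ;;
     dup KS RT shift ;; simulate S ;; Pop VD (\<lambda>_. Skip) ;; each US (\<lambda>_. Push FS 1 ;; flips) ;;
     dup KS RT shift ;; Push RT 4 ;; each YS (\<lambda>s. Push RT (shift s)) ;; Push RT 4 ;;
     each XS (\<lambda>s. Push 0 s) ;; each 0 (\<lambda>s. Push RT (shift s)) ;; simulate N ;;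
     Pop VD (\<lambda>v. Pop FS (\<lambda>c. if v = 2 \<and> c \<noteq> 0 then Push 0 1 else Skip)))"

lemma runs_guess:
  assumes S: "wf_tm S" "reach S (init [] k) (replicate m False) t c" "halted c"
    and N: "wf_tm N" "deterministic N" "reach N (init [x, y] k) bs t' c'" "halted c'"
    and y: "length y = m * clog (length x)"
  shows "\<exists>\<sigma>. runs (guess S N) (start_store [x] k) y (20 * (t + t') + 20 * length (bits k) + 4 * length x * length x
      + 20 * length x + 4 * length y + m * (7 * clog (length x) + 8) + 150) \<sigma> \<and>
    (\<sigma> 0 \<noteq> [] \<longleftrightarrow> st c' = acc_state \<and> m \<noteq> 0)"
proof -
  have bs: "bs = []" using reach_deterministic N by blast
  let ?k = "map bsym (bits k)" and ?y = "map bsym y" and ?x = "map bsym x" and ?n = "length x"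
  define s0 :: store where "s0 = (\<lambda>_. [])"
  have 1: "runs (until_sep 0 KS (\<lambda>s. s)) (start_store [x] k) [] (2 * length ?k + 2) (s0(KS := ?k, 0 := rev ?x))"
    by (rule runs_until_sep[where xs = "rev ?k"]) (auto simp: start_store_def input_syms_1 s0_def fun_eq_iff rev_map)
  have 2: "runs (each 0 (\<lambda>s. Push XS s ;; Push ZS s)) (s0(KS := ?k, 0 := rev ?x)) [] (4 * length ?x + 2)
      (s0(KS := ?k, XS := ?x, ZS := ?x))"
    by (rule runs_each_push2[where h = "\<lambda>s. s" and h' = "\<lambda>s. s"]) (auto simp: s0_def fun_eq_iff rev_map)
  have 3: "runs (Pop ZS (\<lambda>_. Skip)) (s0(KS := ?k, XS := ?x, ZS := ?x)) [] 2 (s0(KS := ?k, XS := ?x, ZS := map bsym (tl x)))"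
    by (rule runs_Exit[where T = 1]) (auto intro!: runs_Skip simp: fun_eq_iff map_tl)
  let ?b = "map bsym (bits (?n - 1))"
  have 4: "runs (each ZS (\<lambda>_. inc CS)) (s0(KS := ?k, XS := ?x, ZS := map bsym (tl x))) [] (?n * (4 * ?n + 6) + 2)
      (s0(KS := ?k, XS := ?x, CS := ?b))"
    by (rule runs_each_inc[where m = 0 and n = ?n and xs = "map bsym (tl x)"]) (auto simp: s0_def fun_eq_iff diff_le_self intro!: mult_le_mono)
  \<comment> \<open>Only the height of this stack is used; as a counter it would be wrong for the
    value 0.\<close>
  define cs where "cs = max 1 (hd0 ?b) # tl ?b"
  have cs: "0 \<notin> set cs" "length cs = clog ?n"
    by (cases "bits (?n - 1)"; auto simp: cs_def clog_bits)+
  have 5: "runs (Pop CS (\<lambda>s. Push CS (max 1 s))) (s0(KS := ?k, XS := ?x, CS := ?b)) [] 2 (s0(KS := ?k, XS := ?x, CS := cs))"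
    by (rule runs_Exit[where T = 1]) (auto intro!: runs_Push simp: fun_eq_iff cs_def)
  let ?s = "s0(KS := ?k, XS := ?x, CS := cs)"
  have 6: "runs (dup KS RT shift) ?s [] (6 * length ?k + 5) (?s(RT := map Suc (input_syms [] k)))"
    by (rule runs_dup) (auto simp: s0_def fun_eq_iff input_syms_0)
  \<comment> \<open>The ticker gets no choice string at all, so all its choices default to False and
    it follows the run with \<open>m\<close> of them.\<close>
  have f: "fits [] (replicate m False)" by (simp add: fits_def)
  have 7: "runs (simulate S) (?s(RT := map Suc (input_syms [] k))) [] (20 * t + 2 * length (input_syms [] k) + 20)
      (?s(US := replicate m 1, VD := [st c + 1]))"
    by (rule runs_simulate[OF S f]) (auto simp: s0_def fun_eq_iff)
  have 8: "runs (Pop VD (\<lambda>_. Skip)) (?s(US := replicate m 1, VD := [st c + 1])) [] 2 (?s(US := replicate m 1))"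
    by (rule runs_Exit[where T = 1]) (auto intro!: runs_Skip simp: s0_def fun_eq_iff)
  let ?f = "replicate m 1 :: nat list"
  have 9: "runs (each US (\<lambda>_. Push FS 1 ;; flips)) (?s(US := replicate m 1)) y (m * (7 * length cs + 8) + 2)
      (?s(FS := ?f, YS := rev ?y))"
    by (rule runs_all_flips) (use cs y in \<open>auto simp: s0_def fun_eq_iff\<close>)
  let ?s1 = "?s(FS := ?f, YS := rev ?y)"
  have 10: "runs (dup KS RT shift) ?s1 [] (6 * length ?k + 5) (?s1(RT := map Suc ?k))"
    by (rule runs_dup) (auto simp: s0_def fun_eq_iff)
  have 11: "runs (Push RT 4) (?s1(RT := map Suc ?k)) [] 1 (?s1(RT := 4 # map Suc ?k))"
    by (rule runs_Push) (auto simp: fun_eq_iff)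
  let ?r = "map Suc ?y @ 4 # map Suc ?k"
  have 12: "runs (each YS (\<lambda>s. Push RT (shift s))) (?s1(RT := 4 # map Suc ?k)) [] (2 * length y + 2) (?s(FS := ?f, RT := ?r))"
    by (rule runs_each_push) (auto simp: s0_def fun_eq_iff rev_map)
  have 13: "runs (Push RT 4) (?s(FS := ?f, RT := ?r)) [] 1 (?s(FS := ?f, RT := 4 # ?r))"
    by (rule runs_Push) (auto simp: fun_eq_iff)
  let ?s2 = "s0(KS := ?k, CS := cs, FS := ?f)"
  have 14: "runs (each XS (\<lambda>s. Push 0 s)) (?s(FS := ?f, RT := 4 # ?r)) [] (2 * ?n + 2) (?s2(RT := 4 # ?r, 0 := rev ?x))"
    by (rule runs_each_push[where h = "\<lambda>s. s"]) (auto simp: s0_def fun_eq_iff rev_map)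
  have 15: "runs (each 0 (\<lambda>s. Push RT (shift s))) (?s2(RT := 4 # ?r, 0 := rev ?x)) [] (2 * ?n + 2)
      (?s2(RT := map Suc (input_syms [x, y] k)))"
    by (rule runs_each_push) (auto simp: s0_def fun_eq_iff rev_map input_syms_2)
  have 16: "runs (simulate N) (?s2(RT := map Suc (input_syms [x, y] k))) [] (20 * t' + 2 * length (input_syms [x, y] k) + 20)
      (?s2(VD := [st c' + 1]))"
    by (rule runs_simulate[OF N(1,3,4), where y = "[]"]) (auto simp: s0_def fun_eq_iff bs)
  define acc where "acc = (st c' + 1 = 2 \<and> hd0 ?f \<noteq> 0)"
  define \<sigma> where "\<sigma> = ?s2(FS := tl ?f, 0 := (if acc then [1] else []))"
  have 17: "runs (Pop VD (\<lambda>v. Pop FS (\<lambda>c. if v = 2 \<and> c \<noteq> 0 then Push 0 1 else Skip))) (?s2(VD := [st c' + 1])) [] 3 \<sigma>"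
  proof (rule runs_Exit[where T = 2], rule runs_Exit[where T = 1])
    let ?z = "?s2(VD := [st c' + 1])"
    have e: "?z VD = [st c' + 1]" "(?z(VD := [])) FS = ?f" by auto
    show "runs (if hd0 (?z VD) = 2 \<and> hd0 ((?z(VD := tl (?z VD))) FS) \<noteq> 0 then Push 0 1 else Skip)
      (?z(VD := tl (?z VD), FS := tl ((?z(VD := tl (?z VD))) FS))) [] 1 \<sigma>"
      unfolding e list.sel hd0_simps acc_def[symmetric]
      by (rule runs_if_push) (auto simp: \<sigma>_def s0_def fun_eq_iff)
  qed auto
  have "acc \<longleftrightarrow> st c' = acc_state \<and> m \<noteq> 0" unfolding acc_def acc_state_def by (cases m) auto
  then have "\<sigma> 0 \<noteq> [] \<longleftrightarrow> st c' = acc_state \<and> m \<noteq> 0" by (simp add: \<sigma>_def)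
  moreover have "runs (guess S N) (start_store [x] k) y (20 * (t + t') + 20 * length (bits k) + 4 * length x * length x
      + 20 * length x + 4 * length y + m * (7 * clog (length x) + 8) + 150) \<sigma>"
    unfolding guess_def
    by (rule runs_mono, rule runs_Seq0[OF 1 runs_Seq0[OF 2 runs_Seq0[OF 3 runs_Seq0[OF 4 runs_Seq0[OF 5 runs_Seq0[OF 6
      runs_Seq0[OF 7 runs_Seq0[OF 8 runs_Seq[OF 9 runs_Seq0[OF 10 runs_Seq0[OF 11 runs_Seq0[OF 12 runs_Seq0[OF 13
      runs_Seq0[OF 14 runs_Seq0[OF 15 runs_Seq0[OF 16 17 order.refl] order.refl] order.refl] order.refl] order.refl]
      order.refl] order.refl], unfolded append_Nil2] order.refl] order.refl] order.refl] order.refl] order.refl] order.refl]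
      order.refl] order.refl])
      (simp add: cs input_syms_0 input_syms_2 algebra_simps)
  ultimately show ?thesis by blast
qed

lemma guess_wf:
  assumes "wf_tm S" "wf_tm N" "num_states S < A" "num_symbols S < A" "num_states N < A" "num_symbols N < A" "16 \<le> K"
  shows "wfc K A (guess S N)"
proof -
  have A: "5 \<le> A" using assms(1,4) by (simp add: wf_tm_def)
  show ?thesis using assms A shift_less[OF A]
    by (auto simp: guess_def flips_def until_sep_def inc_def intro!: wfc_each dup_wf shift_less simulate_wf)
qed

lemma guessing_machine:
  assumes B: "FPT3 B" and f: "computable f"
  obtains N h d where "wf_tm N" "computable h"
    "\<And>x y k. length y = f k * clog (length x) \<Longrightarrow> \<exists>T c. reach N (init [x] k) y T c \<and> halted c \<and>
       (st c = acc_state \<longleftrightarrow> ((x, y), k) \<in> B \<and> f k \<noteq> 0) \<and> T \<le> h k * (length x + 1) ^ d"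
proof -
  obtain N hN d where N: "wf_tm N" "deterministic N" "computable hN"
    "\<And>x y k. \<exists>bs t c. reach N (init [x, y] k) bs t c \<and> halted c \<and>
      t \<le> hN k * (length x + length y + 1) ^ d \<and> (st c = acc_state \<longleftrightarrow> ((x, y), k) \<in> B)"
    using B unfolding fpt_via_def by (auto simp: case_prod_beta)
  obtain S T where S: "wf_tm S" "\<And>k. \<exists>c. reach S (init [] k) (replicate (f k) False) (T k) c \<and> halted c" "bounded T"
    using bounded_ticker[OF f] by blast
  define A where "A = num_states S + num_symbols S + num_states N + num_symbols N + 4"
  have w: "wfc 16 A (guess S N)" by (rule guess_wf) (use S N in \<open>auto simp: A_def wf_tm_def\<close>)
  obtain M where M: "wf_tm M"
    "\<And>ws k bs t \<sigma>. exec (guess S N) (start_store ws k) bs t \<sigma> \<Longrightarrow>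
       \<exists>T cf. reach M (init ws k) bs T cf \<and> halted cf \<and> (st cf = acc_state \<longleftrightarrow> \<sigma> 0 \<noteq> []) \<and>
         T \<le> tm_time (length (input_syms ws k)) t + 2"
    by (rule compile[OF w]) (auto simp: A_def)
  \<comment> \<open>\<open>f\<close> is covered by \<open>T\<close>: a run has at least as many
    steps as choices.\<close>
  define s where "s k = T k + hN k + length (bits k) + 2" for k
  \<comment> \<open>The factor of \<open>tm_time_le\<close> for \<open>a = 300\<close>; the exponent
    is the \<open>d + 2\<close> of \<open>W\<close> below, doubled by the quadratic
    slowdown.\<close>
  have "bounded (\<lambda>k. (4 * 300 * 300 + 4 * 300 + 2) * (T k + hN k + length (bits k) + 2) ^ (2 * (d + 2)))"
    by (rule bounded_poly[OF bounded_add[OF bounded_add[OF S(3) bounded_computable[OF N(3)]] bounded_length_bits[OF S(3)]]])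
  then obtain h where h: "computable h" "\<And>k. (4 * 300 * 300 + 4 * 300 + 2) * s k ^ (2 * (d + 2)) \<le> h k"
    unfolding bounded_def s_def by blast
  have "\<exists>T c. reach M (init [x] k) y T c \<and> halted c \<and>
       (st c = acc_state \<longleftrightarrow> ((x, y), k) \<in> B \<and> f k \<noteq> 0) \<and> T \<le> h k * (length x + 1) ^ (2 * (d + 2))"
    if y: "length y = f k * clog (length x)" for x y k
  proof -
    obtain c where c: "reach S (init [] k) (replicate (f k) False) (T k) c" "halted c" using S(2) by blast
    obtain bs t c' where c': "reach N (init [x, y] k) bs t c'" "halted c'" "t \<le> hN k * (length x + length y + 1) ^ d"
       "st c' = acc_state \<longleftrightarrow> ((x, y), k) \<in> B"
      using N(4) by blast
    let ?n = "length x" and ?L = "length (bits k)" and ?c = "clog (length x)"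
    obtain \<sigma> t' where t': "t' \<le> 20 * (T k + t) + 20 * ?L + 4 * ?n * ?n + 20 * ?n + 4 * length y + f k * (7 * ?c + 8) + 150"
      "exec (guess S N) (start_store [x] k) y t' \<sigma>" "\<sigma> 0 \<noteq> [] \<longleftrightarrow> ((x, y), k) \<in> B \<and> f k \<noteq> 0"
      using runs_guess[OF S(1) c N(1,2) c'(1,2) y] c'(4) unfolding runs_def by blast
    obtain T' cf where T': "reach M (init [x] k) y T' cf" "halted cf" "st cf = acc_state \<longleftrightarrow> \<sigma> 0 \<noteq> []"
      "T' \<le> tm_time (length (input_syms [x] k)) t' + 2"
      using M(2)[OF t'(2)] by blast
    \<comment> \<open>\<open>V\<close> dominates the lengths of \<open>k\<close>, \<open>x\<close>
      and \<open>y\<close>, the time of the ticker and \<open>hN k\<close>. The power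
      \<open>d + 2\<close> is at least 2, for counting \<open>x\<close> in quadratic time, and at
      least \<open>d + 1\<close>, for the time of the decider of \<open>B\<close>.\<close>
    define V where "V = s k * (?n + 1)"
    define W where "W = V ^ (d + 2)"
    have fT: "f k \<le> T k" using reach_length[OF c(1)] by simp
    have c1: "?c \<le> ?n + 1" by (rule clog_le)
    have V1: "1 \<le> V" by (simp add: V_def s_def)
    define v1 v2 v3 where "v1 = T k * (?n + 1)" and "v2 = hN k * (?n + 1)" and "v3 = ?L * (?n + 1)"
    have Ve: "V = v1 + v2 + v3 + 2 * (?n + 1)"
      by (simp only: V_def s_def distrib_right v1_def v2_def v3_def)
    have mono: "T k \<le> v1" "hN k \<le> v2" "?L \<le> v3" by (simp_all add: v1_def v2_def v3_def)
    have y1: "length y \<le> v1" unfolding y v1_def using fT c1 by (intro mult_le_mono)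
    have yV: "?n + length y + 1 \<le> V" using y1 Ve by arith
    have LV: "?L \<le> V" "T k \<le> V" "hN k \<le> V" "f k \<le> V" "?n + 1 \<le> V" "length y \<le> V"
      using Ve mono fT y1 by arith+
    have VW: "V \<le> W" "V * V \<le> W" "V ^ (d + 1) \<le> W" "1 \<le> W"
      unfolding W_def using V1 self_le_power[OF V1, of "d + 2"] power_increasing[OF _ V1, of 2 "d + 2"]
        power_increasing[OF _ V1, of "d + 1" "d + 2"] one_le_power[OF V1] by (simp_all add: power2_eq_square)
    have "t \<le> V * V ^ d" using c'(3) LV(3) power_mono[OF yV, of d] by (meson le_trans mult_le_mono zero_le)
    then have tW: "t \<le> W" using VW(3) by simp
    have nW: "4 * ?n * ?n \<le> 4 * W"
    proof -
      have "?n * ?n \<le> V * V" using LV(5) by (intro mult_le_mono) auto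
      then show ?thesis using VW(2) by (simp add: mult.assoc)
    qed
    have fW: "f k * (7 * ?c + 8) \<le> 15 * W"
    proof -
      have "f k * ?c \<le> V" using LV(6) y by simp
      moreover have "f k * (7 * ?c + 8) = 7 * (f k * ?c) + 8 * f k" by (simp add: algebra_simps)
      ultimately show ?thesis using LV(4) VW(1) by arith
    qed
    have "t' \<le> 300 * W"
    proof -
      have "?L \<le> W" "T k \<le> W" "?n \<le> W" "length y \<le> W" using LV VW(1) by auto
      then have "t' \<le> 20 * (W + W) + 20 * W + 4 * W + 20 * W + 4 * W + 15 * W + 150 * W"
        using tW nW fW VW(4) by (intro order_trans[OF t'(1)] add_mono mult_left_mono) simp_all
      then show ?thesis by simp
    qed
    moreover have "length (input_syms [x] k) \<le> 300 * W" using LV VW by (simp add: input_syms_1)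
    ultimately have "T' \<le> (4 * 300 * 300 + 4 * 300 + 2) * W\<^sup>2"
      using tm_time_le[of _ 300 W t'] VW(4) T'(4) by (meson order_trans)
    also have "W\<^sup>2 = s k ^ (2 * (d + 2)) * (?n + 1) ^ (2 * (d + 2))"
      by (simp only: W_def V_def power_mult_distrib power_mult[symmetric] mult.commute[of 2])
    also have "(4 * 300 * 300 + 4 * 300 + 2) * (s k ^ (2 * (d + 2)) * (?n + 1) ^ (2 * (d + 2))) \<le> h k * (?n + 1) ^ (2 * (d + 2))"
      using h(2)[of k] by (metis mult.assoc mult_le_mono1)
    finally show ?thesis using T'(1,2,3) t'(3) by blast
  qed
  then show thesis using that M(1) h(1) by blast
qed

section \<open>The equivalences\<close>

text \<open>Any run, finished or not, is comparable with the halting run for some string of length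
  \<open>P\<close>. Its time and choices are therefore bounded by that run, and if it halts it is
  that run.\<close>

lemma uniform_paths:
  assumes y: "\<And>y. length y = P \<Longrightarrow> \<exists>T c. reach N (init [x] k) y T c \<and> halted c \<and> (st c = acc_state \<longleftrightarrow> Q y) \<and> T \<le> b"
  shows "reach N (init [x] k) bs t c \<Longrightarrow> t \<le> b \<and> length bs \<le> P"
    and "acc_paths N x k = {y. length y = P \<and> Q y}"
    and "rej_paths N x k = {y. length y = P \<and> \<not> Q y}"
proof -
  have *: "t \<le> b \<and> length bs \<le> P \<and> (halted c \<longrightarrow> length bs = P \<and> (st c = acc_state \<longleftrightarrow> Q bs))"
    if r: "reach N (init [x] k) bs t c" for bs t c
  proof -
    \<comment> \<open>Padding makes the choices long enough to be cut at \<open>P\<close>, whether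
      \<open>bs\<close> is shorter or longer.\<close>
    define l where "l = bs @ replicate P False"
    have "length (take P l) = P" by (simp add: l_def)
    from y[OF this] obtain T c' where c': "reach N (init [x] k) (take P l) T c'" "halted c'" "st c' = acc_state \<longleftrightarrow> Q (take P l)" "T \<le> b"
      by blast
    have "bs @ replicate P False = take P l @ drop P l" unfolding append_take_drop_id l_def ..
    from reach_prefix[OF r c'(1,2) this] show ?thesis using c'(3,4) \<open>length (take P l) = P\<close> by fastforce
  qed
  then show "reach N (init [x] k) bs t c \<Longrightarrow> t \<le> b \<and> length bs \<le> P" by blast
  have acc: "halted c" if "st c = acc_state" for c using that by (simp add: halted_def)
  have rej: "halted c \<and> st c \<noteq> acc_state" if "st c = rej_state" for c
    using that by (simp add: halted_def acc_state_def rej_state_def)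
  show "acc_paths N x k = {y. length y = P \<and> Q y}" using * y acc by (fastforce simp: acc_paths_def)
  show "rej_paths N x k = {y. length y = P \<and> \<not> Q y}" using * y rej by (fastforce simp: rej_paths_def halted_def)
qed

section \<open>Majorities over strings as the common form\<close>

definition majority :: "(bool list \<times> nat) set \<Rightarrow> bool" where
  "majority L \<longleftrightarrow> (\<exists>B f. FPT3 B \<and> computable f \<and> (\<forall>x k. let P = f k * clog (length x) in
     (x, k) \<in> L \<longleftrightarrow> real (card {y. length y = P \<and> ((x, y), k) \<in> B}) \<ge> 2 powr (real P - 1) + 1))"

text \<open>For positive \<open>P\<close> the threshold is an integer just above half of the
  strings. For \<open>P = 0\<close> it is 3/2, which a count of 1 misses although 1 is more than
  half of the strings.\<close>

lemma majority_iff: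
  assumes "0 < P"
  shows "2 powr (real P - 1) + 1 \<le> real n \<longleftrightarrow> 2 ^ P < 2 * n"
proof -
  obtain p where p: "P = Suc p" using assms gr0_implies_Suc by blast
  have "2 powr (real P - 1) + 1 = real (2 ^ p + 1)" by (simp add: p powr_realpow)
  then have "2 powr (real P - 1) + 1 \<le> real n \<longleftrightarrow> 2 ^ p + 1 \<le> n" by (simp only: of_nat_le_iff)
  then show ?thesis by (auto simp: p)
qed

lemma majority_machine:
  assumes "majority L"
  obtains N where "k_restricted N" "\<And>x k. (x, k) \<in> L \<longleftrightarrow> prob_acc N x k > 1/2"
    "\<And>x k. (x, k) \<in> L \<longleftrightarrow> int (num_acc N x k) - int (num_rej N x k) > 0"
proof -
  obtain B f where B: "FPT3 B" "computable f" and L: "\<And>x k P. P = f k * clog (length x) \<Longrightarrow>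
     (x, k) \<in> L \<longleftrightarrow> real (card {y. length y = P \<and> ((x, y), k) \<in> B}) \<ge> 2 powr (real P - 1) + 1"
    using assms unfolding majority_def Let_def by blast
  obtain N h d where N: "wf_tm N" "computable h"
    "\<And>x y k. length y = f k * clog (length x) \<Longrightarrow> \<exists>T c. reach N (init [x] k) y T c \<and> halted c \<and>
       (st c = acc_state \<longleftrightarrow> ((x, y), k) \<in> B \<and> f k \<noteq> 0) \<and> T \<le> h k * (length x + 1) ^ d"
    using guessing_machine[OF B] by blast
  have U: "reach N (init [x] k) bs t c \<Longrightarrow> t \<le> h k * (length x + 1) ^ d \<and> length bs \<le> f k * clog (length x)"
    "acc_paths N x k = {y. length y = f k * clog (length x) \<and> ((x, y), k) \<in> B \<and> f k \<noteq> 0}"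
    "rej_paths N x k = {y. length y = f k * clog (length x) \<and> \<not> (((x, y), k) \<in> B \<and> f k \<noteq> 0)}" for x k bs t c
    by (rule uniform_paths[OF N(3)]; assumption)+
  have "k_restricted N" unfolding k_restricted_def using N(1,2) B(2) U(1) by blast
  moreover have "((x, k) \<in> L \<longleftrightarrow> prob_acc N x k > 1/2) \<and> ((x, k) \<in> L \<longleftrightarrow> int (num_acc N x k) - int (num_rej N x k) > 0)" for x k
  proof -
    define P where "P = f k * clog (length x)"
    let ?a = "{y. length y = P \<and> ((x, y), k) \<in> B \<and> f k \<noteq> 0}"
    have a: "acc_paths N x k = ?a" and r: "rej_paths N x k = {y. length y = P} - ?a"
      using U(2,3)[of x k] by (auto simp: P_def)
    have fin: "finite ?a" by (rule finite_subset[OF _ finite_bool_lists[of P]]) auto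
    have le: "card ?a \<le> 2 ^ P" using card_mono[OF finite_bool_lists[of P], of ?a] by (auto simp: card_bool_lists)
    have L': "(x, k) \<in> L \<longleftrightarrow> 2 ^ P < 2 * card ?a"
    proof (cases "f k = 0")
      case True
      then have P: "P = 0" by (simp add: P_def)
      \<comment> \<open>At most one string is counted, below the threshold 3/2, so no pair with this
        \<open>k\<close> lies in \<open>L\<close>; this agrees with the machine accepting
        nothing.\<close>
      have "card {y. length y = P \<and> ((x, y), k) \<in> B} \<le> card {[] :: bool list}"
        by (rule card_mono) (auto simp: P)
      moreover have "1 < 2 powr (- 1) + (1 :: real)" by (simp add: powr_minus)
      ultimately show ?thesis using L[OF P_def] True P by auto
    next
      case False
      then have "0 < P" using clog_pos[of "length x"] by (simp add: P_def)
      then show ?thesis using L[OF P_def] majority_iff[of P] False by simp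
    qed
    have "prob_acc N x k = (\<Sum>y\<in>?a. (1/2) ^ P)" unfolding prob_acc_def a by (rule sum.cong) auto
    then have p: "prob_acc N x k = real (card ?a) / 2 ^ P" by (simp add: power_divide)
    have "prob_acc N x k > 1/2 \<longleftrightarrow> 2 ^ P < 2 * real (card ?a)" 
    proof -
      have *: "1/2 < C / q \<longleftrightarrow> q < 2 * C" if "0 < q" for C q :: real using that by (simp add: field_simps)
      show ?thesis unfolding p by (rule *) simp
    qed
    also have "\<dots> \<longleftrightarrow> real (2 ^ P) < real (2 * card ?a)" by (simp only: of_nat_mult of_nat_power of_nat_numeral)
    also have "\<dots> \<longleftrightarrow> 2 ^ P < 2 * card ?a" by (rule of_nat_less_iff)
    finally have "prob_acc N x k > 1/2 \<longleftrightarrow> 2 ^ P < 2 * card ?a" .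
    moreover have "num_rej N x k = 2 ^ P - card ?a"
      unfolding num_rej_def r by (subst card_Diff_subset[OF fin]) (auto simp: card_bool_lists)
    then have "int (num_acc N x k) - int (num_rej N x k) = 2 * int (card ?a) - 2 ^ P"
      using le by (simp add: num_acc_def a of_nat_diff)
    moreover have "2 * int (card ?a) - 2 ^ P > 0 \<longleftrightarrow> 2 ^ P < 2 * card ?a"
    proof -
      have "2 ^ P < 2 * card ?a \<longleftrightarrow> int (2 ^ P) < int (2 * card ?a)" by (rule of_nat_less_iff[symmetric])
      then show ?thesis by simp
    qed
    ultimately show ?thesis using L' by (simp only:)
  qed
  ultimately show thesis using that by blast
qed

lemma path_bound:
  assumes "k_restricted M"
  obtains h where "computable h" "\<And>x k bs. bs \<in> acc_paths M x k \<union> rej_paths M x k \<Longrightarrow> length bs < h k * clog (length x)"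
    "\<And>k. 0 < h k"
proof -
  obtain f where f: "computable f" "\<And>x k bs t cf. reach M (init [x] k) bs t cf \<Longrightarrow> length bs \<le> f k * clog (length x)"
    using assms unfolding k_restricted_def by blast
  have "bounded (\<lambda>k. f k + 1)" by (rule bounded_add[OF bounded_computable[OF f(1)] bounded_const[OF bounded_computable[OF f(1)]]])
  then obtain h where h: "computable h" "\<And>k. f k + 1 \<le> h k" unfolding bounded_def by blast
  have lt: "f k * clog (length x) < h k * clog (length x)" for k and x :: "bool list"
    using h(2)[of k] clog_pos[of "length x"] by (intro mult_strict_right_mono) auto
  show thesis
  proof (rule that[OF h(1)])
    show "length bs < h k * clog (length x)" if bs: "bs \<in> acc_paths M x k \<union> rej_paths M x k" for x k bs
    proof -
      obtain t c where "reach M (init [x] k) bs t c" using bs by (auto simp: acc_paths_def rej_paths_def)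
      from le_less_trans[OF f(2)[OF this] lt] show ?thesis .
    qed
    show "0 < h k" for k using h(2)[of k] by simp
  qed
qed

lemma WP_PFPT_majority:
  assumes "WP_PFPT L"
  shows "majority L"
proof -
  obtain M where M: "k_restricted M" and L: "\<And>x k. (x, k) \<in> L \<longleftrightarrow> prob_acc M x k > 1/2"
    using assms unfolding WP_PFPT_def by (metis not_le)
  obtain h where h: "computable h" "\<And>x k bs. bs \<in> acc_paths M x k \<union> rej_paths M x k \<Longrightarrow> length bs < h k * clog (length x)"
    "\<And>k. 0 < h k" using path_bound[OF M] by blast
  have "(x, k) \<in> L \<longleftrightarrow> real (card {y. length y = h k * clog (length x) \<and> ((x, y), k) \<in> outcome M (\<lambda>a _ _. a)})
      \<ge> 2 powr (real (h k * clog (length x)) - 1) + 1" for x k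
  proof -
    let ?P = "h k * clog (length x)"
    define n where "n = card {y. length y = ?P \<and> ((x, y), k) \<in> outcome M (\<lambda>a _ _. a)}"
    have "real n = 2 ^ ?P * prob_acc M x k"
      unfolding n_def by (rule card_accepting[OF M]) (use h(2) in \<open>blast intro: less_imp_le\<close>)
    then have "prob_acc M x k > 1/2 \<longleftrightarrow> 2 ^ ?P < 2 * real n" by (simp add: mult.commute)
    also have "\<dots> \<longleftrightarrow> 2 ^ ?P < 2 * n" by (metis of_nat_less_iff of_nat_mult of_nat_numeral of_nat_power)
    finally show ?thesis using majority_iff[of ?P n] h(3)[of k] clog_pos[of "length x"] L n_def by simp
  qed
  then show ?thesis unfolding majority_def Let_def using FPT3_outcome[OF M] h(1) by blast
qed

text \<open>Among the \<open>2 ^ Suc P\<close> strings, \<open>2 ^ P\<close> plus the gap are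
  accepted, so the gap is positive exactly if these are more than half.\<close>

lemma gap_majority:
  assumes M: "k_restricted M" and L: "\<And>x k. (x, k) \<in> L \<longleftrightarrow> int (num_acc M x k) - int (num_rej M x k) > 0"
  shows "majority L"
proof -
  obtain h where h: "computable h" "\<And>x k bs. bs \<in> acc_paths M x k \<union> rej_paths M x k \<Longrightarrow> length bs < h k * clog (length x)"
    "\<And>k. 0 < h k" using path_bound[OF M] by blast
  have "(x, k) \<in> L \<longleftrightarrow> real (card {y. length y = h k * clog (length x) \<and> ((x, y), k) \<in> outcome M gap_rule})
      \<ge> 2 powr (real (h k * clog (length x)) - 1) + 1" for x k
  proof -
    obtain P where P: "h k * clog (length x) = Suc P" using h(3)[of k] clog_pos[of "length x"] by (metis gr0_implies_Suc mult_pos_pos less_le_trans zero_less_one)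
    define n where "n = card {y. length y = Suc P \<and> ((x, y), k) \<in> outcome M gap_rule}"
    have "length bs \<le> P" if "bs \<in> acc_paths M x k \<union> rej_paths M x k" for bs
      using h(2)[OF that] P by simp
    then have "int n = 2 ^ P + int (num_acc M x k) - int (num_rej M x k)"
      unfolding n_def by (intro card_gap[OF M])
    then have "(x, k) \<in> L \<longleftrightarrow> 2 ^ P < int n" using L by auto
    also have "\<dots> \<longleftrightarrow> 2 ^ P < n" by (metis of_nat_less_iff of_nat_numeral of_nat_power)
    also have "\<dots> \<longleftrightarrow> 2 ^ Suc P < 2 * n" by simp
    finally show ?thesis unfolding P using majority_iff[of "Suc P" n] n_def by simp
  qed
  then show ?thesis unfolding majority_def Let_def using FPT3_outcome[OF M] h(1) by blast
qed

theorem theorem1: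
  fixes L :: "(bool list \<times> nat) set"
  shows "(WP_PFPT L \<longleftrightarrow>
            (\<exists>M. k_restricted M \<and>
               (\<forall>x k. (x, k) \<in> L \<longleftrightarrow> int (num_acc M x k) - int (num_rej M x k) > 0)))
       \<and> (WP_PFPT L \<longleftrightarrow>
            (\<exists>F. GapFPT F \<and> (\<forall>x k. (x, k) \<in> L \<longleftrightarrow> F x k > 0)))
       \<and> (WP_PFPT L \<longleftrightarrow>
            (\<exists>B f. FPT3 B \<and> computable f \<and>
               (\<forall>x k. let P = f k * clog (length x) in
                  (x, k) \<in> L \<longleftrightarrow>
                  real (card {y. length y = P \<and> ((x, y), k) \<in> B}) \<ge> 2 powr (real P - 1) + 1)))"
proof -
  let ?gap = "\<exists>M. k_restricted M \<and> (\<forall>x k. (x, k) \<in> L \<longleftrightarrow> int (num_acc M x k) - int (num_rej M x k) > 0)"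
  have "?gap \<longleftrightarrow> (\<exists>F. GapFPT F \<and> (\<forall>x k. (x, k) \<in> L \<longleftrightarrow> F x k > 0))"
  proof
    assume ?gap
    then obtain M where M: "k_restricted M" "\<forall>x k. (x, k) \<in> L \<longleftrightarrow> int (num_acc M x k) - int (num_rej M x k) > 0" by blast
    then show "\<exists>F. GapFPT F \<and> (\<forall>x k. (x, k) \<in> L \<longleftrightarrow> F x k > 0)" unfolding GapFPT_def
      by (intro exI[of _ "\<lambda>x k. int (num_acc M x k) - int (num_rej M x k)"]) auto
  next
    assume "\<exists>F. GapFPT F \<and> (\<forall>x k. (x, k) \<in> L \<longleftrightarrow> F x k > 0)"
    then show ?gap unfolding GapFPT_def by metis
  qed
  moreover have "WP_PFPT L" if "majority L"
    using majority_machine[OF that] unfolding WP_PFPT_def by (metis not_le)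
  moreover have ?gap if "majority L" using majority_machine[OF that] by metis
  moreover have "majority L" if ?gap using that gap_majority by blast
  \<comment> \<open>\<open>majority L\<close> is the hub: acceptance by probability and by gap each
    imply it, and a machine with paths of equal length gives both back.\<close>
  ultimately show ?thesis using WP_PFPT_majority[of L] unfolding majority_def[symmetric] by blast
qed

end
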